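(* Let $p\ge q\ge 2$ and $\Theta=\{1,\dots,k\}$ with $1\le k<q-1$. Let $(F_0,F_\infty)$ be a pair of transverse flags in $\mathrm{SO}_0(p,q)/P_\Theta$. Then the action of the involution $i$ on $\pi_0(\Omega(F_0)\cap\Omega(F_\infty))$ is trivial.
   Context: $\mathbb{R}^{p,q}$ is $\mathbb{R}^{p+q}$ with a nondegenerate symmetric bilinear form of signature $(p,q)$; $\mathrm{SO}_0(p,q)$ is the identity component of its isometry group. $\mathrm{SO}_0(p,q)/P_{1,\dots,k}$ is the space of flags $F=(F^1\subset\dots\subset F^k)$ of isotropic subspaces with $\dim F^j=j$. Flags $F,G$ are transverse if $F^j\oplus(G^j)^\perp=\mathbb{R}^{p,q}$ for all $1\le j\le k$; $\Omega(F)$ is the set of flags transverse to $F$. Let $U_\Theta$ be the unipotent radical of the stabilizer of $F_\infty$. The map $u\mapsto u\cdot F_0$ is a diffeomorphism $U_\Theta\to\Omega(F_\infty)$; the involution $i(u\cdot F_0)=u^{-1}\cdot F_0$ of $\Omega(F_\infty)$ preserves $\Omega(F_0)\cap\Omega(F_\infty)$ and hence acts on its set of connected components. *)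

theory Defs
  imports "HOL-Analysis.Analysis" "HOL-Algebra.Coset"
begin

section \<open>The pseudo-Euclidean space and its isometry group\<close>

text \<open>A Sylvester basis \<open>P \<union> N\<close> of the ambient space forces nondegeneracy and
  \<open>p + q = CARD('n)\<close>.\<close>

definition symmetric_form_of_signature ::
    "(real^'n \<Rightarrow> real^'n \<Rightarrow> real) \<Rightarrow> nat \<Rightarrow> nat \<Rightarrow> bool" where
  "symmetric_form_of_signature B p q \<longleftrightarrow>
     bilinear B \<and> (\<forall>x y. B x y = B y x) \<and>
     (\<forall>x. (\<forall>y. B x y = 0) \<longrightarrow> x = 0) \<and>
     (\<exists>P N. P \<inter> N = {} \<and> card P = p \<and> card N = q \<and>
        independent (P \<union> N) \<and> span (P \<union> N) = UNIV \<and>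
        (\<forall>x\<in>P \<union> N. \<forall>y\<in>P \<union> N. x \<noteq> y \<longrightarrow> B x y = 0) \<and>
        (\<forall>x\<in>P. B x x > 0) \<and> (\<forall>x\<in>N. B x x < 0))"

definition isometry_group :: "(real^'n \<Rightarrow> real^'n \<Rightarrow> real) \<Rightarrow> (real^'n^'n) set" where
  "isometry_group B = {g. invertible g \<and> (\<forall>x y. B (g *v x) (g *v y) = B x y)}"

definition SO0 :: "(real^'n \<Rightarrow> real^'n \<Rightarrow> real) \<Rightarrow> (real^'n^'n) set" where
  "SO0 B = connected_component_set (isometry_group B) (mat 1)"

definition perp :: "(real^'n \<Rightarrow> real^'n \<Rightarrow> real) \<Rightarrow> (real^'n) set \<Rightarrow> (real^'n) set" where
  "perp B S = {x. \<forall>y\<in>S. B x y = 0}"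


section \<open>Isotropic flags\<close>

text \<open>A flag \<open>F\<^sup>1 \<subset> \<dots> \<subset> F\<^sup>k\<close> is a function on \<open>{1..k}\<close>, made extensional so that equality
  of functions is equality of flags.\<close>

definition flags ::
    "(real^'n \<Rightarrow> real^'n \<Rightarrow> real) \<Rightarrow> nat \<Rightarrow> (nat \<Rightarrow> (real^'n) set) set" where
  "flags B k = {F \<in> extensional {1..k}.
     (\<forall>j\<in>{1..k}. subspace (F j) \<and> dim (F j) = j \<and> (\<forall>x\<in>F j. \<forall>y\<in>F j. B x y = 0)) \<and>
     (\<forall>i\<in>{1..k}. \<forall>j\<in>{1..k}. i \<le> j \<longrightarrow> F i \<subseteq> F j)}"

definition flag_act ::
    "nat \<Rightarrow> real^'n^'n \<Rightarrow> (nat \<Rightarrow> (real^'n) set) \<Rightarrow> (nat \<Rightarrow> (real^'n) set)" where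
  "flag_act k g F = (\<lambda>j\<in>{1..k}. (*v) g ` F j)"

definition transverse ::
    "(real^'n \<Rightarrow> real^'n \<Rightarrow> real) \<Rightarrow> nat \<Rightarrow>
     (nat \<Rightarrow> (real^'n) set) \<Rightarrow> (nat \<Rightarrow> (real^'n) set) \<Rightarrow> bool" where
  "transverse B k F G \<longleftrightarrow>
     (\<forall>j\<in>{1..k}. F j \<inter> perp B (G j) = {0} \<and>
                 {x + y | x y. x \<in> F j \<and> y \<in> perp B (G j)} = UNIV)"

definition Omega ::
    "(real^'n \<Rightarrow> real^'n \<Rightarrow> real) \<Rightarrow> nat \<Rightarrow>
     (nat \<Rightarrow> (real^'n) set) \<Rightarrow> (nat \<Rightarrow> (real^'n) set) set" where
  "Omega B k F = {G \<in> flags B k. transverse B k G F}"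

text \<open>The topology of the homogeneous space \<open>SO0 B / P\<close>: the finest one making the orbit maps
  \<open>g \<mapsto> g \<cdot> F\<close> continuous. When \<open>SO0 B\<close> acts transitively (as it does for \<open>k < q \<le> p\<close>), any single
  \<open>F\<close> yields the same topology, namely the quotient topology transported along
  \<open>g P \<mapsto> g \<cdot> F\<close> with \<open>P\<close> the stabilizer of \<open>F\<close>.\<close>

definition flag_topology ::
    "(real^'n \<Rightarrow> real^'n \<Rightarrow> real) \<Rightarrow> nat \<Rightarrow> (nat \<Rightarrow> (real^'n) set) topology" where
  "flag_topology B k = topology (\<lambda>U. U \<subseteq> flags B k \<and>
     (\<forall>F\<in>flags B k. openin (top_of_set (SO0 B)) {g \<in> SO0 B. flag_act k g F \<in> U}))"

lemma openin_flag_topology: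
  "openin (flag_topology B k) U \<longleftrightarrow> U \<subseteq> flags B k \<and>
     (\<forall>F\<in>flags B k. openin (top_of_set (SO0 B)) {g \<in> SO0 B. flag_act k g F \<in> U})"
proof -
  let ?T = "top_of_set (SO0 B)"
  let ?O = "\<lambda>U. U \<subseteq> flags B k \<and>
     (\<forall>F\<in>flags B k. openin ?T {g \<in> SO0 B. flag_act k g F \<in> U})"
  have inter: "?O (S \<inter> T)" if "?O S" "?O T" for S T
  proof -
    have "{g \<in> SO0 B. flag_act k g F \<in> S \<inter> T} =
        {g \<in> SO0 B. flag_act k g F \<in> S} \<inter> {g \<in> SO0 B. flag_act k g F \<in> T}" for F
      by auto
    then show ?thesis using that by auto
  qed
  have union: "?O (\<Union>K)" if "\<forall>S\<in>K. ?O S" for K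
  proof -
    have "{g \<in> SO0 B. flag_act k g F \<in> \<Union>K} =
        (\<Union>S\<in>K. {g \<in> SO0 B. flag_act k g F \<in> S})" for F
      by auto
    then show ?thesis using that by (auto intro!: openin_Union)
  qed
  have "istopology ?O"
    unfolding istopology_def using inter union by blast
  then show ?thesis
    unfolding flag_topology_def by (simp add: topology_inverse')
qed


section \<open>The unipotent radical and the involution\<close>

definition matrix_group :: "(real^'n^'n) set \<Rightarrow> (real^'n^'n) monoid" where
  "matrix_group H = \<lparr>carrier = H, mult = (**), one = mat 1\<rparr>"

definition unipotent :: "real^'n^'n \<Rightarrow> bool" where
  "unipotent u \<longleftrightarrow> (\<exists>m. \<forall>x. ((\<lambda>v. u *v v - v) ^^ m) x = 0)"

text \<open>\<open>GREATEST\<close> is with respect to inclusion: the largest connected normal subgroup consisting of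
  unipotent elements.\<close>

definition unipotent_radical :: "(real^'n^'n) set \<Rightarrow> (real^'n^'n) set" where
  "unipotent_radical H =
     (GREATEST N. N \<lhd> matrix_group H \<and> connected N \<and> (\<forall>u\<in>N. unipotent u))"

definition flag_stabilizer ::
    "(real^'n \<Rightarrow> real^'n \<Rightarrow> real) \<Rightarrow> nat \<Rightarrow> (nat \<Rightarrow> (real^'n) set) \<Rightarrow> (real^'n^'n) set" where
  "flag_stabilizer B k F = {g \<in> SO0 B. flag_act k g F = F}"

text \<open>The map \<open>u \<cdot> F0 \<mapsto> u\<^sup>-\<^sup>1 \<cdot> F0\<close> for \<open>u\<close> in the unipotent radical at \<open>Finf\<close>; meaningful for
  transverse \<open>F0\<close>, \<open>Finf\<close> and \<open>F \<in> Omega B k Finf\<close>, where \<open>u\<close> exists and is unique.\<close>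

definition flag_involution ::
    "(real^'n \<Rightarrow> real^'n \<Rightarrow> real) \<Rightarrow> nat \<Rightarrow> (nat \<Rightarrow> (real^'n) set) \<Rightarrow>
     (nat \<Rightarrow> (real^'n) set) \<Rightarrow> (nat \<Rightarrow> (real^'n) set) \<Rightarrow> (nat \<Rightarrow> (real^'n) set)" where
  "flag_involution B k F0 Finf F =
     (let U = unipotent_radical (flag_stabilizer B k Finf);
          u = inv_into U (\<lambda>u. flag_act k u F0) F
      in flag_act k (matrix_inv u) F0)"

end

theory Submission
  imports Defs
begin

text \<open>Choose frames \<open>e\<close>, \<open>f\<close> adapted to the two flags with \<open>B (e i) (f l) = \<delta>\<^sub>i\<^sub>l\<close>. The unipotent
  radical \<open>U\<close> of the stabilizer of the second flag acts simply transitively on the flags transverse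
  to it, and \<open>u \<cdot> F0\<close> is transverse to \<open>F0\<close> iff all leading minors of the matrix
  \<open>B (e i) (u (e l))\<close> are nonzero, i.e. iff Gaussian elimination without exchanges yields nonzero
  pivots. Replacing \<open>u\<close> by its inverse transposes this matrix and so preserves the signs of the
  pivots; hence it suffices that the elements of \<open>U\<close> with prescribed pivot signs form a connected
  set. Write \<open>u\<close> as a product of Siegel transformations, one for each \<open>j < k\<close>. Once the first
  factors are fixed, the sign of the next pivot cuts out of the parameter space of the next factor
  either a half-space or one side of an affine light cone. Both are connected because at least two
  positive and two negative directions remain, and this is where \<open>k < q - 1\<close> enters. The
  parameters at which a later fibre might degenerate lie in a subspace of codimension at least
  three, whose removal does not disconnect.\<close>

section \<open>Pivots of Gaussian elimination and isometries\<close>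

text \<open>The set of matrices with prescribed pivot signs has no evident product structure: its
  fibre over one Siegel parameter is again such a set, but for another flag, possibly in bad
  position. The induction therefore runs over arbitrary isotropic families \<open>y\<close> in place
  of \<open>e\<close> and carries only an independence condition, which all but a thin set of
  parameters preserve. The codimension of that set comes from a count of generators, with
  \<open>CARD('n) = p + q\<close> at least \<open>2 * k + 4\<close>.

  A second obstacle is that the unipotent radical is defined as a greatest subgroup, so the explicit
  group \<open>unip\<close> must be shown to contain every normal connected unipotent subgroup of
  the stabilizer. Such a subgroup is conjugated by hyperbolic rotations of the middle space
  \<open>Hs k\<close>; a limit in which the rotations degenerate, and then commutators with them,
  show that its elements act trivially on \<open>perp B (FF k)\<close> modulo \<open>FF k\<close>.

  The topology on flags enters through the continuity of orbit maps: connected sets of matrices in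
  \<open>SO0 B\<close> have connected images.\<close>

definition schur :: "nat \<Rightarrow> (nat \<Rightarrow> nat \<Rightarrow> real) \<Rightarrow> nat \<Rightarrow> nat \<Rightarrow> real" where
  "schur j a = (\<lambda>i l. a i l - a i j * a j l / a j j)"

text \<open>Only the sign of \<open>s j\<close> matters. The Schur complement keeps the labels of
  rows and columns, so the recursion advances the starting index \<open>j\<close> while
  \<open>m\<close> counts the remaining steps.\<close>

fun pivots :: "nat \<Rightarrow> nat \<Rightarrow> (nat \<Rightarrow> real) \<Rightarrow> (nat \<Rightarrow> nat \<Rightarrow> real) \<Rightarrow> bool" where
  "pivots 0 j s a = True"
| "pivots (Suc m) j s a = (0 < s j * a j j \<and> pivots m (Suc j) s (schur j a))"

text \<open>The Schur complement commutes with transposition, and pivots sit on the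
  diagonal.\<close>

lemma pivots_transpose: "pivots m j s (\<lambda>i l. a l i) = pivots m j s a"
proof (induction m arbitrary: j a)
  case (Suc m)
  have "schur j (\<lambda>i l. a l i) = (\<lambda>i l. schur j a l i)"
    by (simp add: schur_def mult.commute)
  then show ?case using Suc[of "Suc j" "schur j a"] by simp
qed simp

lemma pivots_cong:
  assumes "\<And>i l. i \<in> {j..<j+m} \<Longrightarrow> l \<in> {j..<j+m} \<Longrightarrow> a i l = b i l"
    and "\<And>i. i \<in> {j..<j+m} \<Longrightarrow> s i = t i"
  shows "pivots m j s a = pivots m j t b"
  using assms
proof (induction m arbitrary: j a b)
  case (Suc m)
  have "pivots m (Suc j) s (schur j a) = pivots m (Suc j) t (schur j b)"
    by (rule Suc.IH) (use Suc.prems in \<open>auto simp: schur_def\<close>)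
  moreover have "a j j = b j j" "s j = t j" using Suc.prems by auto
  ultimately show ?case by simp
qed simp

text \<open>Each pivot is a rational function of the entries whose denominators are earlier pivots,
  so it is continuous where those are nonzero, and a strict sign condition is open.\<close>

lemma pivots_eventually:
  assumes "\<And>i l. ((\<lambda>t. A t i l) \<longlongrightarrow> a i l) F" and "pivots m j s a"
  shows "\<forall>\<^sub>F t in F. pivots m j s (A t)"
  using assms
proof (induction m arbitrary: j A a)
  case (Suc m)
  have nz: "a j j \<noteq> 0" using Suc.prems(2) by auto
  have "((\<lambda>t. s j * A t j j) \<longlongrightarrow> s j * a j j) F"
    by (intro tendsto_intros Suc.prems(1))
  then have 1: "\<forall>\<^sub>F t in F. 0 < s j * A t j j"
    using Suc.prems(2) by (auto dest: order_tendstoD(1))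
  have "((\<lambda>t. schur j (A t) i l) \<longlongrightarrow> schur j a i l) F" for i l
    unfolding schur_def by (intro tendsto_intros Suc.prems(1) nz)
  then have "\<forall>\<^sub>F t in F. pivots m (Suc j) s (schur j (A t))"
    using Suc.prems(2) by (intro Suc.IH) auto
  with 1 show ?case by eventually_elim simp
qed simp

text \<open>Nonvanishing of the leading minors, written as triviality of kernels: this avoids
  determinants of varying size and is the form in which transversality of flags produces it.\<close>

definition leading_nonsing :: "nat \<Rightarrow> nat \<Rightarrow> (nat \<Rightarrow> nat \<Rightarrow> real) \<Rightarrow> bool" where
  "leading_nonsing m j a \<longleftrightarrow> (\<forall>r\<le>m. \<forall>c. (\<forall>i\<in>{j..<j+r}. (\<Sum>l\<in>{j..<j+r}. a i l * c l) = 0)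
      \<longrightarrow> (\<forall>l\<in>{j..<j+r}. c l = 0))"

lemma nonsingD:
  assumes "leading_nonsing m j a" "r \<le> m" "\<And>i. i \<in> {j..<j+r} \<Longrightarrow> (\<Sum>l\<in>{j..<j+r}. a i l * c l) = 0"
    "l \<in> {j..<j+r}"
  shows "c l = 0"
  using assms unfolding leading_nonsing_def by auto

lemma schur_sum:
  assumes "a j j \<noteq> 0" "finite L"
  shows "(\<Sum>l\<in>L. schur j a i l * c l) =
    (\<Sum>l\<in>L. a i l * c l) - a i j / a j j * (\<Sum>l\<in>L. a j l * c l)"
  by (simp add: schur_def left_diff_distrib sum_subtractf sum_distrib_left algebra_simps)

lemma sum_head_Suc: "(\<Sum>l\<in>{j..<j + Suc r}. g l) = g j + (\<Sum>l\<in>{Suc j..<Suc j + r}. g l :: real)"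
  by (simp add: sum.atLeast_Suc_lessThan)

text \<open>Row \<open>j\<close> expresses \<open>c j\<close> through the other coordinates of a
  kernel vector; substituting this in the remaining rows leaves a kernel vector of the Schur
  complement, which vanishes by induction.\<close>

lemma pivots_imp_leading_nonsing: "pivots m j s a \<Longrightarrow> leading_nonsing m j a"
proof (induction m arbitrary: j a)
  case 0 then show ?case by (simp add: leading_nonsing_def)
next
  case (Suc m)
  have nz: "a j j \<noteq> 0" and IH: "leading_nonsing m (Suc j) (schur j a)"
    using Suc by auto
  show ?case
    unfolding leading_nonsing_def
  proof (intro allI impI)
    fix r c assume r: "r \<le> Suc m"
      and eq: "\<forall>i\<in>{j..<j+r}. (\<Sum>l\<in>{j..<j+r}. a i l * c l) = 0"
    show "\<forall>l\<in>{j..<j+r}. c l = 0"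
    proof (cases r)
      case (Suc r')
      let ?L = "{Suc j..<Suc j + r'}"
      have e: "a i j * c j + (\<Sum>l\<in>?L. a i l * c l) = 0" if "i \<in> {j..<j + Suc r'}" for i
        using eq that unfolding Suc sum_head_Suc by blast
      have ej: "a j j * c j + (\<Sum>l\<in>?L. a j l * c l) = 0"
        by (rule e) simp
      have sl: "x + t = 0 \<Longrightarrow> t = - x" for x t :: real by simp
      have "(\<Sum>l\<in>?L. schur j a i l * c l) = 0" if "i \<in> ?L" for i
      proof -
        have ei: "a i j * c j + (\<Sum>l\<in>?L. a i l * c l) = 0"
          by (rule e) (use that in auto)
        have "(\<Sum>l\<in>?L. schur j a i l * c l) = - (a i j * c j) - a i j / a j j * (- (a j j * c j))"
          unfolding schur_sum[where a=a, OF nz finite_atLeastLessThan]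
          by (simp only: sl[OF ei] sl[OF ej])
        then show ?thesis using nz by simp
      qed
      then have s0: "\<And>i. i \<in> ?L \<Longrightarrow> (\<Sum>l\<in>?L. schur j a i l * c l) = 0" .
      have "r' \<le> m" using r Suc by simp
      then have z: "\<forall>l\<in>?L. c l = 0"
        using nonsingD[OF IH _ s0] by blast
      then have "(\<Sum>l\<in>?L. a j l * c l) = 0" by simp
      then have "c j = 0" using ej nz by simp
      show ?thesis
      proof
        fix l assume "l \<in> {j..<j + r}"
        then show "c l = 0" using z \<open>c j = 0\<close> Suc by (cases "l = j") auto
      qed
    qed simp
  qed
qed

lemma leading_nonsing_imp_pivots: "leading_nonsing m j a \<Longrightarrow> \<exists>s. pivots m j s a"
proof (induction m arbitrary: j a)
  case (Suc m)
  have nz: "a j j \<noteq> 0"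
  proof
    assume "a j j = 0"
    then show False
      using nonsingD[OF Suc.prems, of 1 "\<lambda>_. 1" j] by simp
  qed
  have "leading_nonsing m (Suc j) (schur j a)"
    unfolding leading_nonsing_def
  proof (intro allI impI)
    fix r c assume r: "r \<le> m"
    let ?L = "{Suc j..<Suc j + r}"
    assume eq: "\<forall>i\<in>?L. (\<Sum>l\<in>?L. schur j a i l * c l) = 0"
    \<comment> \<open>Coordinate \<open>j\<close> is chosen to solve row \<open>j\<close>, so that a
      kernel vector of the Schur complement extends to one of the full block.\<close>
    define d where "d = c(j := - (\<Sum>l\<in>?L. a j l * c l) / a j j)"
    have d: "(\<Sum>l\<in>?L. a i l * d l) = (\<Sum>l\<in>?L. a i l * c l)" for i
      by (rule sum.cong) (auto simp: d_def)
    have "(\<Sum>l\<in>{j..<j + Suc r}. a i l * d l) = 0" if "i \<in> {j..<j + Suc r}" for i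
    proof (cases "i = j")
      case True
      then show ?thesis unfolding sum_head_Suc d using nz by (simp add: d_def)
    next
      case False
      then have "i \<in> ?L" using that by auto
      then have "(\<Sum>l\<in>?L. a i l * c l) - a i j / a j j * (\<Sum>l\<in>?L. a j l * c l) = 0"
        using eq schur_sum[where a=a, OF nz finite_atLeastLessThan] by metis
      then show ?thesis unfolding sum_head_Suc d by (simp add: d_def)
    qed
    moreover have "Suc r \<le> Suc m" using r by simp
    ultimately have dz: "d l = 0" if "l \<in> {j..<j + Suc r}" for l
      using nonsingD[OF Suc.prems, of "Suc r" d l] that by blast
    show "\<forall>l\<in>?L. c l = 0"
    proof
      fix l assume "l \<in> ?L"
      then show "c l = 0" using dz[of l] by (simp add: d_def)
    qed
  qed
  then obtain s where s: "pivots m (Suc j) s (schur j a)" using Suc.IH by blast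
  \<comment> \<open>Taking the entry itself as its sign makes the product a square; the later steps
    do not read index \<open>j\<close>.\<close>
  have "pivots m (Suc j) (s(j := a j j)) (schur j a)"
    using s by (subst pivots_cong[where t = s and b = "schur j a"]) auto
  then have "pivots (Suc m) j (s(j := a j j)) a"
    using nz by (simp add: zero_less_mult_iff) linarith
  then show ?case by blast
qed simp

section \<open>Nondegenerate symmetric forms and their isometries\<close>

locale sym_form =
  fixes B :: "real^'n \<Rightarrow> real^'n \<Rightarrow> real"
  assumes bil: "bilinear B" and sym: "B x y = B y x"
    and nondeg: "(\<And>y. B x y = 0) \<Longrightarrow> x = 0"
begin

lemma Bs [simp]:
  "B (x + y) z = B x z + B y z" "B z (x + y) = B z x + B z y"
  "B (x - y) z = B x z - B y z" "B z (x - y) = B z x - B z y"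
  "B (- x) z = - B x z" "B z (- x) = - B z x"
  "B (c *\<^sub>R x) z = c * B x z" "B z (c *\<^sub>R x) = c * B z x"
  "B 0 z = 0" "B z 0 = 0"
  using bil
  by (simp_all add: bilinear_ladd bilinear_radd bilinear_lsub bilinear_rsub bilinear_lneg
      bilinear_rneg bilinear_lmul bilinear_rmul bilinear_lzero bilinear_rzero)

lemma B_sum: "B (sum g A) z = (\<Sum>i\<in>A. B (g i) z)" "B z (sum g A) = (\<Sum>i\<in>A. B z (g i))"
  by (induction A rule: infinite_finite_induct) auto

lemma B_eqI: "(\<And>z. B x z = B y z) \<Longrightarrow> x = y"
  using nondeg[of "x - y"] by simp

lemma bounded_bilinear_B: "bounded_bilinear B"
  using bil by (simp add: bilinear_conv_bounded_bilinear)

lemmas tendsto_B = bounded_bilinear.tendsto[OF bounded_bilinear_B]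
lemmas continuous_on_B = bounded_bilinear.continuous_on[OF bounded_bilinear_B]

lemma subspace_perp: "subspace (perp B S)"
  by (auto simp: subspace_def perp_def)

lemma perp_span: "perp B (span S) = perp B S"
proof
  show "perp B S \<subseteq> perp B (span S)"
  proof
    fix x assume x: "x \<in> perp B S"
    have "span S \<subseteq> {y. B x y = 0}"
      by (rule span_minimal) (use x in \<open>auto simp: perp_def subspace_def\<close>)
    then show "x \<in> perp B (span S)" by (auto simp: perp_def)
  qed
qed (use span_superset in \<open>auto simp: perp_def\<close>)

text \<open>The operator \<open>A\<close> turns \<open>B\<close> into the inner product, so
  \<open>perp B T\<close> is the Euclidean orthogonal complement of the image of \<open>T\<close>
  under \<open>A\<close>, whose dimension is at most that of \<open>T\<close>.\<close>

lemma dim_perp_ge: "CARD('n) \<le> dim (perp B T) + dim T"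
proof -
  define A where "A y = (\<Sum>b\<in>Basis. B b y *\<^sub>R b)" for y
  have lin: "linear A"
    by (rule linearI) (auto simp: A_def scaleR_add_left sum.distrib scaleR_sum_right)
  have A: "B x y = x \<bullet> A y" for x y
  proof -
    have "B x y = B (\<Sum>b\<in>Basis. (x \<bullet> b) *\<^sub>R b) y" by (simp add: euclidean_representation)
    also have "\<dots> = x \<bullet> A y"
      by (simp add: B_sum A_def inner_sum_right mult.commute)
    finally show ?thesis .
  qed
  have "perp B T = {y. \<forall>x\<in>span (A ` T). orthogonal x y}"
  proof (intro Set.set_eqI iffI)
    fix y assume "y \<in> perp B T"
    then have "orthogonal y x" if "x \<in> A ` T" for x
      using that by (auto simp: perp_def A orthogonal_def)
    then show "y \<in> {y. \<forall>x\<in>span (A ` T). orthogonal x y}"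
      using orthogonal_to_span orthogonal_commute by blast
  next
    fix y assume "y \<in> {y. \<forall>x\<in>span (A ` T). orthogonal x y}"
    then have "orthogonal (A x) y" if "x \<in> T" for x
      using that by (auto intro: span_base)
    then show "y \<in> perp B T" by (auto simp: perp_def A orthogonal_def inner_commute)
  qed
  then have "dim (perp B T) + dim (span (A ` T)) = dim (UNIV :: (real^'n) set)"
    using dim_subspace_orthogonal_to_vectors[of "span (A ` T)" UNIV] by simp
  moreover have "dim (A ` T) \<le> dim T" by (rule dim_image_le[OF lin])
  ultimately show ?thesis by simp
qed

lemma dim_Int_perp_ge:
  assumes "subspace S"
  shows "dim S \<le> dim (S \<inter> perp B T) + dim T"
proof -
  have "dim {x + y |x y. x \<in> S \<and> y \<in> perp B T} + dim (S \<inter> perp B T) = dim S + dim (perp B T)"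
    using assms subspace_perp by (rule dim_sums_Int)
  moreover have "dim {x + y |x y. x \<in> S \<and> y \<in> perp B T} \<le> CARD('n)"
    using dim_subset_UNIV[of "{x + y |x y. x \<in> S \<and> y \<in> perp B T}"] by simp
  ultimately show ?thesis using dim_perp_ge[of T] by linarith
qed

lemma ex_nonzero_perp:
  assumes "subspace S" "finite T" "card T < dim S"
  obtains c where "c \<in> S" "c \<noteq> 0" "\<And>t. t \<in> T \<Longrightarrow> B c t = 0"
proof -
  have "dim T \<le> card T" using assms(2) by (simp add: dim_le_card')
  then have "dim (S \<inter> perp B T) > 0" using dim_Int_perp_ge[OF assms(1), of T] assms(3) by linarith
  then obtain c where "c \<in> S \<inter> perp B T" "c \<noteq> 0"
    by (metis dim_eq_0 gr_implies_not0 singletonI subset_iff)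
  then show ?thesis using that by (auto simp: perp_def)
qed

lemma sums_perp_UNIV:
  assumes "subspace S" "S \<inter> perp B T = {0}" "dim T \<le> dim S"
  shows "{x + y |x y. x \<in> S \<and> y \<in> perp B T} = UNIV"
proof -
  have "dim {x + y |x y. x \<in> S \<and> y \<in> perp B T} + dim (S \<inter> perp B T) = dim S + dim (perp B T)"
    using assms(1) subspace_perp by (rule dim_sums_Int)
  then have "dim {x + y |x y. x \<in> S \<and> y \<in> perp B T} \<ge> CARD('n)"
    using assms(2,3) dim_perp_ge[of T] by simp
  moreover have "subspace {x + y |x y. x \<in> S \<and> y \<in> perp B T}"
    using assms(1) subspace_perp by (rule subspace_sums)
  ultimately show ?thesis
    by (intro subspace_dim_equal) auto
qed

text \<open>Nondegeneracy makes a form-preserving matrix injective, hence invertible.\<close>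

lemma isometryI:
  assumes "\<And>x y. B (g *v x) (g *v y) = B x y"
  shows "g \<in> isometry_group B"
proof -
  have "inj ((*v) g)"
  proof (rule injI)
    fix x y assume "g *v x = g *v y"
    then have "B x z = B y z" for z using assms[of x z] assms[of y z] by simp
    then show "x = y" by (rule B_eqI)
  qed
  then have "\<exists>h. h ** g = mat 1"
    by (simp add: matrix_left_invertible_injective)
  then have "invertible g"
    by (simp add: invertible_left_inverse)
  then show ?thesis using assms by (simp add: isometry_group_def)
qed

lemma isometryD: "g \<in> isometry_group B \<Longrightarrow> B (g *v x) (g *v y) = B x y"
  by (simp add: isometry_group_def)

lemma isometry_inverse:
  assumes "g \<in> isometry_group B"
  shows "matrix_inv g ** g = mat 1" "g ** matrix_inv g = mat 1"
    "g *v (matrix_inv g *v x) = x" "matrix_inv g *v (g *v x) = x"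
proof -
  have i: "invertible g" using assms by (simp add: isometry_group_def)
  show 1: "matrix_inv g ** g = mat 1" "g ** matrix_inv g = mat 1"
    using someI_ex[OF i[unfolded invertible_def]] unfolding matrix_inv_def by auto
  show "g *v (matrix_inv g *v x) = x" "matrix_inv g *v (g *v x) = x"
    by (simp_all add: matrix_vector_mul_assoc 1)
qed

lemma isometry_mult: "g \<in> isometry_group B \<Longrightarrow> h \<in> isometry_group B \<Longrightarrow> g ** h \<in> isometry_group B"
  by (rule isometryI) (simp add: isometryD flip: matrix_vector_mul_assoc)

lemma isometry_inv: "g \<in> isometry_group B \<Longrightarrow> matrix_inv g \<in> isometry_group B"
  by (rule isometryI) (metis isometryD isometry_inverse(3))

lemma isometry_one: "mat 1 \<in> isometry_group B"
  by (rule isometryI) simp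

text \<open>The inverse is the adjoint with respect to \<open>B\<close>. This is what turns
  inversion into transposition of the matrix \<open>B (e i) (u *v e l)\<close>.\<close>

lemma isometry_inv_swap: "g \<in> isometry_group B \<Longrightarrow> B (matrix_inv g *v x) y = B x (g *v y)"
  by (metis isometryD isometry_inverse(3))

end

lemma connected_mult_left:
  fixes g :: "real^'n^'n"
  assumes "connected S"
  shows "connected ((**) g ` S)"
  by (rule connected_continuous_image[OF _ assms])
     (auto simp: matrix_matrix_mult_def intro!: continuous_intros)

context sym_form begin

lemma SO0_isometry: "g \<in> SO0 B \<Longrightarrow> g \<in> isometry_group B"
  unfolding SO0_def using connected_component_subset by blast

lemma SO0_one: "mat 1 \<in> SO0 B"
  by (simp add: SO0_def isometry_one)

text \<open>The tool for membership in \<open>SO0 B\<close>: closure under the group operations, the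
  elements of \<open>unip\<close> and the boosts are all reached by a connected family through a
  known element.\<close>

lemma SO0_connected_subset:
  assumes "connected S" "S \<subseteq> isometry_group B" "x \<in> S" "x \<in> SO0 B"
  shows "S \<subseteq> SO0 B"
proof -
  have "connected_component_set (isometry_group B) x = SO0 B"
    using assms(4) unfolding SO0_def by (metis connected_component_eq)
  then show ?thesis using connected_component_maximal[OF assms(3,1,2)] by simp
qed

lemma SO0_connected: "connected (SO0 B)"
  by (simp add: SO0_def connected_connected_component)

lemma SO0_mult: assumes "g \<in> SO0 B" "h \<in> SO0 B" shows "g ** h \<in> SO0 B"
proof -
  have "(**) g ` SO0 B \<subseteq> SO0 B"
    by (rule SO0_connected_subset[where x = g])
       (use assms SO0_one SO0_isometry isometry_mult connected_mult_left[OF SO0_connected] in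
         \<open>auto intro: image_eqI[where x = "mat 1"]\<close>)
  then show ?thesis using assms by auto
qed

lemma SO0_inv: assumes "g \<in> SO0 B" shows "matrix_inv g \<in> SO0 B"
proof -
  have "(**) (matrix_inv g) ` SO0 B \<subseteq> SO0 B"
  proof (rule SO0_connected_subset[where x = "mat 1"])
    show "mat 1 \<in> (**) (matrix_inv g) ` SO0 B"
      using assms isometry_inverse(1)[OF SO0_isometry[OF assms]] by (metis imageI)
    show "(**) (matrix_inv g) ` SO0 B \<subseteq> isometry_group B"
      using assms by (auto intro!: isometry_mult isometry_inv intro: SO0_isometry)
  qed (use SO0_one connected_mult_left[OF SO0_connected] in auto)
  then show ?thesis using SO0_one by (metis image_subset_iff matrix_mul_rid)
qed

end

section \<open>Adapted frames and Siegel transformations\<close>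

text \<open>\<open>e\<close> will span the flag \<open>F0\<close> and \<open>f\<close> the flag
  \<open>Finf\<close>; together they form \<open>k\<close> hyperbolic pairs. Indices start at
  \<open>0\<close>, so step \<open>j\<close> of a flag is spanned by the vectors of index below
  \<open>j\<close>.\<close>

locale dual_frames = sym_form B for B :: "real^'n \<Rightarrow> real^'n \<Rightarrow> real" +
  fixes k :: nat and e f :: "nat \<Rightarrow> real^'n"
  assumes ee: "i < k \<Longrightarrow> l < k \<Longrightarrow> B (e i) (e l) = 0"
    and ff: "i < k \<Longrightarrow> l < k \<Longrightarrow> B (f i) (f l) = 0"
    and ef: "i < k \<Longrightarrow> l < k \<Longrightarrow> B (e i) (f l) = (if i = l then 1 else 0)"
begin

lemma fe: "i < k \<Longrightarrow> l < k \<Longrightarrow> B (f i) (e l) = (if i = l then 1 else 0)"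
  using ef[of l i] sym[of "f i" "e l"] by auto

lemma dual_frames_swap: "dual_frames B k f e"
  by unfold_locales (use ee ff fe in auto)

definition FF :: "nat \<Rightarrow> (real^'n) set" where
  "FF j = span (f ` {..<j})"

definition Hs :: "nat \<Rightarrow> (real^'n) set" where
  "Hs j = {x. \<forall>i<j. B x (e i) = 0 \<and> B x (f i) = 0}"

definition proj_Hs :: "nat \<Rightarrow> real^'n \<Rightarrow> real^'n" where
  "proj_Hs j x = x - (\<Sum>i<j. B x (f i) *\<^sub>R e i + B x (e i) *\<^sub>R f i)"

lemma subspace_FF: "subspace (FF j)"
  by (simp add: FF_def)

lemma FF_mono: "i \<le> j \<Longrightarrow> FF i \<subseteq> FF j"
  unfolding FF_def by (intro span_mono image_mono) auto

lemma f_in_FF: "i < j \<Longrightarrow> f i \<in> FF j"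
  by (auto simp: FF_def intro: span_base)

lemma FF_expand:
  assumes "x \<in> FF j" "j \<le> k"
  shows "x = (\<Sum>i<j. B x (e i) *\<^sub>R f i)"
proof -
  have "FF j \<subseteq> {x. x = (\<Sum>i<j. B x (e i) *\<^sub>R f i)}"
    unfolding FF_def
  proof (rule span_minimal)
    show "f ` {..<j} \<subseteq> {x. x = (\<Sum>i<j. B x (e i) *\<^sub>R f i)}"
    proof
      fix x assume "x \<in> f ` {..<j}"
      then obtain l where l: "l \<in> {..<j}" "x = f l" by blast
      have "(\<Sum>i<j. B (f l) (e i) *\<^sub>R f i) = (\<Sum>i<j. if i = l then f i else 0)"
        using l assms(2) by (intro sum.cong) (auto simp: fe)
      also have "\<dots> = f l" using l by simp
      finally show "x \<in> {x. x = (\<Sum>i<j. B x (e i) *\<^sub>R f i)}" using l(2) by simp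
    qed
    show "subspace {x. x = (\<Sum>i<j. B x (e i) *\<^sub>R f i)}"
    proof (rule subspaceI)
      fix c x assume x: "x \<in> {x. x = (\<Sum>i<j. B x (e i) *\<^sub>R f i)}"
      have "(\<Sum>i<j. B (c *\<^sub>R x) (e i) *\<^sub>R f i) = c *\<^sub>R (\<Sum>i<j. B x (e i) *\<^sub>R f i)"
        by (simp add: scaleR_sum_right)
      also have "\<dots> = c *\<^sub>R x" using x by simp
      finally show "c *\<^sub>R x \<in> {x. x = (\<Sum>i<j. B x (e i) *\<^sub>R f i)}" by simp
    qed (auto simp: scaleR_add_left sum.distrib)
  qed
  then show ?thesis using assms(1) by blast
qed

lemma FF_isotropic: "x \<in> FF k \<Longrightarrow> y \<in> FF k \<Longrightarrow> B x y = 0"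
  by (subst (1) FF_expand[of x k], simp, simp, subst FF_expand[of y k], simp, simp)
     (simp add: B_sum ff)

lemma perp_FF_iff: "x \<in> perp B (FF j) \<longleftrightarrow> (\<forall>i<j. B x (f i) = 0)"
  unfolding FF_def perp_span by (auto simp: perp_def)

lemma perp_FFD: "x \<in> perp B (FF k) \<Longrightarrow> y \<in> FF k \<Longrightarrow> B x y = 0"
  by (simp add: perp_def)

lemma FF_nested_zero: "x \<in> FF j \<Longrightarrow> j \<le> k \<Longrightarrow> i < k \<Longrightarrow> j \<le> i \<Longrightarrow> B x (e i) = 0"
  by (subst FF_expand[of x j], simp, simp) (simp add: B_sum fe)

lemma subspace_Hs: "subspace (Hs j)"
  by (auto simp: subspace_def Hs_def)

lemma Hs_mono: "i \<le> j \<Longrightarrow> Hs j \<subseteq> Hs i"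
  by (auto simp: Hs_def)

lemma HsD: "x \<in> Hs j \<Longrightarrow> i < j \<Longrightarrow> B x (e i) = 0" "x \<in> Hs j \<Longrightarrow> i < j \<Longrightarrow> B x (f i) = 0"
    "x \<in> Hs j \<Longrightarrow> i < j \<Longrightarrow> B (e i) x = 0" "x \<in> Hs j \<Longrightarrow> i < j \<Longrightarrow> B (f i) x = 0"
  by (simp_all add: Hs_def sym[of _ x])

lemma Hs_0: "Hs 0 = UNIV" by (simp add: Hs_def)

lemma f_in_Hs: "j \<le> i \<Longrightarrow> i < k \<Longrightarrow> f i \<in> Hs j"
  by (auto simp: Hs_def fe ff)

lemma proj_Hs_in: assumes "j \<le> k" shows "proj_Hs j x \<in> Hs j"
proof -
  have "B (proj_Hs j x) (e i) = 0 \<and> B (proj_Hs j x) (f i) = 0" if i: "i < j" for i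
  proof -
    have "(\<Sum>l<j. B x (f l) * B (e l) (e i) + B x (e l) * B (f l) (e i)) = (\<Sum>l<j. if l = i then B x (e i) else 0)"
      by (rule sum.cong) (use i assms in \<open>auto simp: ee fe\<close>)
    moreover have "(\<Sum>l<j. B x (f l) * B (e l) (f i) + B x (e l) * B (f l) (f i)) = (\<Sum>l<j. if l = i then B x (f i) else 0)"
      by (rule sum.cong) (use i assms in \<open>auto simp: ef ff\<close>)
    ultimately show ?thesis using i by (simp add: proj_Hs_def B_sum)
  qed
  then show ?thesis by (simp add: Hs_def)
qed

lemma B_proj_Hs: "z \<in> Hs j \<Longrightarrow> B (proj_Hs j x) z = B x z"
  by (simp add: proj_Hs_def B_sum HsD)

lemma Hs_nondeg:
  assumes "x \<in> Hs j" "j \<le> k" "\<And>w. w \<in> Hs j \<Longrightarrow> B x w = 0"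
  shows "x = 0"
proof (rule nondeg)
  fix y
  have "B x y = B x (proj_Hs j y)"
    using B_proj_Hs[OF assms(1), of y] by (simp add: sym)
  then show "B x y = 0" using assms proj_Hs_in by simp
qed

lemma perp_FF_decomp:
  assumes "x \<in> perp B (FF k)"
  obtains z g where "x = z + g" "z \<in> Hs k" "g \<in> FF k"
proof
  have "proj_Hs k x = x - (\<Sum>i<k. B x (e i) *\<^sub>R f i)"
    using assms by (simp add: proj_Hs_def perp_FF_iff)
  then show "x = proj_Hs k x + (\<Sum>i<k. B x (e i) *\<^sub>R f i)" by simp
  show "(\<Sum>i<k. B x (e i) *\<^sub>R f i) \<in> FF k"
    by (auto intro!: subspace_sum subspace_scale subspace_FF f_in_FF)
qed (simp add: proj_Hs_in)

lemma Hs_perp: "z \<in> Hs k \<Longrightarrow> z \<in> perp B (FF k)"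
  by (simp add: perp_FF_iff HsD)

lemma Hs_Int_FF: "z \<in> Hs k \<Longrightarrow> z \<in> FF k \<Longrightarrow> z = 0"
  by (rule Hs_nondeg) (auto simp: HsD intro: FF_isotropic perp_FFD[OF Hs_perp] simp: sym[of z])

lemma span_frames_eqI:
  assumes "\<And>i. i < k \<Longrightarrow> B x (e i) = B y (e i)" "\<And>i. i < k \<Longrightarrow> B x (f i) = B y (f i)"
    "\<And>z. z \<in> Hs k \<Longrightarrow> B x z = B y z"
  shows "x = y"
proof -
  have "x - y \<in> Hs k" using assms(1,2) by (simp add: Hs_def)
  then have "x - y = 0" by (rule Hs_nondeg) (use assms(3) in auto)
  then show ?thesis by simp
qed

text \<open>The term \<open>B w w / 2\<close> keeps the image \<open>e j + w - (B w w / 2) f j\<close> of \<open>e j\<close> isotropic.\<close>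

definition siegel :: "nat \<Rightarrow> real^'n \<Rightarrow> real^'n \<Rightarrow> real^'n" where
  "siegel j w z = z + B z (f j) *\<^sub>R w - (B z w + B w w / 2 * B z (f j)) *\<^sub>R f j"

definition siegel_matrix :: "nat \<Rightarrow> real^'n \<Rightarrow> real^'n^'n" where
  "siegel_matrix j w = matrix (siegel j w)"

lemma linear_siegel: "linear (siegel j w)"
  by (rule linearI) (simp_all add: siegel_def algebra_simps)

lemma siegel_matrix_apply [simp]: "siegel_matrix j w *v z = siegel j w z"
  by (simp add: siegel_matrix_def matrix_works linear_siegel)

lemma siegel_isometry:
  assumes "w \<in> Hs (Suc j)" "j < k"
  shows "B (siegel j w x) (siegel j w y) = B x y"
  using HsD[OF assms(1), of j] ff[OF assms(2,2)]
  by (simp add: siegel_def algebra_simps sym[of "f j" y] sym[of w y])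

lemma siegel_inverse:
  assumes "w \<in> Hs (Suc j)" "j < k"
  shows "siegel j w (siegel j (- w) z) = z" "siegel j (- w) (siegel j w z) = z"
  using HsD[OF assms(1), of j] ff[OF assms(2,2)]
  by (simp_all add: siegel_def algebra_simps)

lemma siegel_f: "w \<in> Hs (Suc j) \<Longrightarrow> j < k \<Longrightarrow> siegel j w (f j) = f j"
  by (simp add: siegel_def ff HsD)

lemma siegel_e: "w \<in> Hs (Suc j) \<Longrightarrow> j < k \<Longrightarrow> siegel j w (e j) = e j + w - (B w w / 2) *\<^sub>R f j"
  by (simp add: siegel_def ef HsD)

lemma siegel_fix: "w \<in> Hs (Suc j) \<Longrightarrow> j < k \<Longrightarrow> i < j \<Longrightarrow> siegel j w (e i) = e i \<and> siegel j w (f i) = f i"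
  by (simp add: siegel_def ef ff HsD)

lemma siegel_perp_f: "B z (f j) = 0 \<Longrightarrow> siegel j w z = z - B z w *\<^sub>R f j"
  by (simp add: siegel_def)

lemma uminus_Hs: "w \<in> Hs j \<Longrightarrow> - w \<in> Hs j"
  by (simp add: Hs_def)

text \<open>The explicit candidate for the unipotent radical: isometries acting trivially on the
  quotients of consecutive \<open>FF j\<close> and on \<open>perp B (FF k)\<close> modulo
  \<open>FF k\<close>. On the dual quotients above \<open>perp B (FF k)\<close> triviality follows
  by adjointness.\<close>

definition unip :: "(real^'n^'n) set" where
  "unip = {u \<in> isometry_group B. (\<forall>j<k. u *v f j - f j \<in> FF j) \<and>
     (\<forall>x\<in>perp B (FF k). u *v x - x \<in> FF k)}"

lemma unip_isometry: "u \<in> unip \<Longrightarrow> u \<in> isometry_group B"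
  by (simp add: unip_def)

lemma unip_FF_Suc:
  assumes "u \<in> unip" "x \<in> FF (Suc j)" "j < k"
  shows "u *v x - x \<in> FF j"
proof -
  have "FF (Suc j) \<subseteq> {x. u *v x - x \<in> FF j}"
    unfolding FF_def[of "Suc j"]
  proof (rule span_minimal)
    show "f ` {..<Suc j} \<subseteq> {x. u *v x - x \<in> FF j}"
      using assms FF_mono[of _ j] by (fastforce simp: unip_def less_Suc_eq_le)
    show "subspace {x. u *v x - x \<in> FF j}"
    proof (rule subspaceI)
      fix x y assume "x \<in> {x. u *v x - x \<in> FF j}" "y \<in> {x. u *v x - x \<in> FF j}"
      then have "(u *v x - x) + (u *v y - y) \<in> FF j" using subspace_FF by (auto intro: subspace_add)
      then show "x + y \<in> {x. u *v x - x \<in> FF j}"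
        by (simp add: matrix_vector_right_distrib algebra_simps)
    next
      fix c x assume "x \<in> {x. u *v x - x \<in> FF j}"
      then have "c *\<^sub>R (u *v x - x) \<in> FF j" using subspace_FF by (auto intro: subspace_scale)
      then show "c *\<^sub>R x \<in> {x. u *v x - x \<in> FF j}"
        by (simp add: matrix_vector_mult_scaleR algebra_simps)
    qed (simp add: subspace_0 subspace_FF)
  qed
  then show ?thesis using assms(2) by blast
qed

lemma unip_diff_FF:
  assumes "u \<in> unip" "x \<in> FF j" "j \<le> k"
  shows "u *v x - x \<in> FF j"
proof (cases j)
  case 0 then show ?thesis using assms by (simp add: FF_def)
next
  case (Suc i) then show ?thesis using unip_FF_Suc[of u x i] FF_mono[of i j] assms by auto
qed

lemma unip_FF:
  assumes "u \<in> unip" "x \<in> FF j" "j \<le> k"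
  shows "u *v x \<in> FF j"
  using subspace_add[OF subspace_FF unip_diff_FF[OF assms] assms(2)] by simp

lemma unip_perp: "u \<in> unip \<Longrightarrow> x \<in> perp B (FF k) \<Longrightarrow> u *v x - x \<in> FF k"
  by (simp add: unip_def)

lemma unip_one: "mat 1 \<in> unip"
  by (simp add: unip_def isometry_one subspace_0 subspace_FF)

lemma unip_mult:
  assumes "u \<in> unip" "v \<in> unip" shows "u ** v \<in> unip"
proof -
  have d: "(u ** v) *v x - x = u *v (v *v x - x) + (u *v x - x)" for x
    by (simp add: matrix_vector_mul_assoc matrix_vector_mult_diff_distrib)
  have "(u ** v) *v f j - f j \<in> FF j" if "j < k" for j
    unfolding d using assms that by (intro subspace_add subspace_FF unip_FF) (auto simp: unip_def)
  moreover have "(u ** v) *v x - x \<in> FF k" if "x \<in> perp B (FF k)" for x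
    unfolding d using assms that by (intro subspace_add subspace_FF unip_FF) (auto simp: unip_def)
  ultimately show ?thesis
    using isometry_mult[OF unip_isometry unip_isometry, OF assms] by (simp add: unip_def)
qed

text \<open>The difference of \<open>x\<close> and its inverse image is the inverse image of
  \<open>u *v x - x\<close>, which lies one step lower in the flag, so induction on \<open>j\<close>
  applies.\<close>

lemma unip_inv_FF:
  assumes "u \<in> unip" "j \<le> k" "x \<in> FF j"
  shows "matrix_inv u *v x \<in> FF j"
proof -
  note inv = isometry_inverse[OF unip_isometry[OF assms(1)]]
  have "\<forall>x\<in>FF j. matrix_inv u *v x \<in> FF j"
    using assms(2)
  proof (induction j)
    case 0 then show ?case by (simp add: FF_def)
  next
    case (Suc j)
    show ?case
    proof
      fix x assume x: "x \<in> FF (Suc j)"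
      have "matrix_inv u *v (u *v x - x) \<in> FF j"
        using Suc unip_FF_Suc[OF assms(1) x] by auto
      then have "x - matrix_inv u *v x \<in> FF (Suc j)"
        using FF_mono[of j "Suc j"] by (auto simp: matrix_vector_mult_diff_distrib inv)
      then show "matrix_inv u *v x \<in> FF (Suc j)"
        using subspace_diff[OF subspace_FF x] by fastforce
    qed
  qed
  then show ?thesis using assms by blast
qed

lemma unip_inv:
  assumes "u \<in> unip" shows "matrix_inv u \<in> unip"
proof -
  note inv = isometry_inverse[OF unip_isometry[OF assms]]
  have d: "matrix_inv u *v x - x = - (matrix_inv u *v (u *v x - x))" for x
    by (simp add: matrix_vector_mult_diff_distrib inv)
  have "matrix_inv u *v f j - f j \<in> FF j" if "j < k" for j
    unfolding d using assms that by (intro subspace_neg subspace_FF unip_inv_FF) (auto simp: unip_def)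
  moreover have "matrix_inv u *v x - x \<in> FF k" if "x \<in> perp B (FF k)" for x
    unfolding d using assms that by (intro subspace_neg subspace_FF unip_inv_FF) (auto simp: unip_def)
  ultimately show ?thesis
    using isometry_inv[OF unip_isometry, OF assms] by (simp add: unip_def)
qed

text \<open>A descending chain of subgroups from \<open>unip\<close> to the identity; consecutive
  members differ by one Siegel parameter in \<open>Hs (Suc j)\<close>.\<close>

definition UU :: "nat \<Rightarrow> (real^'n^'n) set" where
  "UU j = {u \<in> unip. \<forall>i<j. u *v e i = e i \<and> u *v f i = f i}"

lemma UU_0: "UU 0 = unip" by (simp add: UU_def)

lemma UU_mono: "i \<le> j \<Longrightarrow> UU j \<subseteq> UU i" by (auto simp: UU_def)

lemma UU_mult: "u \<in> UU j \<Longrightarrow> v \<in> UU j \<Longrightarrow> u ** v \<in> UU j"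
  by (simp add: UU_def unip_mult flip: matrix_vector_mul_assoc)

text \<open>On \<open>Hs k\<close> the displacement lies in \<open>FF k\<close> and pairs to zero
  with every fixed \<open>e i\<close>, so it vanishes; both frames are fixed anyway.\<close>

lemma UU_k: "UU k = {mat 1}"
proof
  show "UU k \<subseteq> {mat 1}"
  proof
    fix u assume u: "u \<in> UU k"
    then have fix_ef: "i < k \<Longrightarrow> u *v e i = e i" "i < k \<Longrightarrow> u *v f i = f i" for i
      by (auto simp: UU_def)
    have iso: "B (u *v x) (u *v y) = B x y" for x y
      using u by (auto simp: UU_def intro: isometryD unip_isometry)
    have z: "u *v z = z" if "z \<in> Hs k" for z
    proof -
      have d: "u *v z - z \<in> FF k" using u that by (auto simp: UU_def intro: unip_perp Hs_perp)
      have "B (u *v z - z) (e i) = 0" if "i < k" for i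
        using iso[of z "e i"] fix_ef[OF that] by simp
      then show ?thesis using FF_expand[OF d] by simp
    qed
    have "u *v x = x" for x
    proof (rule span_frames_eqI)
      show "B (u *v x) (e i) = B x (e i)" "B (u *v x) (f i) = B x (f i)" if "i < k" for i
        using iso[of x "e i"] iso[of x "f i"] fix_ef[OF that] by simp_all
      show "B (u *v x) w = B x w" if "w \<in> Hs k" for w
        using iso[of x w] z[OF that] by simp
    qed
    then show "u \<in> {mat 1}" by (simp add: matrix_eq)
  qed
qed (simp add: UU_def unip_one)

lemma siegel_matrix_isometry:
  assumes "w \<in> Hs (Suc j)" "j < k"
  shows "siegel_matrix j w \<in> isometry_group B"
  by (rule isometryI) (simp add: siegel_isometry[OF assms])

lemma siegel_matrix_UU:
  assumes w: "w \<in> Hs (Suc j)" and j: "j < k"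
  shows "siegel_matrix j w \<in> UU j"
proof -
  have "siegel j w (f i) - f i \<in> FF i" if i: "i < k" for i
  proof (cases "j < i")
    case True
    then show ?thesis using i j f_in_FF[of j i]
      by (auto simp: siegel_perp_f ff intro!: subspace_neg subspace_scale subspace_FF)
  next
    case False
    then have "siegel j w (f i) = f i"
      using siegel_f[OF w j] siegel_fix[OF w j, of i] by (cases "i = j") auto
    then show ?thesis by (simp add: subspace_0 subspace_FF)
  qed
  moreover have "siegel j w x - x \<in> FF k" if "x \<in> perp B (FF k)" for x
    using that j f_in_FF[of j k]
    by (auto simp: siegel_perp_f perp_FF_iff intro!: subspace_neg subspace_scale subspace_FF)
  ultimately show ?thesis
    using siegel_fix[OF w j] siegel_matrix_isometry[OF w j] by (auto simp: UU_def unip_def)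
qed

text \<open>The parameter \<open>w\<close> is the component of \<open>u *v e j\<close> in
  \<open>Hs (Suc j)\<close>. The coefficient of \<open>u *v e j\<close> on \<open>e j\<close> is 1,
  and isotropy determines the one on \<open>f j\<close>, so the Siegel transformation agrees with
  \<open>u\<close> on \<open>e j\<close>; dividing it out leaves an element fixing one more
  pair.\<close>

lemma UU_factor:
  assumes u: "u \<in> UU j" and j: "j < k"
  obtains w u' where "w \<in> Hs (Suc j)" "u' \<in> UU (Suc j)" "u = siegel_matrix j w ** u'"
    "siegel j w (e j) = u *v e j"
proof -
  have fix_ef: "i < j \<Longrightarrow> u *v e i = e i" "i < j \<Longrightarrow> u *v f i = f i" for i
    using u by (auto simp: UU_def)
  have un: "u \<in> unip" using u by (simp add: UU_def)
  have iso: "B (u *v x) (u *v y) = B x y" for x y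
    by (auto intro: isometryD unip_isometry un)
  define c where "c = B (u *v e j) (e j)"
  define w where "w = u *v e j - e j - c *\<^sub>R f j"
  have 1: "B (u *v e j) (e i) = 0" "B (u *v e j) (f i) = 0" if "i < j" for i
    using iso[of "e j" "e i"] iso[of "e j" "f i"] fix_ef[OF that] that j by (simp_all add: ee ef)
  \<comment> \<open>The inverse of \<open>u\<close>, which is its adjoint, moves \<open>f j\<close>
    only by an element of \<open>FF j\<close>, and \<open>FF j\<close> is orthogonal to
    \<open>e j\<close>.\<close>
  have 2: "B (u *v e j) (f j) = 1"
  proof -
    have "matrix_inv u *v f j - f j \<in> FF j" using unip_inv[OF un] j by (simp add: unip_def)
    then have "B (matrix_inv u *v f j - f j) (e j) = 0"
      by (rule FF_nested_zero) (use j in auto)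
    then have "B (matrix_inv u *v f j) (e j) = 1" using j by (simp add: fe)
    then show ?thesis using isometry_inv_swap[OF unip_isometry[OF un]] by (simp add: sym)
  qed
  have w: "w \<in> Hs (Suc j)"
    using 1 2 j by (auto simp: Hs_def w_def c_def less_Suc_eq ee ef ff fe)
  have ue: "u *v e j = e j + w + c *\<^sub>R f j" by (simp add: w_def)
  have "B (u *v e j) (u *v e j) = 0" using iso ee j by simp
  then have "2 * c + B w w = 0"
    using HsD[OF w, of j] j unfolding ue by (simp add: ee ef ff fe)
  then have "c = - (B w w / 2)" by simp
  then have se: "siegel j w (e j) = u *v e j"
    using ue siegel_e[OF w j] by simp
  have uf: "u *v f j = f j"
  proof -
    have d: "u *v f j - f j \<in> FF j" using un j by (simp add: unip_def)
    have "B (u *v f j - f j) (e i) = 0" if "i < j" for i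
      using iso[of "f j" "e i"] fix_ef[OF that] that j by (simp add: fe)
    then show ?thesis using FF_expand[OF d] j by simp
  qed
  define u' where "u' = siegel_matrix j (- w) ** u"
  have mw: "- w \<in> Hs (Suc j)" using w by (rule uminus_Hs)
  have u'v: "u' *v x = siegel j (- w) (u *v x)" for x
    by (simp add: u'_def flip: matrix_vector_mul_assoc)
  have "u' \<in> UU j" unfolding u'_def using siegel_matrix_UU[OF mw j] u by (rule UU_mult)
  moreover have "u' *v e j = e j" "u' *v f j = f j"
    using siegel_inverse[OF w j] siegel_f[OF mw j] by (simp_all add: u'v uf flip: se)
  ultimately have "u' \<in> UU (Suc j)" by (auto simp: UU_def less_Suc_eq)
  moreover have "u = siegel_matrix j w ** u'"
    by (simp add: matrix_eq u'v siegel_inverse[OF w j] flip: matrix_vector_mul_assoc)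
  ultimately show ?thesis using that w se by blast
qed

lemma siegel_matrix_mult_UU:
  assumes "w \<in> Hs (Suc j)" "j < k" "u \<in> UU (Suc j)"
  shows "siegel_matrix j w ** u \<in> UU j"
  using UU_mult[OF siegel_matrix_UU[OF assms(1,2)]] UU_mono[of j "Suc j"] assms(3) by auto

lemma continuous_on_siegel: "continuous_on S (\<lambda>w. siegel j w z)"
  unfolding siegel_def divide_inverse by (intro continuous_intros continuous_on_B)

lemma continuous_on_siegel_matrix: "continuous_on S (\<lambda>w. siegel_matrix j w ** u)"
proof -
  have "continuous_on S (\<lambda>w. siegel_matrix j w)"
    unfolding siegel_matrix_def matrix_def
    by (intro continuous_on_vec_lambda continuous_on_component continuous_on_siegel)
  then show ?thesis
    unfolding matrix_matrix_mult_def
    by (intro continuous_on_vec_lambda continuous_intros) auto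
qed

text \<open>Shrinking the Siegel parameter linearly to zero joins an element of \<open>UU j\<close>
  to one of \<open>UU (Suc j)\<close>.\<close>

lemma connected_UU: "j \<le> k \<Longrightarrow> connected (UU j)"
proof (induction j rule: inc_induct)
  case base then show ?case by (simp add: UU_k)
next
  case (step j)
  have one: "mat 1 \<in> UU i" for i by (simp add: UU_def unip_one)
  have "connected_component (UU j) u (mat 1)" if u: "u \<in> UU j" for u
  proof -
    obtain w u' where w: "w \<in> Hs (Suc j)" and u': "u' \<in> UU (Suc j)" and eq: "u = siegel_matrix j w ** u'"
      using UU_factor[OF u step.hyps(2)] .
    let ?L = "(\<lambda>w. siegel_matrix j w ** u') ` closed_segment 0 w"
    have sub: "closed_segment 0 w \<subseteq> Hs (Suc j)"
      using w subspace_Hs by (intro closed_segment_subset subspace_imp_convex) (auto simp: subspace_0)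
    have "connected ?L" by (intro connected_continuous_image continuous_on_siegel_matrix) auto
    moreover have "?L \<subseteq> UU j" using sub siegel_matrix_mult_UU[OF _ step.hyps(2) u'] by auto
    moreover have "u \<in> ?L" using eq by auto
    moreover have "siegel_matrix j 0 = mat 1" by (simp add: matrix_eq siegel_def)
    then have "u' \<in> ?L" by (auto intro!: image_eqI[where x = 0])
    ultimately have "connected_component (UU j) u u'"
      unfolding connected_component_def by blast
    moreover have "connected_component (UU j) u' (mat 1)"
      unfolding connected_component_def using step.IH UU_mono[of j "Suc j"] u' one by auto
    ultimately show ?thesis by (rule connected_component_trans)
  qed
  then show ?case
    by (meson connected_component_sym connected_component_trans connected_iff_connected_component)
qed

lemma unip_SO0: "unip \<subseteq> SO0 B"
  by (rule SO0_connected_subset[where x = "mat 1"])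
     (use connected_UU[of 0] unip_isometry unip_one SO0_one in \<open>auto simp: UU_0\<close>)

text \<open>The conditions on \<open>v\<close> are those satisfied by the images of the
  \<open>e i\<close> under an element of \<open>UU j\<close>. The Siegel transformation taking
  \<open>e j\<close> to \<open>v j\<close> is built as in the factorisation, and its inverse pulls
  the other targets back into \<open>Hs (Suc j)\<close>.\<close>

lemma UU_transitive:
  assumes "j \<le> k" "\<And>i. i \<in> {j..<k} \<Longrightarrow> v i \<in> Hs j"
    "\<And>i l. i \<in> {j..<k} \<Longrightarrow> l \<in> {j..<k} \<Longrightarrow> B (v i) (v l) = 0"
    "\<And>i l. i \<in> {j..<k} \<Longrightarrow> l \<in> {j..<i} \<Longrightarrow> B (v i) (f l) = 0"
    "\<And>i. i \<in> {j..<k} \<Longrightarrow> B (v i) (f i) = 1"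
  shows "\<exists>u\<in>UU j. \<forall>i\<in>{j..<k}. u *v e i = v i"
  using assms
proof (induction j arbitrary: v rule: inc_induct)
  case base then show ?case by (auto simp: UU_k)
next
  case (step j)
  note j = step.hyps(2)
  define c where "c = B (v j) (e j)"
  define w where "w = v j - e j - c *\<^sub>R f j"
  have vj: "v j \<in> Hs j" "B (v j) (f j) = 1" "B (v j) (v j) = 0"
    using step.prems j by auto
  have w: "w \<in> Hs (Suc j)"
    using vj j HsD[OF vj(1)] by (auto simp: Hs_def w_def c_def less_Suc_eq ee ef ff fe)
  have ve: "v j = e j + w + c *\<^sub>R f j" by (simp add: w_def)
  have "2 * c + B w w = 0"
    using vj(3) HsD[OF w, of j] j unfolding ve by (simp add: ee ef ff fe)
  then have "c = - (B w w / 2)" by simp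
  then have se: "siegel j w (e j) = v j"
    using ve siegel_e[OF w j] by simp
  have mw: "- w \<in> Hs (Suc j)" using w by (rule uminus_Hs)
  have swap: "B (siegel j (- w) x) y = B x (siegel j w y)" for x y
    using siegel_isometry[OF w j, of "siegel j (- w) x" y] by (simp add: siegel_inverse[OF w j])
  define v' where "v' i = siegel j (- w) (v i)" for i
  have "\<exists>u\<in>UU (Suc j). \<forall>i\<in>{Suc j..<k}. u *v e i = v' i"
  proof (rule step.IH)
    fix i assume i: "i \<in> {Suc j..<k}"
    have vi: "v i \<in> Hs j" using step.prems(1) i by simp
    have "B (v' i) (e l) = 0 \<and> B (v' i) (f l) = 0" if "l < Suc j" for l
    proof (cases "l = j")
      case True
      then show ?thesis using step.prems(2)[of i j] step.prems(3)[of i j] i j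
        by (simp add: v'_def swap se siegel_f[OF w j])
    next
      case False
      then show ?thesis using that vi siegel_fix[OF w j, of l]
        by (simp add: v'_def swap HsD)
    qed
    then show "v' i \<in> Hs (Suc j)" by (simp add: Hs_def)
    have sf: "siegel j w (f l) = f l - B (f l) w *\<^sub>R f j" if "l < k" for l
      using that j by (simp add: siegel_perp_f ff)
    show "B (v' i) (f l) = 0" if "l \<in> {Suc j..<i}" for l
      using that i step.prems(3)[of i j] step.prems(3)[of i l] by (simp add: v'_def swap sf)
    show "B (v' i) (f i) = 1"
      using i step.prems(3)[of i j] step.prems(4)[of i] by (simp add: v'_def swap sf)
    show "B (v' i) (v' l) = 0" if "l \<in> {Suc j..<k}" for l
      using that i step.prems(2)[of i l] by (simp add: v'_def siegel_isometry[OF mw j])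
  qed
  then obtain u where u: "u \<in> UU (Suc j)" "\<And>i. i \<in> {Suc j..<k} \<Longrightarrow> u *v e i = v' i" by blast
  have "(siegel_matrix j w ** u) *v e i = v i" if "i \<in> {j..<k}" for i
  proof (cases "i = j")
    case True
    then show ?thesis using u(1) by (simp add: UU_def se flip: matrix_vector_mul_assoc)
  next
    case False
    then show ?thesis using u(2)[of i] that
      by (simp add: v'_def siegel_inverse[OF w j] flip: matrix_vector_mul_assoc)
  qed
  then show ?case using siegel_matrix_mult_UU[OF w j u(1)] by blast
qed

definition EE :: "nat \<Rightarrow> (real^'n) set" where
  "EE j = span (e ` {..<j})"

lemma EE_expand: "x \<in> EE j \<Longrightarrow> j \<le> k \<Longrightarrow> x = (\<Sum>i<j. B x (f i) *\<^sub>R e i)"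
  using dual_frames.FF_expand[OF dual_frames_swap] dual_frames.FF_def[OF dual_frames_swap]
  by (simp add: EE_def)

text \<open>A unipotent radical meets an opposite parabolic only in the identity: an element of
  \<open>EE (Suc i)\<close> is determined by its pairings with the \<open>f l\<close> for
  \<open>l \<le> i\<close>, and unipotence makes those of \<open>g *v e i\<close> equal to those of
  \<open>e i\<close>.\<close>

lemma unip_fix_EE:
  assumes g: "g \<in> unip" and E: "\<And>i. i < k \<Longrightarrow> g *v e i \<in> EE (Suc i)"
  shows "g = mat 1"
proof -
  have iso: "B (g *v x) (g *v y) = B x y" for x y
    by (auto intro: isometryD unip_isometry g)
  have ge: "g *v e i = e i" if i: "i < k" for i
  proof -
    have "B (g *v e i) (f l) = (if l = i then 1 else 0)" if l: "l \<le> i" for l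
    proof -
      have "matrix_inv g *v f l - f l \<in> FF l" using unip_inv[OF g] i l by (simp add: unip_def)
      then have "B (matrix_inv g *v f l - f l) (e i) = 0"
        by (rule FF_nested_zero) (use i l in auto)
      then have "B (matrix_inv g *v f l) (e i) = (if l = i then 1 else 0)" using i l by (simp add: fe)
      then show ?thesis using isometry_inv_swap[OF unip_isometry[OF g]] by (simp add: sym)
    qed
    then have "(\<Sum>l<Suc i. B (g *v e i) (f l) *\<^sub>R e l) = (\<Sum>l<Suc i. if l = i then e l else 0)"
      by (intro sum.cong) auto
    then show ?thesis using EE_expand[OF E[OF i]] i by simp
  qed
  have "g *v f i = f i" if i: "i < k" for i
  proof -
    have d: "g *v f i - f i \<in> FF i" using g i by (simp add: unip_def)
    have "B (g *v f i - f i) (e l) = 0" if "l < i" for l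
      using iso[of "f i" "e l"] ge[of l] that i by simp
    then show ?thesis using FF_expand[OF d] i by simp
  qed
  then have "g \<in> UU k" using g ge by (simp add: UU_def)
  then show ?thesis by (simp add: UU_k)
qed

end

section \<open>Connectedness for prescribed pivot signs\<close>

lemma ex_off_span:
  fixes H :: "'a::euclidean_space set"
  assumes "dim K < dim H"
  obtains z where "z \<in> H" "z \<notin> span K"
proof -
  have "\<not> H \<subseteq> span K"
    using assms dim_subset[of H "span K"] by auto
  then show ?thesis using that by blast
qed

lemma dense_off_subspace:
  fixes H :: "'a::euclidean_space set"
  assumes "subspace H" "subspace K" "dim K < dim H" "w \<in> H" "0 < \<delta>"
  obtains w' where "w' \<in> H" "dist w' w < \<delta>" "w' \<notin> K"
proof (cases "w \<in> K")
  case True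
  obtain z where z: "z \<in> H" "z \<notin> span K" using ex_off_span[OF assms(3)] .
  then have zK: "z \<notin> K" "z \<noteq> 0" using assms(2) by (auto simp: span_0 intro: span_base)
  define t where "t = \<delta> / (2 * norm z)"
  have t: "t > 0" using zK assms(5) by (simp add: t_def)
  show ?thesis
  proof
    show "w + t *\<^sub>R z \<in> H" using assms z by (intro subspace_add subspace_scale) auto
    show "dist (w + t *\<^sub>R z) w < \<delta>" using zK assms(5) by (simp add: dist_norm t_def)
    show "w + t *\<^sub>R z \<notin> K"
    proof
      assume "w + t *\<^sub>R z \<in> K"
      then have "inverse t *\<^sub>R (w + t *\<^sub>R z - w) \<in> K"
        using True assms(2) by (intro subspace_scale subspace_diff) auto
      then show False using t zK by simp
    qed
  qed
qed (use assms that in auto)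

text \<open>A point of the segment in \<open>K\<close> has a nonzero coefficient on
  \<open>c\<close>, since \<open>a\<close> is not in \<open>K\<close>, and would express
  \<open>c\<close> through \<open>a\<close> and \<open>K\<close>.\<close>

lemma closed_segment_avoids_subspace:
  assumes "subspace K" "a \<notin> K" "c \<notin> span (insert a K)"
  shows "closed_segment a c \<inter> K = {}"
proof -
  have False if "0 \<le> s" and K: "(1 - s) *\<^sub>R a + s *\<^sub>R c \<in> K" for s
  proof (cases "s = 0")
    case False
    have "(1 - s) *\<^sub>R a + s *\<^sub>R c - (1 - s) *\<^sub>R a \<in> span (insert a K)"
      using K by (intro span_diff span_scale) (auto intro: span_base)
    then have "s *\<^sub>R c \<in> span (insert a K)" by simp
    then have "inverse s *\<^sub>R (s *\<^sub>R c) \<in> span (insert a K)" by (rule span_scale)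
    then show False using assms(3) False by simp
  qed (use K assms(2) in simp)
  then show ?thesis by (auto simp: closed_segment_def)
qed

text \<open>Codimension at least three leaves a direction outside the span of \<open>K\<close> and
  any two points \<open>y\<close>, \<open>z\<close>. Moving \<open>y\<close> slightly in this
  direction gives a point \<open>c\<close> whose segments to \<open>y\<close> and to
  \<open>z\<close> both miss \<open>K\<close>. This joins points locally, and connectedness of
  \<open>A\<close> makes it global.\<close>

lemma connected_diff_subspace:
  fixes H :: "'a::euclidean_space set"
  assumes H: "subspace H" and A: "openin (top_of_set H) A" "connected A"
    and K: "subspace K" "dim K + 2 < dim H"
  shows "connected (A - K)"
  unfolding connected_iff_connected_component
proof (intro ballI)
  fix a b assume ab: "a \<in> A - K" "b \<in> A - K"
  have AH: "A \<subseteq> H" using A(1) openin_imp_subset by blast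
  have ball: "\<exists>r>0. ball x r \<inter> H \<subseteq> A" if "x \<in> A" for x
    using A(1) that by (auto simp: openin_contains_ball)
  show "connected_component (A - K) a b"
  proof (rule connected_equivalence_relation_gen[OF A(2), where P = "\<lambda>x. x \<notin> K"])
    show "\<exists>z. z \<in> T \<and> z \<notin> K" if T: "openin (top_of_set A) T" "x \<in> T" for T x
    proof -
      have "openin (top_of_set H) T" using T(1) A(1) openin_trans by blast
      then obtain r where r: "r > 0" "\<forall>x'\<in>H. dist x' x < r \<longrightarrow> x' \<in> T" "x \<in> H"
        using T(2) unfolding openin_euclidean_subtopology_iff by blast
      obtain z where "z \<in> H" "dist z x < r" "z \<notin> K"
        by (rule dense_off_subspace[OF H K(1) _ r(3,1)]) (use K(2) in auto)
      then show ?thesis using r by auto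
    qed
    show "\<exists>T. openin (top_of_set A) T \<and> x \<in> T \<and>
       (\<forall>y\<in>T. \<forall>z\<in>T. y \<notin> K \<and> z \<notin> K \<longrightarrow> connected_component (A - K) y z)" if "x \<in> A" for x
    proof -
      obtain r where r: "r > 0" "ball x r \<inter> H \<subseteq> A" using ball[OF \<open>x \<in> A\<close>] by blast
      have "connected_component (A - K) y z" if yz: "y \<in> ball x r \<inter> H" "z \<in> ball x r \<inter> H" "y \<notin> K" "z \<notin> K" for y z
      proof -
        have "dim (insert y (insert z K)) \<le> dim K + 2" by (simp add: dim_insert)
        then have "dim (insert y (insert z K)) < dim H" using K(2) by linarith
        then obtain h where h: "h \<in> H" "h \<notin> span (insert y (insert z K))"
          using ex_off_span by blast
        \<comment> \<open>Small enough that \<open>c\<close> stays in the ball; the summand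
          \<open>1\<close> keeps the denominator positive.\<close>
        define t where "t = (r - dist x y) / (2 * (norm h + 1))"
        have n: "0 < 2 * (norm h + 1)" by (simp add: add_nonneg_pos)
        have t: "t > 0" using yz(1) n by (simp add: t_def)
        have "norm h < 2 * (norm h + 1)" using norm_ge_zero[of h] unfolding distrib_left by argo
        then have "t * norm h < t * (2 * (norm h + 1))" using t by (rule mult_strict_left_mono)
        also have "\<dots> = r - dist x y" using n by (simp add: t_def)
        finally have tn: "t * norm h < r - dist x y" .
        define c where "c = y + t *\<^sub>R h"
        have "dist y c = t * norm h" using t by (simp add: c_def dist_norm)
        then have c1: "c \<in> ball x r" using tn dist_triangle[of x c y] by simp
        have c2: "c \<in> H" using yz h H unfolding c_def by (auto intro: subspace_add subspace_scale)
        have c3: "c \<notin> span (insert y (insert z K))"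
        proof
          assume "c \<in> span (insert y (insert z K))"
          then have "c - y \<in> span (insert y (insert z K))" by (intro span_diff) (auto intro: span_base)
          then have "inverse t *\<^sub>R (c - y) \<in> span (insert y (insert z K))" by (rule span_scale)
          then show False using h t by (simp add: c_def)
        qed
        have conv: "convex (ball x r \<inter> H)" by (intro convex_Int subspace_imp_convex[OF H]) auto
        have "connected_component (A - K) g c"
          if g: "g \<in> ball x r \<inter> H" "g \<notin> K" "c \<notin> span (insert g K)" for g
        proof -
          have "closed_segment g c \<subseteq> ball x r \<inter> H"
            using g c1 c2 conv by (intro closed_segment_subset) auto
          moreover have "closed_segment g c \<inter> K = {}"
            by (rule closed_segment_avoids_subspace[OF K(1) g(2,3)])
          ultimately have "closed_segment g c \<subseteq> A - K" using r(2) by blast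
          then show ?thesis unfolding connected_component_def
            using connected_segment(1)[of g c] by (meson ends_in_segment)
        qed
        moreover have "c \<notin> span (insert y K)" "c \<notin> span (insert z K)"
          using c3 span_mono[of "insert y K" "insert y (insert z K)"]
            span_mono[of "insert z K" "insert y (insert z K)"] by auto
        ultimately show ?thesis using yz
          by (meson connected_component_sym connected_component_trans)
      qed
      moreover have "openin (top_of_set A) (ball x r \<inter> H)"
        using r(2) AH by (auto simp: openin_open Int_absorb1 Int_commute intro!: exI[of _ "ball x r"])
      moreover have "x \<in> ball x r \<inter> H" using r(1) \<open>x \<in> A\<close> AH by auto
      ultimately show ?thesis by blast
    qed
  qed (use ab connected_component_trans in auto)
qed

section \<open>Connected cones and the fibres of one pivot\<close>

context sym_form begin

text \<open>Two vectors of the cone with \<open>0 \<le> s * B a b\<close> are joined by their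
  segment. In general the path goes through a cone vector \<open>c\<close> orthogonal to
  \<open>a\<close>, replaced by its negative if its pairing with \<open>b\<close> has the wrong
  sign.\<close>

lemma connected_definite_cone:
  assumes H: "subspace H" and def: "\<And>a. \<exists>c\<in>H. B a c = 0 \<and> 0 < s * B c c"
  shows "connected {w \<in> H. 0 < s * B w w}" (is "connected ?X")
proof -
  have seg: "connected_component ?X a b" if "a \<in> ?X" "b \<in> ?X" "0 \<le> s * B a b" for a b
  proof -
    have "closed_segment a b \<subseteq> ?X"
    proof
      fix x assume "x \<in> closed_segment a b"
      then obtain t where t: "0 \<le> t" "t \<le> 1" "x = (1 - t) *\<^sub>R a + t *\<^sub>R b"
        by (auto simp: closed_segment_def)
      have "s * B x x = (1 - t)\<^sup>2 * (s * B a a) + 2 * (t * (1 - t)) * (s * B a b) + t\<^sup>2 * (s * B b b)"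
        by (simp add: t(3) power2_eq_square algebra_simps sym[of b a])
      moreover have "0 \<le> 2 * (t * (1 - t)) * (s * B a b)" using t that(3) by simp
      moreover have "0 < (1 - t)\<^sup>2 * (s * B a a) + t\<^sup>2 * (s * B b b)"
      proof (cases "t = 0")
        case False
        then have "0 < t\<^sup>2 * (s * B b b)" using that by auto
        moreover have "0 \<le> (1 - t)\<^sup>2 * (s * B a a)"
          by (rule mult_nonneg_nonneg[OF zero_le_power2]) (use that in simp)
        ultimately show ?thesis by linarith
      qed (use that in auto)
      ultimately have "0 < s * B x x" by linarith
      moreover have "x \<in> H" unfolding t(3) using that H by (auto intro!: subspace_add subspace_scale)
      ultimately show "x \<in> ?X" by simp
    qed
    then show ?thesis unfolding connected_component_def
      using connected_segment(1)[of a b] by (meson ends_in_segment)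
  qed
  show ?thesis
    unfolding connected_iff_connected_component
  proof (intro ballI)
    fix a b assume a: "a \<in> ?X" and b: "b \<in> ?X"
    obtain c where c: "c \<in> H" "B a c = 0" "0 < s * B c c" using def by blast
    define c' where "c' = (if 0 \<le> s * B c b then c else - c)"
    have c': "c' \<in> ?X" using c H by (auto simp: c'_def subspace_neg)
    have "0 \<le> s * B a c'" "0 \<le> s * B c' b" using c by (auto simp: c'_def)
    then show "connected_component ?X a b"
      using seg[OF a c'] seg[OF c' b] connected_component_trans by blast
  qed
qed

end

text \<open>\<open>definite\<close> is the form in which two positive and two negative directions of
  \<open>Hs k\<close> are used: one linear condition, orthogonality to \<open>a\<close>, still
  leaves a vector whose length has the sign of \<open>s\<close>. \<open>large\<close> feeds the
  dimension count for bad parameters.\<close>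

locale indefinite_frames = dual_frames B k e f
  for B :: "real^'n \<Rightarrow> real^'n \<Rightarrow> real" and k :: nat and e f :: "nat \<Rightarrow> real^'n" +
  assumes definite: "s \<noteq> 0 \<Longrightarrow> \<exists>c\<in>Hs k. B a c = 0 \<and> 0 < s * B c c"
    and large: "2 * k + 4 \<le> CARD('n)"
begin

lemma definite_Hs: "s \<noteq> 0 \<Longrightarrow> j \<le> k \<Longrightarrow> \<exists>c\<in>Hs j. B a c = 0 \<and> 0 < s * B c c"
  using definite[of s a] Hs_mono[of j k] by blast

lemma dim_Hs_ge: "CARD('n) \<le> dim (Hs j) + 2 * j"
proof -
  have "Hs j = perp B (e ` {..<j} \<union> f ` {..<j})" by (auto simp: Hs_def perp_def)
  moreover have "card (e ` {..<j} \<union> f ` {..<j}) \<le> j + j"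
    using card_Un_le[of "e ` {..<j}" "f ` {..<j}"] card_image_le[of "{..<j}" e] card_image_le[of "{..<j}" f]
    by simp
  moreover have "dim (e ` {..<j} \<union> f ` {..<j}) \<le> card (e ` {..<j} \<union> f ` {..<j})"
    by (rule dim_le_card') simp
  ultimately show ?thesis using dim_perp_ge[of "e ` {..<j} \<union> f ` {..<j}"] by simp
qed

text \<open>An element \<open>u\<close> of \<open>UU (Suc j)\<close> fixes \<open>e j\<close>, so
  the first pivot of \<open>siegel_matrix j w ** u\<close> depends on \<open>w\<close>
  alone.\<close>

definition fibre :: "nat \<Rightarrow> real^'n \<Rightarrow> real \<Rightarrow> (real^'n) set" where
  "fibre j y s = {w \<in> Hs (Suc j). 0 < s * B y (siegel j w (e j))}"

lemma openin_fibre: "openin (top_of_set (Hs (Suc j))) (fibre j y s)"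
proof -
  have "open {w. 0 < s * B y (siegel j w (e j))}"
    by (intro open_Collect_less continuous_intros continuous_on_B continuous_on_siegel)
  then show ?thesis unfolding fibre_def openin_open by blast
qed

text \<open>Write \<open>a\<close>, \<open>b\<close> for the coefficients of \<open>y\<close> on
  \<open>e j\<close>, \<open>f j\<close> and \<open>y'\<close> for the rest. The pivot is then
  \<open>b + B y' w - a / 2 * B w w\<close>. If \<open>a = 0\<close> it is affine, and nonconstant
  because \<open>y\<close> is not a multiple of \<open>f j\<close>: the fibre is a half-space. If
  \<open>a \<noteq> 0\<close>, isotropy of \<open>y\<close> is exactly what makes the constant
  vanish after completing the square, and the fibre is a translated open cone.\<close>

lemma fibre_connected:
  assumes j: "j < k" and y: "y \<in> Hs j" "B y y = 0" "\<And>c. y \<noteq> c *\<^sub>R f j" and s: "s \<noteq> 0"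
  shows "connected (fibre j y s)" "fibre j y s \<noteq> {}"
proof -
  define a b where "a = B y (f j)" and "b = B y (e j)"
  define y' where "y' = y - a *\<^sub>R e j - b *\<^sub>R f j"
  have y': "y' \<in> Hs (Suc j)"
    using y(1) j by (auto simp: Hs_def y'_def a_def b_def less_Suc_eq ee ef ff fe)
  have yy: "y = y' + a *\<^sub>R e j + b *\<^sub>R f j" by (simp add: y'_def)
  have eq: "B y (siegel j w (e j)) = b + B y' w - a / 2 * B w w" if "w \<in> Hs (Suc j)" for w
    using HsD[OF that, of j] HsD[OF y', of j] j unfolding yy siegel_e[OF that j]
    by (simp add: ee ef ff fe)
  have "B y' y' + 2 * a * b = 0"
    using y(2) HsD[OF y', of j] j unfolding yy by (simp add: ee ef ff fe)
  then have y'y': "B y' y' = - 2 * a * b" by simp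
  have fib: "fibre j y s = {w \<in> Hs (Suc j). 0 < s * (b + B y' w - a / 2 * B w w)}"
    using eq by (auto simp: fibre_def)
  show "connected (fibre j y s)" "fibre j y s \<noteq> {}"
  proof (atomize (full), cases "a = 0")
    case True
    have "y' \<noteq> 0" using y(3)[of b] yy True by auto
    then obtain w where w: "w \<in> Hs (Suc j)" "B y' w \<noteq> 0"
      using Hs_nondeg[OF y'] j by (meson Suc_leI)
    \<comment> \<open>Scaled so that the affine pivot takes the value \<open>s\<close>
      itself.\<close>
    define w' where "w' = ((s - b) / B y' w) *\<^sub>R w"
    have "w' \<in> fibre j y s" using w s True subspace_scale[OF subspace_Hs w(1)]
      by (auto simp: fib w'_def zero_less_mult_iff linorder_neq_iff)
    moreover have "convex (fibre j y s)"
    proof -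
      have "fibre j y s = Hs (Suc j) \<inter> {w. - (s * b) < s * B y' w}"
        using True by (auto simp: fib algebra_simps)
      moreover have "linear (\<lambda>w. s * B y' w)" by (rule linearI) (auto simp: algebra_simps)
      then have "convex ((\<lambda>w. s * B y' w) -` {- (s * b)<..})"
        by (intro convex_linear_vimage) auto
      then have "convex {w. - (s * b) < s * B y' w}" by (simp add: vimage_def)
      ultimately show ?thesis using subspace_imp_convex[OF subspace_Hs] convex_Int by metis
    qed
    ultimately show "connected (fibre j y s) \<and> fibre j y s \<noteq> {}" using convex_connected by auto
  next
    case False
    define s' where "s' = - (s * a / 2)"
    define h where "h = inverse a *\<^sub>R y'"
    have h: "h \<in> Hs (Suc j)" unfolding h_def by (rule subspace_scale[OF subspace_Hs y'])
    have s': "s' \<noteq> 0" using s False by (simp add: s'_def)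
    have sq: "s * (b + B y' w - a / 2 * B w w) = s' * B (w - h) (w - h)" for w
      using False by (simp add: s'_def h_def y'y' sym[of w y'] field_simps)
    have img: "fibre j y s = (+) h ` {w \<in> Hs (Suc j). 0 < s' * B w w}"
    proof (intro Set.set_eqI iffI)
      fix w assume "w \<in> fibre j y s"
      then have "w - h \<in> {w \<in> Hs (Suc j). 0 < s' * B w w}"
        using h subspace_diff[OF subspace_Hs] unfolding fib sq by blast
      then show "w \<in> (+) h ` {w \<in> Hs (Suc j). 0 < s' * B w w}" by (metis (no_types) add_diff_cancel_left' diff_add_cancel add.commute imageI)
    next
      fix w assume "w \<in> (+) h ` {w \<in> Hs (Suc j). 0 < s' * B w w}"
      then obtain x where x: "w = h + x" "x \<in> Hs (Suc j)" "0 < s' * B x x" by blast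
      then have "0 < s' * B (w - h) (w - h)" by simp
      then show "w \<in> fibre j y s" unfolding fib sq using x h subspace_add[OF subspace_Hs] by blast
    qed
    have d: "\<exists>c\<in>Hs (Suc j). B x c = 0 \<and> 0 < s' * B c c" for x
      using definite_Hs[OF s'] j by simp
    then have "connected {w \<in> Hs (Suc j). 0 < s' * B w w}"
      by (intro connected_definite_cone subspace_Hs)
    then show "connected (fibre j y s) \<and> fibre j y s \<noteq> {}"
      unfolding img using d[of 0] by (auto intro!: connected_continuous_image continuous_intros)
  qed
qed

section \<open>Fibration of the pivot sets\<close>

definition pivot_set :: "nat \<Rightarrow> (nat \<Rightarrow> real^'n) \<Rightarrow> (nat \<Rightarrow> real) \<Rightarrow> (real^'n^'n) set" where
  "pivot_set j y s = {u \<in> UU j. pivots (k - j) j s (\<lambda>i l. B (y i) (u *v e l))}"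

text \<open>At step \<open>j\<close> the first flag is replaced by the isotropic vectors \<open>y i\<close>, what is left of it in
  \<open>Hs j\<close> after \<open>j\<close> elimination steps. Its linear independence from the second flag is the condition
  that survives the induction off the subspace \<open>degenerate\<close>.\<close>

definition generic :: "nat \<Rightarrow> (nat \<Rightarrow> real^'n) \<Rightarrow> bool" where
  "generic j y \<longleftrightarrow> (\<forall>i\<in>{j..<k}. y i \<in> Hs j) \<and> (\<forall>i\<in>{j..<k}. \<forall>l\<in>{j..<k}. B (y i) (y l) = 0) \<and>
     (\<forall>c d. (\<Sum>i\<in>{j..<k}. c i *\<^sub>R f i + d i *\<^sub>R y i) = 0 \<longrightarrow> (\<forall>i\<in>{j..<k}. c i = 0 \<and> d i = 0))"

text \<open>Elimination performed on vectors in place of matrix rows: subtract from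
  \<open>y i\<close> the multiple of \<open>y j\<close> that clears column \<open>j\<close>, then
  move the Siegel factor to this side by adjointness. Removing the \<open>e j\<close> component
  brings the result into \<open>Hs (Suc j)\<close> and leaves the matrix unchanged, since
  \<open>e j\<close> is orthogonal to \<open>u *v e l\<close> for \<open>u\<close> in
  \<open>UU (Suc j)\<close> and \<open>l > j\<close>.\<close>

definition next_y :: "nat \<Rightarrow> real^'n \<Rightarrow> (nat \<Rightarrow> real^'n) \<Rightarrow> nat \<Rightarrow> real^'n" where
  "next_y j w y i =
     (let v = siegel j w (e j);
          t = siegel j (- w) (y i - (B (y i) v / B (y j) v) *\<^sub>R y j)
      in t - B t (f j) *\<^sub>R e j)"

text \<open>\<open>w\<close> is the projection of \<open>siegel j w (e j)\<close> to
  \<open>Hs (Suc j)\<close>; outside the projected span of the \<open>f i\<close> and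
  \<open>y i\<close> it keeps the next family independent. The index \<open>j\<close> is missing for
  \<open>f\<close> because \<open>f j\<close> projects to zero.\<close>

definition degenerate :: "nat \<Rightarrow> (nat \<Rightarrow> real^'n) \<Rightarrow> (real^'n) set" where
  "degenerate j y = span (f ` {Suc j..<k} \<union> (\<lambda>i. proj_Hs (Suc j) (y i)) ` {j..<k})"

lemma siegel_swap:
  assumes "w \<in> Hs (Suc j)" "j < k"
  shows "B (siegel j (- w) x) y = B x (siegel j w y)"
  using siegel_isometry[OF assms, of "siegel j (- w) x" y] by (simp add: siegel_inverse[OF assms])

lemma next_y_schur:
  assumes w: "w \<in> Hs (Suc j)" and u: "u \<in> UU (Suc j)" and l: "l \<in> {Suc j..<k}"
  shows "B (next_y j w y i) (u *v e l) = schur j (\<lambda>i l. B (y i) ((siegel_matrix j w ** u) *v e l)) i l"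
proof -
  have j: "j < k" using l by simp
  have uj: "u *v e j = e j" using u by (simp add: UU_def)
  have iso: "u \<in> isometry_group B" using u by (simp add: UU_def unip_isometry)
  have "B (e j) (u *v e l) = 0" using isometryD[OF iso, of "e j" "e l"] uj ee j l by simp
  then show ?thesis
    by (simp add: next_y_def Let_def siegel_swap[OF w j] schur_def uj flip: matrix_vector_mul_assoc)
qed

text \<open>The first pivot depends on \<open>w\<close> alone, and the Schur complement is the
  matrix of \<open>u\<close> for the new family, so membership splits into a condition on
  \<open>w\<close> and a pivot set with one step less.\<close>

lemma siegel_matrix_mult_in_pivot_set_iff:
  assumes w: "w \<in> Hs (Suc j)" and j: "j < k" and u: "u \<in> UU (Suc j)"
  shows "siegel_matrix j w ** u \<in> pivot_set j y s \<longleftrightarrow> w \<in> fibre j (y j) (s j) \<and> u \<in> pivot_set (Suc j) (next_y j w y) s"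
proof -
  let ?a = "\<lambda>i l. B (y i) ((siegel_matrix j w ** u) *v e l)"
  have uj: "u *v e j = e j" using u by (simp add: UU_def)
  have k: "k - j = Suc (k - Suc j)" using j by simp
  have "pivots (k - Suc j) (Suc j) s (schur j ?a) =
      pivots (k - Suc j) (Suc j) s (\<lambda>i l. B (next_y j w y i) (u *v e l))"
    by (rule pivots_cong) (use next_y_schur[OF w u] j in auto)
  moreover have "?a j j = B (y j) (siegel j w (e j))"
    by (simp add: uj flip: matrix_vector_mul_assoc)
  ultimately show ?thesis
    using siegel_matrix_mult_UU[OF w j u] w u by (simp add: pivot_set_def fibre_def k)
qed

lemma linear_proj_Hs: "linear (proj_Hs j)"
  by (rule linearI)
     (simp_all add: proj_Hs_def sum.distrib scaleR_add_left scaleR_add_right scaleR_sum_right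
        scaleR_diff_right algebra_simps)

lemma proj_Hs_id: "x \<in> Hs j \<Longrightarrow> proj_Hs j x = x"
  by (simp add: proj_Hs_def HsD)

lemma proj_Hs_frame:
  assumes "i < j" "j \<le> k"
  shows "proj_Hs j (e i) = 0" "proj_Hs j (f i) = 0"
proof -
  have "(\<Sum>l<j. B (e i) (f l) *\<^sub>R e l + B (e i) (e l) *\<^sub>R f l) = (\<Sum>l<j. if l = i then e l else 0)"
    by (rule sum.cong) (use assms in \<open>auto simp: ee ef\<close>)
  moreover have "(\<Sum>l<j. B (f i) (f l) *\<^sub>R e l + B (f i) (e l) *\<^sub>R f l) = (\<Sum>l<j. if l = i then f l else 0)"
    by (rule sum.cong) (use assms in \<open>auto simp: ff fe\<close>)
  ultimately show "proj_Hs j (e i) = 0" "proj_Hs j (f i) = 0" using assms by (simp_all add: proj_Hs_def)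
qed

lemma generic_not_multiple:
  assumes "generic j y" "j < k" shows "y j \<noteq> c *\<^sub>R f j"
proof
  assume yj: "y j = c *\<^sub>R f j"
  let ?c = "\<lambda>i. if i = j then - c else 0" and ?d = "\<lambda>i. if i = j then 1 else 0"
  have 0: "(\<Sum>i\<in>{j..<k}. ?c i *\<^sub>R f i + ?d i *\<^sub>R y i) = 0"
    by (rule sum.neutral) (auto simp: yj)
  have "\<forall>c d. (\<Sum>i\<in>{j..<k}. c i *\<^sub>R f i + d i *\<^sub>R y i) = 0 \<longrightarrow> (\<forall>i\<in>{j..<k}. c i = 0 \<and> d i = 0)"
    using assms(1) by (simp add: generic_def)
  from this[rule_format, OF 0, of j] assms(2) show False by simp
qed

text \<open>There are at most \<open>2 * (k - j) - 1\<close> generators, against a dimension of at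
  least \<open>CARD('n) - 2 * (j + 1)\<close>, which \<open>large\<close> bounds below by
  \<open>2 * (k - j) + 2\<close>.\<close>

lemma dim_degenerate:
  assumes "j < k" shows "dim (degenerate j y) + 2 < dim (Hs (Suc j))"
proof -
  let ?F = "f ` {Suc j..<k}" and ?Y = "(\<lambda>i. proj_Hs (Suc j) (y i)) ` {j..<k}"
  have "card (?F \<union> ?Y) \<le> card ?F + card ?Y" by (rule card_Un_le)
  also have "\<dots> \<le> (k - Suc j) + (k - j)"
    using card_image_le[of "{Suc j..<k}" f] card_image_le[of "{j..<k}" "\<lambda>i. proj_Hs (Suc j) (y i)"]
    by simp
  finally have "dim (degenerate j y) \<le> (k - Suc j) + (k - j)"
    using dim_le_card'[of "?F \<union> ?Y"] unfolding degenerate_def dim_span by simp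
  then show ?thesis using dim_Hs_ge[of "Suc j"] large assms by simp
qed

text \<open>Applying \<open>siegel j w\<close> to a relation among the later \<open>f i\<close> and
  the new vectors gives a relation between the \<open>f i\<close>, the old \<open>y i\<close> and a
  multiple \<open>\<sigma>\<close> of \<open>siegel j w (e j)\<close>. If
  \<open>\<sigma> \<noteq> 0\<close>, projecting to \<open>Hs (Suc j)\<close> puts \<open>w\<close>
  into \<open>degenerate j y\<close>; if \<open>\<sigma> = 0\<close>, independence of the old family
  applies.\<close>

lemma generic_next:
  assumes g: "generic j y" and j: "j < k" and w: "w \<in> Hs (Suc j)" and p: "B (y j) (siegel j w (e j)) \<noteq> 0"
    and nb: "w \<notin> degenerate j y"
  shows "generic (Suc j) (next_y j w y)"
proof -
  define v where "v = siegel j w (e j)"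
  define r where "r i = B (y i) v / B (y j) v" for i
  define t where "t i = siegel j (- w) (y i - r i *\<^sub>R y j)" for i
  define \<alpha> where "\<alpha> i = B (t i) (f j)" for i
  have ny: "next_y j w y i = t i - \<alpha> i *\<^sub>R e j" for i
    by (simp add: next_y_def Let_def t_def r_def v_def \<alpha>_def)
  have yH: "y i \<in> Hs j" if "i \<in> {j..<k}" for i using g that by (simp add: generic_def)
  have yy: "B (y i) (y l) = 0" if "i \<in> {j..<k}" "l \<in> {j..<k}" for i l using g that by (simp add: generic_def)
  have ind: "\<And>c d. (\<Sum>i\<in>{j..<k}. c i *\<^sub>R f i + d i *\<^sub>R y i) = 0 \<Longrightarrow> \<forall>i\<in>{j..<k}. c i = 0 \<and> d i = 0"
    using g by (simp add: generic_def)
  have pv: "B (y j) v \<noteq> 0" using p by (simp add: v_def)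
  have te: "B (t i) (e j) = 0" for i
    using pv by (simp add: t_def siegel_swap[OF w j] r_def flip: v_def)
  have "next_y j w y i \<in> Hs (Suc j)" if i: "i \<in> {Suc j..<k}" for i
  proof -
    have "B (t i - \<alpha> i *\<^sub>R e j) (e l) = 0 \<and> B (t i - \<alpha> i *\<^sub>R e j) (f l) = 0" if l: "l < Suc j" for l
    proof (cases "l = j")
      case True
      then show ?thesis using te j by (simp add: ee ef \<alpha>_def)
    next
      case False
      have "y i \<in> Hs j" "y j \<in> Hs j" using yH i j by auto
      then show ?thesis using l False j siegel_fix[OF w j, of l]
        by (simp add: t_def siegel_swap[OF w j] ee ef HsD)
    qed
    then show ?thesis by (simp add: Hs_def ny)
  qed
  moreover have "B (next_y j w y i) (next_y j w y l) = 0" if "i \<in> {Suc j..<k}" "l \<in> {Suc j..<k}" for i l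
  proof -
    have "B (t i) (t l) = 0"
      using that yy[of i l] yy[of i j] yy[of j l] yy[of j j] j
      by (simp add: t_def siegel_isometry[OF uminus_Hs[OF w] j])
    then show ?thesis using te j by (simp add: ny ee sym[of "e j" "t l"])
  qed
  moreover have "\<forall>i\<in>{Suc j..<k}. c i = 0 \<and> d i = 0"
    if sum0: "(\<Sum>i\<in>{Suc j..<k}. c i *\<^sub>R f i + d i *\<^sub>R next_y j w y i) = 0" for c d
  proof -
    let ?J = "{Suc j..<k}"
    define \<sigma> where "\<sigma> = (\<Sum>i\<in>?J. d i * \<alpha> i)"
    \<comment> \<open>The values at \<open>j\<close> collect the multiples of \<open>f j\<close> and
      of \<open>y j\<close> that appear when the Siegel transformation is expanded.\<close>
    define c' where "c' = c(j := - (\<Sum>i\<in>?J. c i * B (f i) w))"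
    define d' where "d' = d(j := - (\<Sum>i\<in>?J. d i * r i))"
    have sf: "siegel j w (f i) = f i - B (f i) w *\<^sub>R f j" if "i \<in> ?J" for i
      using that j by (simp add: siegel_perp_f ff)
    have sn: "siegel j w (next_y j w y i) = y i - r i *\<^sub>R y j - \<alpha> i *\<^sub>R v" for i
      by (simp add: ny linear_diff[OF linear_siegel] linear_scale[OF linear_siegel] t_def siegel_inverse[OF w j] v_def)
    have "0 = siegel j w (\<Sum>i\<in>?J. c i *\<^sub>R f i + d i *\<^sub>R next_y j w y i)"
      unfolding sum0 by (simp add: linear_0[OF linear_siegel])
    also have "\<dots> = (\<Sum>i\<in>?J. c i *\<^sub>R siegel j w (f i) + d i *\<^sub>R siegel j w (next_y j w y i))"
      by (simp add: linear_sum[OF linear_siegel] linear_add[OF linear_siegel] linear_scale[OF linear_siegel])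
    also have "\<dots> = (\<Sum>i\<in>?J. c i *\<^sub>R f i + d i *\<^sub>R y i - (c i * B (f i) w) *\<^sub>R f j - (d i * r i) *\<^sub>R y j - (d i * \<alpha> i) *\<^sub>R v)"
      by (rule sum.cong) (simp_all add: sf sn algebra_simps)
    also have "\<dots> = (\<Sum>i\<in>?J. c i *\<^sub>R f i + d i *\<^sub>R y i) + (c' j *\<^sub>R f j + d' j *\<^sub>R y j) - \<sigma> *\<^sub>R v"
      by (simp add: sum_subtractf c'_def d'_def \<sigma>_def flip: scaleR_sum_left)
    also have "(\<Sum>i\<in>?J. c i *\<^sub>R f i + d i *\<^sub>R y i) = (\<Sum>i\<in>?J. c' i *\<^sub>R f i + d' i *\<^sub>R y i)"
      by (rule sum.cong) (auto simp: c'_def d'_def)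
    also have "\<dots> + (c' j *\<^sub>R f j + d' j *\<^sub>R y j) = (\<Sum>i\<in>{j..<k}. c' i *\<^sub>R f i + d' i *\<^sub>R y i)"
      using j by (simp add: sum.atLeast_Suc_lessThan add.commute)
    finally have eq: "(\<Sum>i\<in>{j..<k}. c' i *\<^sub>R f i + d' i *\<^sub>R y i) = \<sigma> *\<^sub>R v" by simp
    have "\<sigma> = 0"
    proof (rule ccontr)
      assume \<sigma>: "\<sigma> \<noteq> 0"
      let ?p = "proj_Hs (Suc j)"
      note lin = linear_proj_Hs[of "Suc j"]
      have "?p v = w"
        using j by (simp add: v_def siegel_e[OF w j] linear_add[OF lin] linear_diff[OF lin] linear_scale[OF lin]
            proj_Hs_id[OF w] proj_Hs_frame)
      then have "\<sigma> *\<^sub>R w = ?p (\<Sum>i\<in>{j..<k}. c' i *\<^sub>R f i + d' i *\<^sub>R y i)"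
        by (simp add: eq linear_scale[OF lin])
      also have "\<dots> = (\<Sum>i\<in>{j..<k}. c' i *\<^sub>R ?p (f i) + d' i *\<^sub>R ?p (y i))"
        by (simp add: linear_sum[OF lin] linear_add[OF lin] linear_scale[OF lin])
      also have "\<dots> \<in> degenerate j y"
      proof (rule subspace_sum)
        show "subspace (degenerate j y)" by (simp add: degenerate_def)
        fix i assume i: "i \<in> {j..<k}"
        have "?p (f i) \<in> degenerate j y"
        proof (cases "i = j")
          case True
          then show ?thesis using j by (simp add: proj_Hs_frame degenerate_def span_0)
        next
          case False
          then have "?p (f i) = f i" using i by (intro proj_Hs_id f_in_Hs) auto
          then show ?thesis using i False by (auto simp: degenerate_def intro: span_base)
        qed
        moreover have "?p (y i) \<in> degenerate j y" using i by (auto simp: degenerate_def intro: span_base)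
        ultimately show "c' i *\<^sub>R ?p (f i) + d' i *\<^sub>R ?p (y i) \<in> degenerate j y"
          unfolding degenerate_def by (intro span_add span_scale)
      qed
      finally have "inverse \<sigma> *\<^sub>R (\<sigma> *\<^sub>R w) \<in> degenerate j y" unfolding degenerate_def by (rule span_scale)
      then show False using \<sigma> nb by simp
    qed
    then have "\<forall>i\<in>{j..<k}. c' i = 0 \<and> d' i = 0" using ind eq by simp
    then have "c' i = 0 \<and> d' i = 0" if "i \<in> ?J" for i using that by simp
    moreover have "c' i = c i" "d' i = d i" if "i \<in> ?J" for i
      using that by (simp_all add: c'_def d'_def)
    ultimately show ?thesis by metis
  qed
  ultimately show ?thesis unfolding generic_def by blast
qed

text \<open>With \<open>u\<close> fixed, all pivot signs persist for parameters near
  \<open>w\<close>, so a short segment of parameters stays in the pivot set, even when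
  \<open>w\<close> is degenerate.\<close>

lemma pivot_set_local:
  assumes j: "j < k" and w: "w \<in> Hs (Suc j)" and u: "u \<in> UU (Suc j)" and X: "siegel_matrix j w ** u \<in> pivot_set j y s"
  obtains \<delta> where "\<delta> > 0"
    "\<And>w'. w' \<in> Hs (Suc j) \<Longrightarrow> dist w' w < \<delta> \<Longrightarrow>
       connected_component (pivot_set j y s) (siegel_matrix j w ** u) (siegel_matrix j w' ** u)"
proof -
  have "((\<lambda>w'. B (y i) ((siegel_matrix j w' ** u) *v e l)) \<longlongrightarrow> B (y i) ((siegel_matrix j w ** u) *v e l)) (nhds w)" for i l
  proof -
    have "continuous_on UNIV (\<lambda>w'. B (y i) (siegel j w' (u *v e l)))"
      by (intro continuous_on_B continuous_intros continuous_on_siegel)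
    then have "isCont (\<lambda>w'. B (y i) (siegel j w' (u *v e l))) w"
      by (simp add: continuous_on_eq_continuous_at)
    then have "((\<lambda>w'. B (y i) (siegel j w' (u *v e l))) \<longlongrightarrow> B (y i) (siegel j w (u *v e l))) (nhds w)"
      unfolding isCont_def by (rule tendsto_at_iff_tendsto_nhds[THEN iffD1])
    then show ?thesis by (simp flip: matrix_vector_mul_assoc)
  qed
  moreover have "pivots (k - j) j s (\<lambda>i l. B (y i) ((siegel_matrix j w ** u) *v e l))"
    using X by (simp add: pivot_set_def)
  ultimately have "\<forall>\<^sub>F w' in nhds w. pivots (k - j) j s (\<lambda>i l. B (y i) ((siegel_matrix j w' ** u) *v e l))"
    by (rule pivots_eventually)
  then obtain \<delta> where \<delta>: "\<delta> > 0"
    "\<And>w'. dist w' w < \<delta> \<Longrightarrow> pivots (k - j) j s (\<lambda>i l. B (y i) ((siegel_matrix j w' ** u) *v e l))"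
    unfolding eventually_nhds_metric by blast
  have "connected_component (pivot_set j y s) (siegel_matrix j w ** u) (siegel_matrix j w' ** u)"
    if w': "w' \<in> Hs (Suc j)" "dist w' w < \<delta>" for w'
  proof -
    have "closed_segment w w' \<subseteq> Hs (Suc j) \<inter> ball w \<delta>"
      using w w' \<delta>(1)
      by (intro closed_segment_subset convex_Int subspace_imp_convex[OF subspace_Hs])
         (auto simp: dist_commute)
    then have "(\<lambda>x. siegel_matrix j x ** u) ` closed_segment w w' \<subseteq> pivot_set j y s"
      using \<delta>(2) siegel_matrix_mult_UU[OF _ j u] by (auto simp: pivot_set_def dist_commute subset_iff)
    moreover have "connected ((\<lambda>x. siegel_matrix j x ** u) ` closed_segment w w')"
      by (intro connected_continuous_image continuous_on_siegel_matrix) auto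
    ultimately show ?thesis
      unfolding connected_component_def by (meson ends_in_segment imageI)
  qed
  then show ?thesis using that \<delta>(1) by blast
qed

text \<open>Over \<open>A - K\<close> the fibres \<open>Z w\<close> are connected and nonempty by
  induction, and neighbouring fibres are joined by keeping \<open>u\<close> and moving
  \<open>w\<close>; as \<open>A - K\<close> is connected, so is the part lying over it. An element
  over \<open>K\<close> is moved off \<open>K\<close> by perturbing its parameter, so nothing has to
  be known about degenerate fibres.\<close>

lemma pivot_set_connected:
  assumes "j \<le> k" "generic j y" "\<And>i. s i \<noteq> 0"
  shows "connected (pivot_set j y s) \<and> pivot_set j y s \<noteq> {}"
  using assms(1,2)
proof (induction j arbitrary: y rule: inc_induct)
  case base then show ?case by (simp add: pivot_set_def UU_k)
next
  case (step j)
  note j = step.hyps(2)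
  let ?X = "pivot_set j y s" and ?H = "Hs (Suc j)"
  define A where "A = fibre j (y j) (s j)"
  define K where "K = degenerate j y"
  define Z where "Z w = (**) (siegel_matrix j w) ` pivot_set (Suc j) (next_y j w y) s" for w
  have AH: "A \<subseteq> ?H" by (auto simp: A_def fibre_def)
  have yj: "y j \<in> Hs j" "B (y j) (y j) = 0" using step.prems j by (auto simp: generic_def)
  have A: "connected A" "A \<noteq> {}"
    unfolding A_def
    using fibre_connected[OF j yj generic_not_multiple[OF step.prems j] assms(3)] by auto
  have opA: "openin (top_of_set ?H) A" by (simp add: A_def openin_fibre)
  have K: "subspace K" "dim K + 2 < dim ?H" using dim_degenerate[OF j] by (auto simp: K_def degenerate_def)
  have AK: "connected (A - K)" by (rule connected_diff_subspace[OF subspace_Hs opA A(1) K])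
  have CU: "pivot_set i y s \<subseteq> UU i" for i y by (auto simp: pivot_set_def)
  have IH: "connected (pivot_set (Suc j) (next_y j w y) s) \<and> pivot_set (Suc j) (next_y j w y) s \<noteq> {}"
    if "w \<in> A - K" for w
    by (rule step.IH, rule generic_next) (use that step.prems j in \<open>auto simp: A_def K_def fibre_def\<close>)
  have Z: "connected (Z w)" "Z w \<subseteq> ?X" "Z w \<noteq> {}" if "w \<in> A - K" for w
  proof -
    show "connected (Z w)" "Z w \<noteq> {}" using IH[OF that] by (auto simp: Z_def intro: connected_mult_left)
    show "Z w \<subseteq> ?X"
      using siegel_matrix_mult_in_pivot_set_iff[OF _ j] that AH CU by (fastforce simp: Z_def A_def)
  qed
  have ZI: "w \<in> A \<and> siegel_matrix j w ** u \<in> Z w" if "w \<in> ?H" "u \<in> UU (Suc j)" "siegel_matrix j w ** u \<in> ?X" for w u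
    using siegel_matrix_mult_in_pivot_set_iff[OF that(1) j that(2)] that(3) by (auto simp: Z_def A_def)
  have Zcc: "connected_component ?X u u'" if "w \<in> A - K" "u \<in> Z w" "u' \<in> Z w" for w u u'
    unfolding connected_component_def using Z[OF that(1)] that by blast
  define R where "R w w' \<longleftrightarrow> w \<in> A - K \<and> w' \<in> A - K \<and>
      (\<forall>u\<in>Z w. \<forall>u'\<in>Z w'. connected_component ?X u u')" for w w'
  have R: "R a b" if ab: "a \<in> A - K" "b \<in> A - K" for a b
  proof (rule connected_equivalence_relation_gen[OF AK ab, where P = "\<lambda>_. True"])
    show "R x z" if "R x y" "R y z" for x y z
      using that Z(3)[of y] unfolding R_def by (meson connected_component_trans ex_in_conv)
    show "\<exists>T. openin (top_of_set (A - K)) T \<and> w \<in> T \<and> (\<forall>x\<in>T. \<forall>y\<in>T. True \<and> True \<longrightarrow> R x y)"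
      if w: "w \<in> A - K" for w
    proof -
      obtain u where u: "u \<in> pivot_set (Suc j) (next_y j w y) s" using IH[OF w] by blast
      have uU: "u \<in> UU (Suc j)" using u CU by blast
      have wH: "w \<in> ?H" using w AH by blast
      have X: "siegel_matrix j w ** u \<in> ?X" using Z(2)[OF w] u by (auto simp: Z_def)
      obtain \<delta> where \<delta>: "\<delta> > 0" "\<And>w'. w' \<in> ?H \<Longrightarrow> dist w' w < \<delta> \<Longrightarrow>
        connected_component ?X (siegel_matrix j w ** u) (siegel_matrix j w' ** u)"
        using pivot_set_local[OF j wH uU X] by blast
      let ?T = "(A - K) \<inter> ball w \<delta>"
      have "connected_component ?X (siegel_matrix j w ** u) g" if "x \<in> ?T" "g \<in> Z x" for x g
      proof -
        have xH: "x \<in> ?H" using that AH by blast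
        have cc: "connected_component ?X (siegel_matrix j w ** u) (siegel_matrix j x ** u)"
          using \<delta>(2)[OF xH] that by (simp add: dist_commute)
        then have "siegel_matrix j x ** u \<in> Z x" using ZI[OF xH uU] connected_component_in by blast
        then show ?thesis using cc Zcc[of x] that connected_component_trans by blast
      qed
      then have "\<forall>x\<in>?T. \<forall>y\<in>?T. R x y"
        unfolding R_def by (meson IntD1 connected_component_sym connected_component_trans)
      moreover have "openin (top_of_set (A - K)) ?T" by (simp add: openin_open_Int)
      ultimately show ?thesis using w \<delta>(1) by (meson IntI centre_in_ball)
    qed
  qed (use openin_subset in auto)
  have near: "\<exists>w\<in>A - K. \<exists>g'\<in>Z w. connected_component ?X g g'" if g: "g \<in> ?X" for g
  proof -
    obtain w u where w: "w \<in> ?H" and u: "u \<in> UU (Suc j)" and eq: "g = siegel_matrix j w ** u"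
      using UU_factor[of g j] g CU j by blast
    have X: "siegel_matrix j w ** u \<in> ?X" using g eq by simp
    obtain \<delta> where \<delta>: "\<delta> > 0" "\<And>w'. w' \<in> ?H \<Longrightarrow> dist w' w < \<delta> \<Longrightarrow>
      connected_component ?X (siegel_matrix j w ** u) (siegel_matrix j w' ** u)"
      using pivot_set_local[OF j w u X] by blast
    obtain w' where w': "w' \<in> ?H" "dist w' w < \<delta>" "w' \<notin> K"
      by (rule dense_off_subspace[OF subspace_Hs K(1) _ w \<delta>(1)]) (use K(2) in auto)
    have cc: "connected_component ?X g (siegel_matrix j w' ** u)" using \<delta>(2) w' eq by blast
    then show ?thesis using ZI[OF w'(1) u] connected_component_in w'(3) by blast
  qed
  have "connected ?X"
    unfolding connected_iff_connected_component
  proof (intro ballI)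
    fix g h assume "g \<in> ?X" "h \<in> ?X"
    then obtain w g' w' h' where "w \<in> A - K" "g' \<in> Z w" "connected_component ?X g g'"
      "w' \<in> A - K" "h' \<in> Z w'" "connected_component ?X h h'"
      using near by meson
    moreover from this have "connected_component ?X g' h'" using R[of w w'] by (simp add: R_def)
    ultimately show "connected_component ?X g h"
      by (meson connected_component_sym connected_component_trans)
  qed
  moreover have "?X \<noteq> {}"
  proof -
    obtain a where a: "a \<in> A" using A(2) by blast
    then obtain \<delta> where \<delta>: "\<delta> > 0" "\<forall>x'\<in>?H. dist x' a < \<delta> \<longrightarrow> x' \<in> A"
      using opA unfolding openin_euclidean_subtopology_iff by blast
    obtain w where "w \<in> ?H" "dist w a < \<delta>" "w \<notin> K"
      by (rule dense_off_subspace[OF subspace_Hs K(1) _ _ \<delta>(1), where w = a]) (use K(2) a AH in auto)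
    then have "w \<in> A - K" using \<delta>(2) by blast
    then show ?thesis using Z by blast
  qed
  ultimately show ?case by blast
qed

end

section \<open>Unipotent normal subgroups of the stabilizer\<close>

text \<open>The ranges of the powers drop in dimension until they stabilise, and a stable range of a
  nilpotent operator is zero. An exponent independent of \<open>T\<close> is what permits a limit of
  nilpotent operators later.\<close>

lemma nilpotent_index_le_DIM:
  fixes T :: "'a::euclidean_space \<Rightarrow> 'a"
  assumes T: "linear T" and nil: "\<And>x. (T ^^ m) x = 0"
  shows "(T ^^ DIM('a)) x = 0"
proof -
  have lin: "linear (T ^^ i)" for i
    by (induction i) (auto simp: T linear_id[unfolded id_def] id_def intro: linear_compose[unfolded o_def] linear_compose)
  define r where "r i = dim (range (T ^^ i))" for i
  have sub: "range (T ^^ Suc i) \<subseteq> range (T ^^ i)" for i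
    by (auto simp: funpow_swap1 simp del: funpow.simps simp add: funpow_Suc_right)
  have ss: "subspace (range (T ^^ i))" for i
    using linear_subspace_image[OF lin subspace_UNIV] .
  have "r i \<le> DIM('a) - i" if "i \<le> DIM('a)" for i
    using that
  proof (induction i)
    case 0 then show ?case by (simp add: r_def dim_subset_UNIV)
  next
    case (Suc i)
    show ?case
    proof (cases "r (Suc i) < r i")
      case True then show ?thesis using Suc by simp
    next
      case False
      then have eq: "range (T ^^ Suc i) = range (T ^^ i)"
        by (intro subspace_dim_equal[OF ss ss sub]) (simp only: r_def linorder_not_less)
      have "range (T ^^ (d + i)) = range (T ^^ i)" for d
      proof (induction d)
        case (Suc d)
        have "range (T ^^ (Suc d + i)) = T ` range (T ^^ (d + i))" by (simp add: image_comp)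
        also have "\<dots> = range (T ^^ Suc i)" unfolding Suc by (simp add: image_comp)
        finally show ?case using eq by simp
      qed simp
      from this[of m] have "range (T ^^ i) \<subseteq> {0}"
        using nil by (auto simp: funpow_add)
      then have "range (T ^^ Suc i) \<subseteq> {0}" using eq by simp
      then have "r (Suc i) = 0" unfolding r_def by (simp add: dim_eq_0)
      then show ?thesis by simp
    qed
  qed
  from this[of "DIM('a)"] have "range (T ^^ DIM('a)) \<subseteq> {0}"
    unfolding r_def by (simp add: dim_eq_0)
  then show ?thesis by auto
qed

context dual_frames begin

text \<open>The operator \<open>u - 1\<close> maps \<open>perp B (FF j)\<close> into
  \<open>perp B (FF (Suc j))\<close>, then \<open>perp B (FF k)\<close> into \<open>FF k\<close>,
  then each \<open>FF (Suc j)\<close> into \<open>FF j\<close>: after \<open>2 * k + 1\<close> steps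
  nothing is left.\<close>

lemma unip_unipotent:
  assumes u: "u \<in> unip" shows "unipotent u"
proof -
  define T where "T v = u *v v - v" for v
  have iso: "u \<in> isometry_group B" using u by (rule unip_isometry)
  have up: "T x \<in> perp B (FF (Suc j))" if x: "x \<in> perp B (FF j)" and j: "j < k" for x j
    unfolding perp_FF_iff
  proof (intro allI impI)
    fix l assume l: "l < Suc j"
    have "matrix_inv u *v f l - f l \<in> FF l" using unip_inv[OF u] l j by (simp add: unip_def)
    then have "matrix_inv u *v f l - f l \<in> FF j" using FF_mono[of l j] l by auto
    then have "B x (matrix_inv u *v f l - f l) = 0" using x unfolding perp_def by blast
    then show "B (T x) (f l) = 0"
      using isometry_inv_swap[OF iso, of "f l" x] by (simp add: T_def sym)
  qed
  have 1: "(T ^^ i) x \<in> perp B (FF i)" if "i \<le> k" for i x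
    using that
  proof (induction i)
    case 0 then show ?case by (simp add: perp_FF_iff)
  next
    case (Suc i) then show ?case using up[of "(T ^^ i) x" i] by simp
  qed
  have 2: "(T ^^ (i + Suc k)) x \<in> FF (k - i)" if "i \<le> k" for i x
    using that
  proof (induction i)
    case 0
    then show ?case using unip_perp[OF u 1[of k x]] T_def[of "(T ^^ k) x"] by simp
  next
    case (Suc i)
    then have "k - i = Suc (k - Suc i)" by simp
    then show ?case using Suc unip_FF_Suc[OF u, of "(T ^^ (i + Suc k)) x" "k - Suc i"]
      T_def[of "(T ^^ (i + Suc k)) x"] by simp
  qed
  have "(T ^^ (k + Suc k)) x = 0" for x using 2[of k x] by (simp add: FF_def)
  then show ?thesis unfolding unipotent_def T_def by blast
qed

text \<open>For a hyperbolic pair this is the hyperbolic rotation scaling \<open>x\<close> by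
  \<open>t\<close> and \<open>y\<close> by \<open>1 / t\<close>, the identity on the orthogonal
  complement. With \<open>x\<close>, \<open>y\<close> in \<open>Hs k\<close> it fixes both
  frames.\<close>

definition boost :: "real^'n \<Rightarrow> real^'n \<Rightarrow> real \<Rightarrow> real^'n \<Rightarrow> real^'n" where
  "boost x y t v = v + ((t - 1) * B v y) *\<^sub>R x + ((1 / t - 1) * B v x) *\<^sub>R y"

definition hyp :: "real^'n \<Rightarrow> real^'n \<Rightarrow> bool" where
  "hyp x y \<longleftrightarrow> x \<in> Hs k \<and> y \<in> Hs k \<and> B x x = 0 \<and> B y y = 0 \<and> B x y = 1"

lemma hypD: "hyp x y \<Longrightarrow> B x x = 0" "hyp x y \<Longrightarrow> B y y = 0" "hyp x y \<Longrightarrow> B x y = 1"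
  "hyp x y \<Longrightarrow> B y x = 1" "hyp x y \<Longrightarrow> x \<in> Hs k" "hyp x y \<Longrightarrow> y \<in> Hs k"
  by (simp_all add: hyp_def sym[of y x])

lemma hyp_sym: "hyp x y \<Longrightarrow> hyp y x"
  by (simp add: hyp_def sym[of y x])

lemma hyp_scale: "x \<in> Hs k \<Longrightarrow> y \<in> Hs k \<Longrightarrow> B x x = 0 \<Longrightarrow> B y y = 0 \<Longrightarrow> B x y \<noteq> 0 \<Longrightarrow>
    hyp x (inverse (B x y) *\<^sub>R y)"
  by (simp add: hyp_def subspace_scale[OF subspace_Hs])

lemma linear_boost: "linear (boost x y t)"
  by (rule linearI) (simp_all add: boost_def algebra_simps)

lemma matrix_boost: "matrix (boost x y t) *v v = boost x y t v"
  by (simp add: matrix_works linear_boost)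

lemma boost_isometry:
  assumes "hyp x y" "t \<noteq> 0"
  shows "B (boost x y t v) (boost x y t w) = B v w"
  using assms(2)
  by (simp add: boost_def hypD[OF assms(1)] sym[of x w] sym[of y w] field_simps)

lemma boost_inverse:
  assumes "hyp x y" "t \<noteq> 0"
  shows "boost x y t (boost x y (1 / t) v) = v"
proof -
  define w where "w = boost x y (1 / t) v"
  have w: "B w y = B v y / t" "B w x = t * B v x"
    by (simp_all add: w_def boost_def hypD[OF assms(1)] algebra_simps)
  have "boost x y t w = v + ((1 / t - 1) * B v y + (t - 1) * (B v y / t)) *\<^sub>R x +
      ((t - 1) * B v x + (1 / t - 1) * (t * B v x)) *\<^sub>R y"
    unfolding boost_def[of x y t w] w by (simp add: w_def boost_def scaleR_add_left)
  also have "(1 / t - 1) * B v y + (t - 1) * (B v y / t) = 0" using assms(2) by (simp add: field_simps)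
  also have "(t - 1) * B v x + (1 / t - 1) * (t * B v x) = 0" using assms(2) by (simp add: field_simps)
  finally show ?thesis by (simp add: w_def)
qed

lemma boost_fix: "B v x = 0 \<Longrightarrow> B v y = 0 \<Longrightarrow> boost x y t v = v"
  by (simp add: boost_def)

end

section \<open>Null and nonnull vectors in the middle space\<close>

context indefinite_frames begin

lemma definite1: "s \<noteq> 0 \<Longrightarrow> \<exists>c\<in>Hs k. B c a = 0 \<and> 0 < s * B c c"
  using definite[of s a] by (simp add: sym)

lemma hyp_partner:
  assumes "x \<in> Hs k" "x \<noteq> 0" "B x x = 0"
  obtains y where "hyp x y"
proof -
  obtain t where t: "t \<in> Hs k" "B x t \<noteq> 0" using Hs_nondeg[OF assms(1)] assms(2) by blast
  define y where "y = t - (B t t / (2 * B x t)) *\<^sub>R x"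
  have "y \<in> Hs k" using t assms(1) by (auto simp: y_def intro!: subspace_diff subspace_scale subspace_Hs)
  moreover have "B y y = 0" "B x y = B x t" using t assms(3) by (simp_all add: y_def sym[of t x])
  ultimately have "hyp x (inverse (B x y) *\<^sub>R y)" using assms t by (intro hyp_scale) auto
  then show ?thesis using that by blast
qed

lemma ex_hyp: "\<exists>x y. hyp x y"
proof -
  obtain a where a: "a \<in> Hs k" "0 < B a a" using definite1[of 1 0] by auto
  obtain b where b: "b \<in> Hs k" "B b a = 0" "0 < - B b b" using definite1[of "-1" a] by auto
  \<comment> \<open>The ratio balances the positive length of \<open>a\<close> against the negative
    length of \<open>b\<close>, so that \<open>x\<close> is null.\<close>
  define r where "r = sqrt (B a a / - B b b)"
  define x where "x = a + r *\<^sub>R b"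
  have "0 < B a a / - B b b" using a b by (intro divide_pos_pos) auto
  then have rr: "r * r = B a a / - B b b" by (simp only: r_def real_sqrt_mult_self abs_of_pos)
  have "B x x = B a a + r * r * B b b" using b by (simp add: x_def sym[of a b])
  also have "\<dots> = 0" unfolding rr using b by simp
  finally have 1: "B x x = 0" .
  have "B x a = B a a" using b by (simp add: x_def)
  then have "x \<noteq> 0" using a by auto
  moreover have "x \<in> Hs k" using a b by (auto simp: x_def intro!: subspace_add subspace_scale subspace_Hs)
  ultimately show ?thesis using hyp_partner 1 by blast
qed

text \<open>A vector orthogonal to the null vector \<open>x\<close> keeps its length when a multiple
  of \<open>x\<close> is subtracted, and a suitable multiple kills the pairing with
  \<open>y\<close>.\<close>

lemma ex_nonnull_perp_hyp:
  assumes "hyp x y"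
  obtains z where "z \<in> Hs k" "B z x = 0" "B z y = 0" "B z z \<noteq> 0"
proof -
  obtain c where c: "c \<in> Hs k" "B c x = 0" "0 < B c c" using definite1[of 1 x] by auto
  have "c - B c y *\<^sub>R x \<in> Hs k" using c hypD[OF assms] by (auto intro!: subspace_diff subspace_scale subspace_Hs)
  then show ?thesis using c hypD[OF assms] that[of "c - B c y *\<^sub>R x"] by (simp add: sym[of x c])
qed

lemma ex_nonnull_perp_hyp3:
  assumes h: "hyp x y" and v: "v \<in> Hs k" "B v v \<noteq> 0" "B v x = 0" "B v y = 0"
  obtains z where "z \<in> Hs k" "B z x = 0" "B z y = 0" "B z v = 0" "B z z \<noteq> 0"
proof -
  \<comment> \<open>The sign opposite to that of \<open>B v v\<close>: removing the
    \<open>v\<close>-component from \<open>c\<close> can then only enlarge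
    \<open>s * B c c\<close>.\<close>
  define s :: real where "s = - sgn (B v v)"
  have s: "s \<noteq> 0" using v by (simp add: s_def sgn_if)
  obtain c where c: "c \<in> Hs k" "B c x = 0" "0 < s * B c c" using definite1[OF s] by auto
  define c1 where "c1 = c - (B c v / B v v) *\<^sub>R v"
  have c1: "c1 \<in> Hs k" "B c1 x = 0" "B c1 v = 0"
    using c v by (auto simp: c1_def intro!: subspace_diff subspace_scale subspace_Hs)
  have eq: "B c1 c1 = B c c - (B c v)\<^sup>2 / B v v"
    using v by (simp add: c1_def sym[of v c] power2_eq_square)
  have "s * B c1 c1 = s * B c c + (B c v)\<^sup>2 * (- s / B v v)"
    unfolding eq by (simp add: algebra_simps)
  moreover have "- s / B v v \<ge> 0" using v by (simp add: s_def sgn_if)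
  ultimately have "s * B c1 c1 > 0" using c(3)
    by (smt (verit) mult_nonneg_nonneg zero_le_power2)
  then have c1n: "B c1 c1 \<noteq> 0" by auto
  define z where "z = c1 - B c1 y *\<^sub>R x"
  have "z \<in> Hs k" using c1 hypD[OF h] by (auto simp: z_def intro!: subspace_diff subspace_scale subspace_Hs)
  moreover have "B z x = 0" "B z y = 0" "B z v = 0" "B z z = B c1 c1"
    using c1 hypD[OF h] v(3) by (simp_all add: z_def sym[of x c1] sym[of x v])
  ultimately show ?thesis using that c1n by simp
qed

section \<open>Normal unipotent subgroups act trivially on the graded pieces\<close>

context
  fixes N :: "(real^'n^'n) set"
  assumes N_iso: "\<And>m. m \<in> N \<Longrightarrow> m \<in> isometry_group B"
    and N_FF: "\<And>m x j. m \<in> N \<Longrightarrow> j \<le> k \<Longrightarrow> x \<in> FF j \<Longrightarrow> m *v x \<in> FF j"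
    and N_mult: "\<And>m n. m \<in> N \<Longrightarrow> n \<in> N \<Longrightarrow> m ** n \<in> N"
    and N_inv: "\<And>m. m \<in> N \<Longrightarrow> matrix_inv m \<in> N"
    and N_conj: "\<And>m x y t. m \<in> N \<Longrightarrow> hyp x y \<Longrightarrow> 0 < t \<Longrightarrow>
        matrix (boost x y t) ** m ** matrix (boost x y (1 / t)) \<in> N"
    and N_unipotent: "\<And>m. m \<in> N \<Longrightarrow> unipotent m"
begin

lemma N_B: "m \<in> N \<Longrightarrow> B (m *v x) (m *v y) = B x y"
  by (rule isometryD[OF N_iso])

lemma N_perp:
  assumes "m \<in> N" "x \<in> perp B (FF k)" shows "m *v x \<in> perp B (FF k)"
proof -
  have "B (m *v x) y = 0" if "y \<in> FF k" for y
  proof -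
    have "B x (matrix_inv m *v y) = 0"
      using N_FF[OF N_inv[OF assms(1)] order_refl that] assms(2) by (simp add: perp_def)
    then show ?thesis using isometry_inv_swap[OF N_iso[OF assms(1)], of y x] by (simp add: sym)
  qed
  then show ?thesis by (simp add: perp_def)
qed

lemma unipotent_nil:
  assumes "unipotent (M :: real^'n^'n)" shows "((\<lambda>v. M *v v - v) ^^ CARD('n)) x = 0"
proof -
  obtain m where "\<And>x. ((\<lambda>v. M *v v - v) ^^ m) x = 0" using assms by (auto simp: unipotent_def)
  moreover have "linear (\<lambda>v. M *v v - v)"
    by (intro linear_compose_sub matrix_vector_mul_linear linear_ident)
  ultimately show ?thesis using nilpotent_index_le_DIM[of "\<lambda>v. M *v v - v" m x] by simp
qed

text \<open>With \<open>a\<close> the boost of parameter \<open>1 / t\<close>, the nilpotent operators \<open>t\<^sup>2 (a m a\<^sup>-\<^sup>1 m - 1)\<close> converge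
  as \<open>t \<rightarrow> 0\<close> to an operator with eigenvector \<open>x\<close>, whose eigenvalue must therefore vanish.\<close>

lemma N_hyp_product:
  assumes m: "m \<in> N" and h: "hyp x y"
  shows "B (m *v x) x * B (m *v y) y = 0"
proof -
  \<comment> \<open>\<open>P\<close> and \<open>Q\<close> are \<open>t\<close> times the boosts of
    parameters \<open>1 / t\<close> and \<open>t\<close>. Being polynomial in \<open>t\<close>, they
    make sense at \<open>t = 0\<close>, where they become rank-one maps.\<close>
  define P where "P t v = t *\<^sub>R v + ((1 - t) * B v y) *\<^sub>R x + ((t\<^sup>2 - t) * B v x) *\<^sub>R y" for t v
  define Q where "Q t v = t *\<^sub>R v + ((t\<^sup>2 - t) * B v y) *\<^sub>R x + ((1 - t) * B v x) *\<^sub>R y" for t v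
  define G where "G t v = P t (m *v (Q t (m *v v))) - t\<^sup>2 *\<^sub>R v" for t v
  define c where "c = B (m *v x) x * B (m *v y) y"
  have PQ: "P t v = t *\<^sub>R boost x y (1 / t) v" "Q t v = t *\<^sub>R boost x y t v" if "t > 0" for t v
    using that by (simp_all add: P_def Q_def boost_def algebra_simps power2_eq_square)
  \<comment> \<open>The exponent does not depend on \<open>t\<close>, as the limit requires.\<close>
  have zero: "(G t ^^ CARD('n)) x = 0" if t: "t > 0" for t
  proof -
    define M where "M = (matrix (boost x y (1 / t)) ** m ** matrix (boost x y t)) ** m"
    have "M \<in> N" using N_mult[OF N_conj[OF m h, of "1 / t"] m] t by (simp add: M_def)
    then have nil: "((\<lambda>v. M *v v - v) ^^ CARD('n)) x = 0"
      by (intro unipotent_nil N_unipotent)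
    have Mv: "M *v v = boost x y (1 / t) (m *v (boost x y t (m *v v)))" for v
      by (simp add: M_def matrix_boost flip: matrix_vector_mul_assoc)
    have G: "G t v = t\<^sup>2 *\<^sub>R (M *v v - v)" for v
      by (simp add: G_def PQ[OF t] Mv linear_scale[OF linear_boost] matrix_vector_mult_scaleR
          scaleR_diff_right power2_eq_square)
    have "(G t ^^ i) x = (t\<^sup>2) ^ i *\<^sub>R ((\<lambda>v. M *v v - v) ^^ i) x" for i
      by (induction i) (simp_all add: G matrix_vector_mult_scaleR algebra_simps)
    then show ?thesis using nil by simp
  qed
  have G_lim: "((\<lambda>t. G t (V t)) \<longlongrightarrow> G 0 v) (at_right 0)" if "(V \<longlongrightarrow> v) (at_right 0)" for V v
    unfolding G_def P_def Q_def
    by (intro tendsto_intros tendsto_B that bounded_linear.tendsto[OF matrix_vector_mul_bounded_linear])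
  have lim: "((\<lambda>t. (G t ^^ i) x) \<longlongrightarrow> c ^ i *\<^sub>R x) (at_right 0)" for i
  proof (induction i)
    case (Suc i)
    have G0: "G 0 (c ^ i *\<^sub>R x) = c ^ Suc i *\<^sub>R x"
      by (simp add: G_def P_def Q_def c_def matrix_vector_mult_scaleR algebra_simps)
    have "((\<lambda>t. G t ((G t ^^ i) x)) \<longlongrightarrow> G 0 (c ^ i *\<^sub>R x)) (at_right 0)"
      by (rule G_lim[OF Suc])
    then show ?case by (simp add: G0)
  qed simp
  have "\<forall>\<^sub>F t in at_right 0. (G t ^^ CARD('n)) x = 0"
    using zero by (auto simp: eventually_at_right_less intro: eventually_mono[OF eventually_at_right_less])
  then have "((\<lambda>t. (G t ^^ CARD('n)) x) \<longlongrightarrow> 0) (at_right 0)"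
    by (rule tendsto_eventually)
  then have "c ^ CARD('n) *\<^sub>R x = 0"
    using lim[of "CARD('n)"] tendsto_unique[OF trivial_limit_at_right_real] by blast
  moreover have "x \<noteq> 0" using hypD(3)[OF h] by auto
  ultimately show ?thesis by (simp add: c_def)
qed

text \<open>Each \<open>Y r\<close> with \<open>r \<noteq> 0\<close> on the null curve through
  \<open>x\<close> forms, after scaling, a hyperbolic pair with \<open>x\<close>. Were
  \<open>B (m *v x) x\<close> nonzero, \<open>N_hyp_product\<close> would make
  \<open>B (m *v Y r) (Y r)\<close> vanish for these \<open>r\<close>, and by continuity at
  \<open>r = 0\<close>, where \<open>Y r\<close> is \<open>x\<close>.\<close>

lemma N_null:
  assumes m: "m \<in> N" and x: "x \<in> Hs k" "B x x = 0"
  shows "B (m *v x) x = 0"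
proof (cases "x = 0")
  case False
  obtain y where h: "hyp x y" using hyp_partner[OF x(1) False x(2)] .
  obtain z where z: "z \<in> Hs k" "B z x = 0" "B z y = 0" "B z z \<noteq> 0"
    using ex_nonnull_perp_hyp[OF h] .
  define Y where "Y r = x + r *\<^sub>R z - (r\<^sup>2 / 2 * B z z) *\<^sub>R y" for r
  note hd = hypD[OF h] sym[of x z] sym[of y z]
  have YH: "Y r \<in> Hs k" for r
    using x z hd by (auto simp: Y_def intro!: subspace_add subspace_diff subspace_scale subspace_Hs)
  have Y0: "B (Y r) (Y r) = 0" for r using z by (simp add: Y_def hd power2_eq_square)
  have xY: "B x (Y r) \<noteq> 0" if "r \<noteq> 0" for r using z that by (simp add: Y_def hd)
  show ?thesis
  proof (rule ccontr)
    assume nz: "B (m *v x) x \<noteq> 0"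
    have "B (m *v Y r) (Y r) = 0" if "r \<noteq> 0" for r
      using N_hyp_product[OF m hyp_scale[OF x(1) YH x(2) Y0 xY[OF that]]] nz xY[OF that]
      by (simp add: matrix_vector_mult_scaleR)
    then have "\<forall>\<^sub>F r in at 0. B (m *v Y r) (Y r) = 0" by (simp add: eventually_at_filter)
    then have "((\<lambda>r. B (m *v Y r) (Y r)) \<longlongrightarrow> 0) (at 0)" by (rule tendsto_eventually)
    moreover have "((\<lambda>r. B (m *v Y r) (Y r)) \<longlongrightarrow> B (m *v Y 0) (Y 0)) (at 0)"
      unfolding Y_def
      by (intro tendsto_intros tendsto_B bounded_linear.tendsto[OF matrix_vector_mul_bounded_linear]) auto
    ultimately have "B (m *v Y 0) (Y 0) = 0" using tendsto_unique[OF trivial_limit_at] by blast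
    then show False using nz by (simp add: Y_def)
  qed
qed simp

text \<open>The quadratic form \<open>B (m *v v) v\<close> vanishes on the null cone of
  \<open>Hs k\<close>, and such a form is a multiple of \<open>B\<close>; \<open>S\<close> is its
  polar form.\<close>

lemma N_scalar:
  assumes m: "m \<in> N"
  obtains c where "\<And>v. v \<in> Hs k \<Longrightarrow> B (m *v v) v = c * B v v"
proof -
  obtain x y where h: "hyp x y" using ex_hyp by blast
  define S where "S u v = B (m *v u) v + B (m *v v) u" for u v
  have S_lin: "S (u + u') v = S u v + S u' v" "S u (v + v') = S u v + S u v'"
    "S (r *\<^sub>R u) v = r * S u v" "S u (r *\<^sub>R v) = r * S u v" for u u' v v' r
    by (simp_all add: S_def matrix_vector_right_distrib matrix_vector_mult_scaleR algebra_simps)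
  have S_sym: "S u v = S v u" for u v by (simp add: S_def)
  have S_null: "S v v = 0" if "v \<in> Hs k" "B v v = 0" for v using N_null[OF m that] by (simp add: S_def)
  have key: "S x z = 0 \<and> S z z = B z z * S x y"
    if h: "hyp x y" and z: "z \<in> Hs k" "B z x = 0" "B z y = 0" for x y z
  proof -
    note hd = hypD[OF h] sym[of x z] sym[of y z]
    have eq: "2 * r * S x z + r\<^sup>2 * (S z z - B z z * S x y) - r ^ 3 * B z z * S z y = 0" for r
    proof -
      define v where "v = x + r *\<^sub>R z + (- (r\<^sup>2 / 2 * B z z)) *\<^sub>R y"
      have "v \<in> Hs k" using z hd unfolding v_def
        by (intro subspace_add subspace_scale subspace_Hs) auto
      moreover have "B v v = 0" using z by (simp add: v_def hd power2_eq_square)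
      ultimately have "S v v = 0" by (rule S_null)
      then show ?thesis
        using S_null[OF hd(5,1)] S_null[OF hd(6,2)]
        unfolding v_def S_lin by (simp add: S_sym[of z x] S_sym[of y x] S_sym[of y z] power2_eq_square power3_eq_cube algebra_simps)
    qed
    \<comment> \<open>A cubic polynomial without constant term that vanishes at three nonzero points
      has zero coefficients.\<close>
    show ?thesis using eq[of 1] eq[of "-1"] eq[of 2] by (simp add: power2_eq_square power3_eq_cube)
  qed
  have "B (m *v v) v = (S x y / 2) * B v v" if v: "v \<in> Hs k" for v
  proof -
    define a b where "a = B v y" and "b = B v x"
    define z where "z = v - a *\<^sub>R x - b *\<^sub>R y"
    note hd = hypD[OF h]
    have z: "z \<in> Hs k" "B z x = 0" "B z y = 0"
      using v hd by (auto simp: z_def a_def b_def intro!: subspace_diff subspace_scale subspace_Hs)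
    have vv: "v = a *\<^sub>R x + b *\<^sub>R y + z" by (simp add: z_def)
    have k1: "S x z = 0" "S z z = B z z * S x y" using key[OF h z] by auto
    have k2: "S y z = 0" using key[OF hyp_sym[OF h] z(1,3,2)] by auto
    have "S v v = 2 * a * b * S x y + B z z * S x y"
      using S_null[OF hd(5,1)] S_null[OF hd(6,2)] k1 k2 unfolding vv S_lin
      by (simp add: S_sym[of z x] S_sym[of z y] S_sym[of y x])
    also have "\<dots> = S x y * B v v"
      using z unfolding vv by (simp add: hd sym[of x z] sym[of y z] algebra_simps)
    finally show ?thesis by (simp add: S_def)
  qed
  then show ?thesis using that by blast
qed

text \<open>Unipotence fixes the scalar: \<open>m - 1\<close> is nilpotent on
  \<open>perp B (FF k)\<close> modulo \<open>FF k\<close>, so it kills a nonzero class there,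
  represented by some \<open>u\<close> in \<open>Hs k\<close>. For \<open>t\<close> in
  \<open>Hs k\<close> with \<open>B u t \<noteq> 0\<close>, both \<open>B (m *v u) t\<close> and
  \<open>B (m *v t) u\<close> equal \<open>B u t\<close>, and polarisation gives
  \<open>c = 1\<close>.\<close>

lemma N_quadratic:
  assumes m: "m \<in> N" and v: "v \<in> Hs k"
  shows "B (m *v v) v = B v v"
proof -
  obtain c where c: "\<And>v. v \<in> Hs k \<Longrightarrow> B (m *v v) v = c * B v v" using N_scalar[OF m] by blast
  define T where "T v = m *v v - v" for v
  have T_perp: "T x \<in> perp B (FF k)" if "x \<in> perp B (FF k)" for x
    using that N_perp[OF m that] by (simp add: T_def subspace_diff subspace_perp)
  obtain x y where h: "hyp x y" using ex_hyp by blast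
  have x: "x \<in> Hs k" "x \<noteq> 0" using hypD[OF h] by auto
  obtain M where M: "(T ^^ M) x = 0"
    using N_unipotent[OF m] unfolding unipotent_def T_def by blast
  have Tp: "(T ^^ i) x \<in> perp B (FF k)" for i
    by (induction i) (auto simp: T_perp Hs_perp[OF x(1)])
  define i where "i = (LEAST i. (T ^^ i) x \<in> FF k)"
  have "(T ^^ i) x \<in> FF k"
    unfolding i_def by (rule LeastI[of _ M]) (simp add: M subspace_0 subspace_FF)
  moreover have "i \<noteq> 0" using Hs_Int_FF x calculation by (metis funpow_0)
  then obtain i' where i': "i = Suc i'" using not0_implies_Suc by blast
  moreover have "(T ^^ i') x \<notin> FF k"
    using not_less_Least[of i' "\<lambda>i. (T ^^ i) x \<in> FF k"] i' by (simp add: i_def)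
  ultimately obtain w where w: "w \<in> perp B (FF k)" "w \<notin> FF k" "T w \<in> FF k"
    using Tp by (metis funpow.simps(2) o_apply)
  obtain u g where ug: "w = u + g" "u \<in> Hs k" "g \<in> FF k" using perp_FF_decomp[OF w(1)] .
  have u0: "u \<noteq> 0" using w(2) ug by auto
  have "T u = T w - T g" by (simp add: T_def ug matrix_vector_right_distrib)
  moreover have "T g \<in> FF k" using N_FF[OF m _ ug(3)] ug(3) by (simp add: T_def subspace_diff subspace_FF)
  ultimately have Tu: "T u \<in> FF k" using w(3) by (simp add: subspace_diff subspace_FF)
  obtain t where t: "t \<in> Hs k" "B u t \<noteq> 0" using Hs_nondeg[OF ug(2)] u0 by blast
  have perpF: "B t z = 0" if "z \<in> FF k" for z using perp_FFD[OF Hs_perp[OF t(1)] that] .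
  have "B t (T u) = 0" by (rule perpF[OF Tu])
  then have 1: "B (m *v u) t = B u t" by (simp add: T_def sym)
  have "matrix_inv m *v u - u = - (matrix_inv m *v T u)"
    by (simp add: T_def matrix_vector_mult_diff_distrib isometry_inverse[OF N_iso[OF m]])
  moreover have "matrix_inv m *v T u \<in> FF k" using N_FF[OF N_inv[OF m] _ Tu] by simp
  ultimately have "matrix_inv m *v u - u \<in> FF k" by (simp add: subspace_neg subspace_FF)
  then have "B t (matrix_inv m *v u - u) = 0" by (rule perpF)
  then have 2: "B (m *v t) u = B u t"
    using isometry_inv_swap[OF N_iso[OF m], of u t] by (simp add: sym)
  have ut: "u + t \<in> Hs k" using ug t by (simp add: subspace_add subspace_Hs)
  have "B (m *v u) t + B (m *v t) u = c * (2 * B u t)"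
    using c[OF ut] c[OF ug(2)] c[OF t(1)] sym[of t u]
    by (simp add: matrix_vector_right_distrib algebra_simps)
  then have "c = 1" using 1 2 t by simp
  then show ?thesis using c v by simp
qed

text \<open>Let \<open>n\<close> be the commutator of \<open>m\<close> with the boost of parameter
  2. The boost fixes \<open>v\<close>, and \<open>B (n *v v) v\<close> exceeds \<open>B v v\<close>
  by half of the product in question; by \<open>N_quadratic\<close> the two are equal.\<close>

lemma N_hyp_perp:
  assumes m: "m \<in> N" and v: "v \<in> Hs k" and h: "hyp x y" and p: "B v x = 0" "B v y = 0"
  shows "B (m *v v) x * B (m *v v) y = 0"
proof -
  define n where "n = matrix_inv m ** (matrix (boost x y 2) ** m ** matrix (boost x y (1 / 2)))"
  have "n \<in> N" unfolding n_def by (intro N_mult N_inv m N_conj h) simp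
  then have 1: "B (n *v v) v = B v v" using N_quadratic v by blast
  have "n *v v = matrix_inv m *v (boost x y 2 (m *v v))"
    by (simp add: n_def matrix_boost boost_fix[OF p] flip: matrix_vector_mul_assoc)
  then have "B (n *v v) v = B (boost x y 2 (m *v v)) (m *v v)"
    using isometry_inv_swap[OF N_iso[OF m]] by simp
  also have "\<dots> = B v v + (1 / 2) * (B (m *v v) x * B (m *v v) y)"
    by (simp add: boost_def N_B[OF m] sym[of x "m *v v"] sym[of y "m *v v"])
  finally show ?thesis using 1 by simp
qed

text \<open>The component \<open>u\<close> of the displacement in \<open>Hs k\<close> is null and
  orthogonal to \<open>v\<close>. Were it nonzero, some hyperbolic pair orthogonal to
  \<open>v\<close> would have both members pairing nontrivially with \<open>u\<close>, against
  \<open>N_hyp_perp\<close>.\<close>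

lemma N_fix_nonnull:
  assumes m: "m \<in> N" and v: "v \<in> Hs k" and nn: "B v v \<noteq> 0"
  shows "m *v v - v \<in> FF k"
proof -
  have "m *v v - v \<in> perp B (FF k)"
    using N_perp[OF m Hs_perp[OF v]] Hs_perp[OF v] by (simp add: subspace_diff subspace_perp)
  then obtain u g where ug: "m *v v - v = u + g" "u \<in> Hs k" "g \<in> FF k" using perp_FF_decomp by blast
  have gH: "B g z = 0" "B z g = 0" if "z \<in> Hs k" for z
    using perp_FFD[OF Hs_perp[OF that] ug(3)] sym[of g z] by simp_all
  have gg: "B g g = 0" using FF_isotropic ug(3) by simp
  have mv: "m *v v = v + u + g" using ug(1) by (simp add: algebra_simps)
  have uv: "B u v = 0" using N_quadratic[OF m v] gH v unfolding mv by simp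
  have "B (v + u + g) (v + u + g) = B v v" using N_B[OF m, of v v] by (simp only: mv)
  then have uu: "B u u = 0" using uv gH[OF v] gH[OF ug(2)] gg sym[of v u] by simp
  have "u = 0"
  proof (rule ccontr)
    assume u0: "u \<noteq> 0"
    obtain t where t: "t \<in> Hs k" "B u t \<noteq> 0" using Hs_nondeg[OF ug(2)] u0 by blast
    define t1 where "t1 = t - (B t v / B v v) *\<^sub>R v"
    have t1: "t1 \<in> Hs k" "B t1 v = 0" "B u t1 \<noteq> 0"
      using t v nn uv by (auto simp: t1_def intro!: subspace_diff subspace_scale subspace_Hs)
    define x0 where "x0 = t1 - (B t1 t1 / (2 * B u t1)) *\<^sub>R u"
    have x0: "x0 \<in> Hs k" "B x0 x0 = 0" "B u x0 \<noteq> 0" "B x0 v = 0"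
      using t1 ug uu uv
      by (auto simp: x0_def sym[of t1 u] intro!: subspace_diff subspace_scale subspace_Hs)
    define x where "x = inverse (B u x0) *\<^sub>R x0"
    have h: "hyp u x" unfolding x_def by (rule hyp_scale[OF ug(2) x0(1) uu x0(2,3)])
    have xv: "B v x = 0" using x0(4) by (simp add: x_def sym[of v x0])
    have vu: "B v u = 0" using uv sym[of v u] by simp
    obtain z where z: "z \<in> Hs k" "B z u = 0" "B z x = 0" "B z v = 0" "B z z \<noteq> 0"
      using ex_nonnull_perp_hyp3[OF h v nn vu xv] .
    \<comment> \<open>A second null vector: like \<open>x\<close> it pairs with \<open>u\<close> to
      1, while \<open>B x y = - B z z / 2\<close> is nonzero.\<close>
    define y where "y = x + z - (B z z / 2) *\<^sub>R u"
    note hd = hypD[OF h] sym[of u z] sym[of x z] sym[of v z]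
    have y: "y \<in> Hs k" "B y y = 0" "B x y \<noteq> 0" "B v y = 0"
      using z hd xv vu by (auto simp: y_def intro!: subspace_diff subspace_add subspace_scale subspace_Hs)
    define y' where "y' = inverse (B x y) *\<^sub>R y"
    have h': "hyp x y'" unfolding y'_def using hyp_scale[of x y] y hd by simp
    have "B v y' = 0" using y by (simp add: y'_def)
    then have "B (m *v v) x * B (m *v v) y' = 0" by (intro N_hyp_perp[OF m v h'] xv)
    moreover have "B (m *v v) x = 1" using xv gH hd unfolding mv by simp
    moreover have "B u y = 1" using z uu by (simp add: y_def hd)
    then have "B (m *v v) y = 1" using y(4) gH[OF y(1)] unfolding mv by simp
    ultimately show False using y by (simp add: y'_def)
  qed
  then show ?thesis using ug by simp
qed

text \<open>A null \<open>v\<close> is the difference of the nonnull vectors \<open>v + c\<close>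
  and \<open>c\<close>, where \<open>c\<close> is orthogonal to \<open>v\<close>.\<close>

lemma N_fix:
  assumes m: "m \<in> N" and v: "v \<in> Hs k"
  shows "m *v v - v \<in> FF k"
proof (cases "B v v = 0")
  case True
  obtain c where c: "c \<in> Hs k" "B c v = 0" "0 < B c c" using definite1[of 1 v] by auto
  have "m *v (v + c) - (v + c) \<in> FF k"
    using c True v by (intro N_fix_nonnull[OF m]) (auto simp: sym[of v c] subspace_add subspace_Hs)
  moreover have "m *v c - c \<in> FF k" using c by (intro N_fix_nonnull[OF m]) auto
  ultimately have "(m *v (v + c) - (v + c)) - (m *v c - c) \<in> FF k"
    by (rule subspace_diff[OF subspace_FF])
  then show ?thesis by (simp add: matrix_vector_right_distrib)
qed (use N_fix_nonnull[OF m v] in auto)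

text \<open>On \<open>FF (Suc i)\<close> modulo \<open>FF i\<close> the map \<open>m\<close> is a
  scalar \<open>c\<close>, and nilpotence of \<open>m - 1\<close> forces
  \<open>c = 1\<close>.\<close>

lemma N_fix_frame:
  assumes m: "m \<in> N" and i: "i < k"
  shows "m *v f i - f i \<in> FF i"
proof -
  define T where "T v = m *v v - v" for v
  have T_add: "T (v + w) = T v + T w" "T (r *\<^sub>R v) = r *\<^sub>R T v" for v w r
    by (simp_all add: T_def matrix_vector_right_distrib matrix_vector_mult_scaleR algebra_simps)
  have TFF: "T x \<in> FF i" if "x \<in> FF i" for x
    using N_FF[OF m _ that] i that by (simp add: T_def subspace_diff subspace_FF)
  have "m *v f i \<in> FF (Suc i)" using N_FF[OF m _ f_in_FF] i by simp
  then have "m *v f i = (\<Sum>l<Suc i. B (m *v f i) (e l) *\<^sub>R f l)" using FF_expand[of "m *v f i" "Suc i"] i by simp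
  then obtain c g where cg: "m *v f i = c *\<^sub>R f i + g" "g \<in> FF i"
    by (metis (no_types, lifting) add.commute f_in_FF lessThan_iff subspace_FF subspace_scale subspace_sum sum.lessThan_Suc)
  have Tf: "T (f i) = (c - 1) *\<^sub>R f i + g" by (simp add: T_def cg algebra_simps)
  have "(T ^^ s) (f i) - (c - 1) ^ s *\<^sub>R f i \<in> FF i" for s
  proof (induction s)
    case (Suc s)
    define d where "d = (T ^^ s) (f i) - (c - 1) ^ s *\<^sub>R f i"
    have "(T ^^ s) (f i) = (c - 1) ^ s *\<^sub>R f i + d" by (simp add: d_def)
    then have "(T ^^ Suc s) (f i) - (c - 1) ^ Suc s *\<^sub>R f i = (c - 1) ^ s *\<^sub>R g + T d"
      by (simp add: T_add Tf algebra_simps)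
    moreover have "d \<in> FF i" using Suc by (simp add: d_def)
    ultimately show ?case using cg(2) TFF by (auto intro!: subspace_add subspace_scale subspace_FF)
  qed (simp add: subspace_0 subspace_FF)
  moreover obtain M where "(T ^^ M) (f i) = 0"
    using N_unipotent[OF m] unfolding unipotent_def T_def by blast
  ultimately have "(c - 1) ^ M *\<^sub>R f i \<in> FF i"
    by (metis diff_0 subspace_FF subspace_neg minus_minus)
  then have "B ((c - 1) ^ M *\<^sub>R f i) (e i) = 0" by (rule FF_nested_zero) (use i in auto)
  then have "c = 1" using i by (simp add: fe)
  then show ?thesis using cg by simp
qed

lemma N_subset_unip: "N \<subseteq> unip"
proof
  fix m assume m: "m \<in> N"
  have "m *v x - x \<in> FF k" if x: "x \<in> perp B (FF k)" for x
  proof -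
    obtain z g where zg: "x = z + g" "z \<in> Hs k" "g \<in> FF k" using perp_FF_decomp[OF x] .
    have "m *v x - x = (m *v z - z) + (m *v g - g)" by (simp add: zg matrix_vector_right_distrib)
    moreover have "m *v g - g \<in> FF k" using N_FF[OF m _ zg(3)] zg(3) by (simp add: subspace_diff subspace_FF)
    ultimately show ?thesis using N_fix[OF m zg(2)] by (simp add: subspace_add subspace_FF)
  qed
  then show "m \<in> unip" using N_iso[OF m] N_fix_frame[OF m] by (simp add: unip_def)
qed

end

end

section \<open>Flags and the involution\<close>

lemma flag_act_mult: "flag_act k (g ** h) F = flag_act k g (flag_act k h F)"
  by (auto simp: flag_act_def fun_eq_iff restrict_def image_image simp flip: matrix_vector_mul_assoc)

lemma flag_act_one: "F \<in> extensional {1..k} \<Longrightarrow> flag_act k (mat 1) F = F"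
  by (auto simp: flag_act_def fun_eq_iff restrict_def extensional_def)

lemma flags_extensional: "F \<in> flags B k \<Longrightarrow> F \<in> extensional {1..k}"
  by (simp add: flags_def)

context sym_form begin

lemma dim_isometry_image:
  assumes "g \<in> isometry_group B" shows "dim ((*v) g ` S) = dim S"
proof (rule dim_image_eq)
  show "inj_on ((*v) g) (span S)"
    by (rule inj_on_inverseI[where g = "(*v) (matrix_inv g)"]) (simp add: isometry_inverse[OF assms])
qed simp

lemma flag_act_flags:
  assumes "g \<in> isometry_group B" "F \<in> flags B k"
  shows "flag_act k g F \<in> flags B k"
proof -
  have "subspace ((*v) g ` F j) \<and> dim ((*v) g ` F j) = j \<and> (\<forall>x\<in>(*v) g ` F j. \<forall>y\<in>(*v) g ` F j. B x y = 0)"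
    if "j \<in> {1..k}" for j
    using assms(2) that
    by (auto simp: flags_def dim_isometry_image[OF assms(1)] isometryD[OF assms(1)]
        intro!: linear_subspace_image)
  moreover have "(*v) g ` F i \<subseteq> (*v) g ` F j" if "i \<in> {1..k}" "j \<in> {1..k}" "i \<le> j" for i j
    using assms(2) that by (intro image_mono) (auto simp: flags_def)
  ultimately show ?thesis unfolding flags_def by (auto simp: flag_act_def)
qed

lemma topspace_flag_topology: "topspace (flag_topology B k) = flags B k"
proof
  show "topspace (flag_topology B k) \<subseteq> flags B k"
    by (auto simp: topspace_def openin_flag_topology)
  have "{g \<in> SO0 B. flag_act k g F \<in> flags B k} = SO0 B" if "F \<in> flags B k" for F
    using flag_act_flags[OF SO0_isometry that] by auto
  then have "openin (flag_topology B k) (flags B k)"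
    by (simp add: openin_flag_topology)
  then show "flags B k \<subseteq> topspace (flag_topology B k)" by (rule openin_subset)
qed

lemma continuous_map_flag_act:
  assumes "S \<subseteq> SO0 B" "F \<in> flags B k"
  shows "continuous_map (top_of_set S) (flag_topology B k) (\<lambda>g. flag_act k g F)"
  unfolding continuous_map_def
proof (intro conjI allI impI)
  show "(\<lambda>g. flag_act k g F) \<in> topspace (top_of_set S) \<rightarrow> topspace (flag_topology B k)"
    using assms flag_act_flags SO0_isometry by (auto simp: topspace_flag_topology)
  fix U assume "openin (flag_topology B k) U"
  then have "openin (top_of_set (SO0 B)) {g \<in> SO0 B. flag_act k g F \<in> U}"
    using assms(2) by (simp add: openin_flag_topology)
  then obtain T where T: "open T" "{g \<in> SO0 B. flag_act k g F \<in> U} = SO0 B \<inter> T"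
    by (auto simp: openin_open)
  have "{g \<in> topspace (top_of_set S). flag_act k g F \<in> U} = S \<inter> T"
    using assms(1) T(2) by auto
  then show "openin (top_of_set S) {g \<in> topspace (top_of_set S). flag_act k g F \<in> U}" using T(1) by (auto simp: openin_open)
qed

lemma flag_stabilizer_mult:
  "g \<in> flag_stabilizer B k F \<Longrightarrow> h \<in> flag_stabilizer B k F \<Longrightarrow> g ** h \<in> flag_stabilizer B k F"
  by (simp add: flag_stabilizer_def SO0_mult flag_act_mult)

lemma flag_stabilizer_inv:
  assumes "F \<in> extensional {1..k}" "g \<in> flag_stabilizer B k F"
  shows "matrix_inv g \<in> flag_stabilizer B k F"
proof -
  have g: "g \<in> SO0 B" "flag_act k g F = F" using assms(2) by (auto simp: flag_stabilizer_def)
  have "flag_act k (matrix_inv g) F = flag_act k (matrix_inv g ** g) F"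
    by (simp only: flag_act_mult g(2))
  then have "flag_act k (matrix_inv g) F = F"
    by (simp only: isometry_inverse[OF SO0_isometry[OF g(1)]] flag_act_one[OF assms(1)])
  then show ?thesis using SO0_inv[OF g(1)] by (simp add: flag_stabilizer_def)
qed

lemma group_flag_stabilizer:
  assumes "F \<in> extensional {1..k}"
  shows "group (matrix_group (flag_stabilizer B k F))"
proof (rule groupI)
  fix x assume "x \<in> carrier (matrix_group (flag_stabilizer B k F))"
  then have x: "x \<in> flag_stabilizer B k F" by (simp add: matrix_group_def)
  then have "matrix_inv x ** x = mat 1"
    by (intro isometry_inverse SO0_isometry) (simp add: flag_stabilizer_def)
  then show "\<exists>y\<in>carrier (matrix_group (flag_stabilizer B k F)).
      y \<otimes>\<^bsub>matrix_group (flag_stabilizer B k F)\<^esub> x = \<one>\<^bsub>matrix_group (flag_stabilizer B k F)\<^esub>"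
    using flag_stabilizer_inv[OF assms x] by (auto simp: matrix_group_def)
qed (auto simp: matrix_group_def matrix_mul_assoc flag_stabilizer_mult flag_stabilizer_def[of _ _ _]
      SO0_one SO0_mult flag_act_one[OF assms] flag_act_mult)

lemma inv_flag_stabilizer:
  assumes "F \<in> extensional {1..k}" "g \<in> flag_stabilizer B k F"
  shows "inv\<^bsub>matrix_group (flag_stabilizer B k F)\<^esub> g = matrix_inv g"
proof (rule group.inv_equality[OF group_flag_stabilizer[OF assms(1)]])
  have "g \<in> isometry_group B" using assms(2) by (intro SO0_isometry) (simp add: flag_stabilizer_def)
  then show "matrix_inv g \<otimes>\<^bsub>matrix_group (flag_stabilizer B k F)\<^esub> g = \<one>\<^bsub>matrix_group (flag_stabilizer B k F)\<^esub>"
    using isometry_inverse by (simp add: matrix_group_def)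
qed (use assms flag_stabilizer_inv in \<open>auto simp: matrix_group_def\<close>)

end

section \<open>Flags in adapted frames\<close>

context dual_frames begin

definition Ffl :: "nat \<Rightarrow> (real^'n) set" where
  "Ffl = (\<lambda>j\<in>{1..k}. FF j)"

definition Efl :: "nat \<Rightarrow> (real^'n) set" where
  "Efl = (\<lambda>j\<in>{1..k}. EE j)"

lemma Ffl_extensional: "Ffl \<in> extensional {1..k}" by (simp add: Ffl_def)
lemma Efl_extensional: "Efl \<in> extensional {1..k}" by (simp add: Efl_def)

lemma flag_act_Ffl_iff:
  "flag_act k g Ffl = Ffl \<longleftrightarrow> (\<forall>j\<in>{1..k}. (*v) g ` FF j = FF j)"
proof -
  have act: "flag_act k g Ffl = (\<lambda>j\<in>{1..k}. (*v) g ` FF j)"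
    by (simp add: flag_act_def Ffl_def restrict_def fun_eq_iff)
  show ?thesis
  proof
    assume "flag_act k g Ffl = Ffl"
    then have eq: "flag_act k g Ffl j = Ffl j" for j by simp
    show "\<forall>j\<in>{1..k}. (*v) g ` FF j = FF j"
    proof
      fix j assume "j \<in> {1..k}"
      then show "(*v) g ` FF j = FF j" using eq[of j] unfolding act by (simp add: Ffl_def)
    qed
  next
    assume "\<forall>j\<in>{1..k}. (*v) g ` FF j = FF j"
    then show "flag_act k g Ffl = Ffl" unfolding act unfolding Ffl_def by (intro restrict_ext) blast
  qed
qed

lemma flag_act_Efl: "flag_act k g Efl = (\<lambda>j\<in>{1..k}. (*v) g ` EE j)"
  unfolding flag_act_def Efl_def by (auto simp: fun_eq_iff restrict_def)

lemma dim_FF: "j \<le> k \<Longrightarrow> dim (FF j) = j"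
proof (induction j)
  case 0 then show ?case by (simp add: FF_def)
next
  case (Suc j)
  have "f j \<notin> FF j" using FF_nested_zero[of "f j" j j] fe[of j j] Suc by auto
  then have "dim (insert (f j) (f ` {..<j})) = Suc (dim (f ` {..<j}))"
    by (simp add: dim_insert FF_def)
  moreover have "f ` {..<Suc j} = insert (f j) (f ` {..<j})" by (simp add: lessThan_Suc)
  ultimately show ?case using Suc by (simp add: FF_def)
qed

lemma dim_EE: "j \<le> k \<Longrightarrow> dim (EE j) = j"
  using dual_frames.dim_FF[OF dual_frames_swap] dual_frames.FF_def[OF dual_frames_swap]
  by (simp add: EE_def)

lemma Efl_flags: "Efl \<in> flags B k"
proof -
  have "B x y = 0" if "x \<in> EE j" "y \<in> EE j" "j \<le> k" for x y j
    using dual_frames.FF_isotropic[OF dual_frames_swap, of x y] that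
      dual_frames.FF_def[OF dual_frames_swap] dual_frames.FF_mono[OF dual_frames_swap, of j k]
    by (auto simp: EE_def)
  moreover have "EE i \<subseteq> EE j" if "i \<le> j" for i j
    unfolding EE_def by (intro span_mono image_mono) (use that in auto)
  ultimately show ?thesis
    by (auto simp: flags_def Efl_def dim_EE) (auto simp: EE_def)
qed

lemma unip_image_FF:
  assumes "u \<in> unip" "j \<le> k" shows "(*v) u ` FF j = FF j"
proof
  show "(*v) u ` FF j \<subseteq> FF j" using unip_FF assms by auto
  show "FF j \<subseteq> (*v) u ` FF j"
  proof
    fix x assume x: "x \<in> FF j"
    have "x = u *v (matrix_inv u *v x)" by (simp add: isometry_inverse[OF unip_isometry[OF assms(1)]])
    then show "x \<in> (*v) u ` FF j" using unip_inv_FF[OF assms x] by blast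
  qed
qed

lemma unip_stabilizer: "unip \<subseteq> flag_stabilizer B k Ffl"
proof
  fix u assume "u \<in> unip"
  then show "u \<in> flag_stabilizer B k Ffl"
    using unip_SO0 unip_image_FF[of u]
    by (simp add: flag_stabilizer_def flag_act_Ffl_iff subset_iff del: image_subset_iff)
qed

lemma stabilizer_FF:
  assumes "g \<in> flag_stabilizer B k Ffl" "j \<le> k" "x \<in> FF j"
  shows "g *v x \<in> FF j"
proof (cases "j = 0")
  case True then show ?thesis using assms(3) by (simp add: FF_def)
next
  case False
  then have "(*v) g ` FF j = FF j" using assms(1,2) by (simp add: flag_stabilizer_def flag_act_Ffl_iff)
  then show ?thesis using assms(3) by blast
qed

text \<open>The conditions defining \<open>unip\<close> depend only on the subspaces
  \<open>FF j\<close> and the form, both preserved by \<open>g\<close>.\<close>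

lemma stabilizer_conj_unip:
  assumes g: "g \<in> flag_stabilizer B k Ffl" and u: "u \<in> unip"
  shows "g ** u ** matrix_inv g \<in> unip"
proof -
  have gi: "g \<in> isometry_group B" using g by (intro SO0_isometry) (simp add: flag_stabilizer_def)
  have g': "matrix_inv g \<in> flag_stabilizer B k Ffl" using flag_stabilizer_inv[OF Ffl_extensional g] .
  have d: "(g ** u ** matrix_inv g) *v x - x = g *v (u *v (matrix_inv g *v x) - matrix_inv g *v x)" for x
    by (simp add: matrix_vector_mult_diff_distrib isometry_inverse[OF gi] flip: matrix_vector_mul_assoc)
  have "(g ** u ** matrix_inv g) *v f j - f j \<in> FF j" if "j < k" for j
    unfolding d using that stabilizer_FF[OF g', of "Suc j" "f j"] f_in_FF[of j "Suc j"]
    by (intro stabilizer_FF[OF g] unip_FF_Suc[OF u]) auto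
  moreover have "(g ** u ** matrix_inv g) *v x - x \<in> FF k" if x: "x \<in> perp B (FF k)" for x
  proof -
    have "B (matrix_inv g *v x) y = 0" if "y \<in> FF k" for y
      using isometry_inv_swap[OF gi, of x y] stabilizer_FF[OF g order_refl that] x by (simp add: perp_def)
    then have "matrix_inv g *v x \<in> perp B (FF k)" by (simp add: perp_def)
    then show ?thesis unfolding d by (intro stabilizer_FF[OF g] unip_perp[OF u]) auto
  qed
  ultimately show ?thesis
    using isometry_mult[OF isometry_mult[OF gi unip_isometry[OF u]] isometry_inv[OF gi]]
    by (simp add: unip_def)
qed

lemma unip_normal: "unip \<lhd> matrix_group (flag_stabilizer B k Ffl)"
proof -
  let ?G = "matrix_group (flag_stabilizer B k Ffl)"
  interpret G: group ?G by (rule group_flag_stabilizer[OF Ffl_extensional])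
  have "subgroup unip ?G"
  proof (rule G.subgroupI)
    show "inv\<^bsub>?G\<^esub> u \<in> unip" if "u \<in> unip" for u
      using that unip_stabilizer inv_flag_stabilizer[OF Ffl_extensional] unip_inv by auto
  qed (use unip_stabilizer unip_one unip_mult in \<open>auto simp: matrix_group_def\<close>)
  moreover have "g \<otimes>\<^bsub>?G\<^esub> u \<otimes>\<^bsub>?G\<^esub> inv\<^bsub>?G\<^esub> g \<in> unip" if "g \<in> carrier ?G" "u \<in> unip" for g u
  proof -
    have "g \<in> flag_stabilizer B k Ffl" using that by (simp add: matrix_group_def)
    then show ?thesis
      using stabilizer_conj_unip[OF _ that(2)] inv_flag_stabilizer[OF Ffl_extensional]
      by (simp add: matrix_group_def)
  qed
  ultimately show ?thesis by (simp add: G.normal_inv_iff)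
qed

text \<open>The boosts with \<open>t > 0\<close> form a connected family through the identity, and
  they fix \<open>FF k\<close> pointwise because \<open>x\<close> and \<open>y\<close> are
  orthogonal to it.\<close>

lemma boost_stabilizer:
  assumes h: "hyp x y" and t: "t > 0"
  shows "matrix (boost x y t) \<in> flag_stabilizer B k Ffl"
proof -
  let ?S = "(\<lambda>t. matrix (boost x y t)) ` {0<..}"
  have iso: "matrix (boost x y t) \<in> isometry_group B" if "t > 0" for t
    by (rule isometryI) (use that boost_isometry[OF h] in \<open>simp add: matrix_boost\<close>)
  have "continuous_on {0<..} (\<lambda>t. boost x y t z)" for z
    unfolding boost_def by (intro continuous_intros) auto
  then have "continuous_on {0<..} (\<lambda>t. matrix (boost x y t))"
    unfolding matrix_def by (intro continuous_on_vec_lambda continuous_on_component)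
  then have "connected ?S" by (intro connected_continuous_image) auto
  moreover have "matrix (boost x y 1) = mat 1" by (simp add: matrix_eq matrix_boost boost_def)
  then have "mat 1 \<in> ?S" by (metis greaterThan_iff imageI zero_less_one)
  ultimately have "?S \<subseteq> SO0 B"
    using iso SO0_one by (intro SO0_connected_subset[of ?S "mat 1"]) auto
  then have 1: "matrix (boost x y t) \<in> SO0 B" using t by auto
  have "boost x y t v = v" if "v \<in> FF j" "j \<le> k" for v j
  proof (rule boost_fix)
    have "v \<in> FF k" using that FF_mono by blast
    then show "B v x = 0" "B v y = 0"
      using perp_FFD[OF Hs_perp[OF hypD(5)[OF h]]] perp_FFD[OF Hs_perp[OF hypD(6)[OF h]]] sym by metis+
  qed
  then have "(*v) (matrix (boost x y t)) ` FF j = FF j" if "j \<le> k" for j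
    using that by (simp add: matrix_boost)
  then show ?thesis using 1 by (simp add: flag_stabilizer_def flag_act_Ffl_iff)
qed

lemma unip_inj: "inj_on (\<lambda>u. flag_act k u Efl) unip"
proof (rule inj_onI)
  fix u v assume u: "u \<in> unip" and v: "v \<in> unip" and eq: "flag_act k u Efl = flag_act k v Efl"
  note inv = isometry_inverse[OF unip_isometry[OF u]]
  define g where "g = matrix_inv u ** v"
  have g: "g \<in> unip" using u v by (simp add: g_def unip_mult unip_inv)
  have "flag_act k g Efl = flag_act k (matrix_inv u) (flag_act k u Efl)"
    by (simp add: g_def flag_act_mult eq)
  also have "\<dots> = Efl" by (simp only: flag_act_mult[symmetric] inv flag_act_one[OF Efl_extensional])
  finally have gE: "flag_act k g Efl j = Efl j" for j by simp
  have "g = mat 1"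
  proof (rule unip_fix_EE[OF g])
    fix i assume i: "i < k"
    have "(*v) g ` EE (Suc i) = flag_act k g Efl (Suc i)" using i by (simp add: flag_act_Efl)
    also have "\<dots> = EE (Suc i)" unfolding gE using i by (simp add: Efl_def)
    finally have "(*v) g ` EE (Suc i) = EE (Suc i)" .
    moreover have "e i \<in> EE (Suc i)" by (auto simp: EE_def intro: span_base)
    ultimately show "g *v e i \<in> EE (Suc i)" by blast
  qed
  then have "u ** g = u" by simp
  then show "u = v" by (simp add: g_def matrix_mul_assoc inv)
qed

text \<open>\<open>G (Suc i)\<close> has one dimension more than there are conditions
  \<open>B v (f l) = 0\<close>, and transversality keeps the remaining pairing with
  \<open>f i\<close> from vanishing.\<close>

lemma isotropic_flag_frame:
  assumes G: "G \<in> flags B k" and tr: "transverse B k G Ffl" and i: "i < k"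
  obtains v where "v \<in> G (Suc i)" "\<And>l. l < i \<Longrightarrow> B v (f l) = 0" "B v (f i) = 1"
proof -
  have GS: "subspace (G (Suc i))" "dim (G (Suc i)) = Suc i" using G i by (auto simp: flags_def)
  have "card (f ` {..<i}) \<le> i" using card_image_le[of "{..<i}" f] by simp
  then obtain c where c: "c \<in> G (Suc i)" "c \<noteq> 0" "\<And>t. t \<in> f ` {..<i} \<Longrightarrow> B c t = 0"
    using ex_nonzero_perp[OF GS(1), of "f ` {..<i}"] GS(2) by auto
  have "B c (f i) \<noteq> 0"
  proof
    assume "B c (f i) = 0"
    then have "c \<in> perp B (FF (Suc i))" using c(3) by (auto simp: perp_FF_iff less_Suc_eq)
    moreover have "G (Suc i) \<inter> perp B (FF (Suc i)) = {0}"
      using tr i by (auto simp: transverse_def Ffl_def)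
    ultimately show False using c by blast
  qed
  then show ?thesis using that[of "inverse (B c (f i)) *\<^sub>R c"] c GS(1) by (simp add: subspace_scale)
qed

text \<open>Vectors chosen from the steps of \<open>G\<close> meet the hypotheses of
  \<open>UU_transitive\<close> with \<open>j = 0\<close>, so one \<open>u\<close> carries the frame
  \<open>e\<close> onto them; equality of the flags follows by dimension.\<close>

lemma unip_surj:
  assumes G: "G \<in> flags B k" and tr: "transverse B k G Ffl"
  shows "\<exists>u\<in>unip. flag_act k u Efl = G"
proof -
  have "\<exists>v. v \<in> G (Suc i) \<and> (\<forall>l<i. B v (f l) = 0) \<and> B v (f i) = 1" if "i < k" for i
    using isotropic_flag_frame[OF G tr that] by metis
  then obtain v where v: "\<And>i. i < k \<Longrightarrow> v i \<in> G (Suc i) \<and> (\<forall>l<i. B (v i) (f l) = 0) \<and> B (v i) (f i) = 1"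
    by metis
  have mono: "G i \<subseteq> G j" if "1 \<le> i" "i \<le> j" "j \<le> k" for i j
    using G that by (auto simp: flags_def)
  have GS: "subspace (G j)" "dim (G j) = j" if "1 \<le> j" "j \<le> k" for j using G that by (auto simp: flags_def)
  have "\<exists>u\<in>UU 0. \<forall>i\<in>{0..<k}. u *v e i = v i"
  proof (rule UU_transitive)
    fix i l assume il: "i \<in> {0..<k}" "l \<in> {0..<k}"
    then have "v i \<in> G k" "v l \<in> G k" using v[of i] v[of l] mono[of "Suc i" k] mono[of "Suc l" k] by auto
    moreover have "k \<in> {1..k}" using il by simp
    ultimately show "B (v i) (v l) = 0" using G unfolding flags_def by blast
  qed (use v in \<open>auto simp: Hs_0\<close>)
  then obtain u where u: "u \<in> unip" "\<And>i. i < k \<Longrightarrow> u *v e i = v i" by (auto simp: UU_0)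
  have "(*v) u ` EE j = G j" if j: "1 \<le> j" "j \<le> k" for j
  proof (rule subspace_dim_equal)
    have "v i \<in> G j" if "i < j" for i using v[of i] mono[of "Suc i" j] that j by auto
    then have "e ` {..<j} \<subseteq> {x. u *v x \<in> G j}" using u(2) j by auto
    moreover have "subspace {x. u *v x \<in> G j}"
      using GS(1)[OF j]
      by (auto simp: subspace_def matrix_vector_right_distrib matrix_vector_mult_scaleR)
    ultimately have "EE j \<subseteq> {x. u *v x \<in> G j}" unfolding EE_def by (rule span_minimal)
    then show "(*v) u ` EE j \<subseteq> G j" by auto
    show "dim (G j) \<le> dim ((*v) u ` EE j)"
      using GS(2)[OF j] by (simp add: dim_isometry_image[OF unip_isometry[OF u(1)]] dim_EE j)
    show "subspace ((*v) u ` EE j)" by (intro linear_subspace_image) (auto simp: EE_def)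
  qed (use GS j in auto)
  then have "flag_act k u Efl = G"
    using flags_extensional[OF G] by (auto simp: flag_act_Efl fun_eq_iff restrict_def extensional_def)
  then show ?thesis using u(1) by blast
qed

lemma EE_sum: "(\<Sum>l<j. c l *\<^sub>R e l) \<in> EE j"
  unfolding EE_def by (intro span_sum span_scale span_base) auto

lemma EE_coeff: "j \<le> k \<Longrightarrow> i < j \<Longrightarrow> B (\<Sum>l<j. c l *\<^sub>R e l) (f i) = c i"
proof -
  assume a: "j \<le> k" "i < j"
  have "(\<Sum>l<j. c l * B (e l) (f i)) = (\<Sum>l<j. if l = i then c l else 0)"
    using a by (intro sum.cong) (auto simp: ef)
  then show ?thesis using a by (simp add: B_sum)
qed

lemma transverse_Ffl:
  assumes u: "u \<in> unip" shows "transverse B k (flag_act k u Efl) Ffl"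
  unfolding transverse_def
proof (intro ballI conjI)
  fix j assume j: "j \<in> {1..k}"
  have eq: "flag_act k u Efl j = (*v) u ` EE j" "Ffl j = FF j" using j by (auto simp: flag_act_Efl Ffl_def)
  have ss: "subspace ((*v) u ` EE j)" by (intro linear_subspace_image) (auto simp: EE_def)
  have "x = 0" if "x \<in> (*v) u ` EE j" "x \<in> perp B (FF j)" for x
  proof -
    obtain y where y: "x = u *v y" "y \<in> EE j" using \<open>x \<in> (*v) u ` EE j\<close> by blast
    have "B y (f l) = 0" if "l < j" for l
    proof -
      have "B (u *v y) (u *v f l) = 0"
        using \<open>x \<in> perp B (FF j)\<close> unip_FF[OF u f_in_FF[OF that]] j by (simp add: perp_def y)
      then show ?thesis by (simp add: isometryD[OF unip_isometry[OF u]])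
    qed
    then show ?thesis using EE_expand[OF y(2)] j y(1) by simp
  qed
  then show int: "flag_act k u Efl j \<inter> perp B (Ffl j) = {0}"
    unfolding eq using subspace_0[OF ss] subspace_0[OF subspace_perp] by blast
  show "{x + y |x y. x \<in> flag_act k u Efl j \<and> y \<in> perp B (Ffl j)} = UNIV"
    using int unfolding eq
    by (rule sums_perp_UNIV[OF ss])
       (use j in \<open>simp add: dim_isometry_image[OF unip_isometry[OF u]] dim_EE dim_FF\<close>)
qed

text \<open>A combination of the \<open>u *v e l\<close> with \<open>l < r\<close> is orthogonal to
  \<open>EE r\<close> exactly when its coefficients lie in the kernel of the leading block of size
  \<open>r\<close>. The condition on sums follows by dimension.\<close>

lemma transverse_Efl_iff:
  assumes u: "u \<in> isometry_group B"
  shows "transverse B k (flag_act k u Efl) Efl \<longleftrightarrow> leading_nonsing k 0 (\<lambda>i l. B (e i) (u *v e l))"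
    (is "?L \<longleftrightarrow> ?R")
proof
  have usum: "B (u *v (\<Sum>l<j. c l *\<^sub>R e l)) (e i) = (\<Sum>l<j. B (e i) (u *v e l) * c l)" for j c i
    by (simp add: linear_sum[OF matrix_vector_mul_linear] matrix_vector_mult_scaleR B_sum sym[of _ "e i"] mult.commute)
  {
    assume L: ?L
    show ?R
      unfolding leading_nonsing_def
    proof (intro allI impI ballI)
      fix r c l assume r: "r \<le> k" and l: "l \<in> {0..<0 + r}"
        and eq: "\<forall>i\<in>{0..<0 + r}. (\<Sum>l\<in>{0..<0 + r}. B (e i) (u *v e l) * c l) = 0"
      define x where "x = u *v (\<Sum>l<r. c l *\<^sub>R e l)"
      have "B x (e i) = 0" if "i < r" for i
        using eq that usum[where j = r and c = c and i = i] by (simp add: x_def atLeast0LessThan)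
      then have "x \<in> perp B (EE r)" unfolding EE_def perp_span by (auto simp: perp_def)
      moreover have "x \<in> (*v) u ` EE r" using EE_sum by (auto simp: x_def)
      moreover have "(*v) u ` EE r \<inter> perp B (EE r) = {0}"
      proof -
        have r1: "r \<in> {1..k}" using r l by auto
        have "flag_act k u Efl r = (*v) u ` EE r" "Efl r = EE r"
          using r1 by (simp_all add: flag_act_Efl) (simp add: Efl_def)
        then show ?thesis using bspec[OF L[unfolded transverse_def] r1] by simp
      qed
      ultimately have "x = 0" by blast
      then have "(\<Sum>l<r. c l *\<^sub>R e l) = 0"
        using isometry_inverse(4)[OF u, of "\<Sum>l<r. c l *\<^sub>R e l"] by (simp add: x_def)
      then show "c l = 0" using EE_coeff[OF r, of l c] l by simp
    qed
  }
  assume R: ?R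
  show ?L
    unfolding transverse_def
  proof (intro ballI conjI)
    fix j assume j: "j \<in> {1..k}"
    have eq: "flag_act k u Efl j = (*v) u ` EE j" "Efl j = EE j" using j by (simp_all add: flag_act_Efl) (simp add: Efl_def)
    have ss: "subspace ((*v) u ` EE j)" by (intro linear_subspace_image) (auto simp: EE_def)
    have "x = 0" if x: "x \<in> (*v) u ` EE j" "x \<in> perp B (EE j)" for x
    proof -
      obtain y where y: "x = u *v y" "y \<in> EE j" using x(1) by blast
      define c where "c l = B y (f l)" for l
      have yc: "y = (\<Sum>l<j. c l *\<^sub>R e l)" using EE_expand[OF y(2)] j by (simp add: c_def)
      have "(\<Sum>l\<in>{0..<0 + j}. B (e i) (u *v e l) * c l) = 0" if "i \<in> {0..<0 + j}" for i
      proof -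
        have "e i \<in> EE j" using that by (auto simp: EE_def intro: span_base)
        then have "B x (e i) = 0" using x(2) by (simp add: perp_def)
        then show ?thesis using usum[where j = j and c = c and i = i] by (simp add: y yc atLeast0LessThan)
      qed
      then have "c l = 0" if "l < j" for l
        using nonsingD[OF R, of j c l] j that by simp
      then show "x = 0" using yc y(1) by simp
    qed
    then show int: "flag_act k u Efl j \<inter> perp B (Efl j) = {0}"
      unfolding eq using subspace_0[OF ss] subspace_0[OF subspace_perp] by blast
    show "{x + y |x y. x \<in> flag_act k u Efl j \<and> y \<in> perp B (Efl j)} = UNIV"
      using int unfolding eq
      by (rule sums_perp_UNIV[OF ss]) (simp add: dim_isometry_image[OF u])
  qed
qed

text \<open>Orthogonality to the \<open>f i\<close> and to one more vector imposes
  \<open>k + 1\<close> conditions, fewer than \<open>dim S\<close>. Projecting a solution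
  \<open>c\<close> to \<open>Hs k\<close> subtracts an isotropic vector of \<open>FF k\<close>
  orthogonal to \<open>c\<close>, which preserves \<open>B c c\<close>.\<close>

lemma definite_HsI:
  assumes S: "subspace S" "k + 2 \<le> dim S" and def: "\<And>x. x \<in> S \<Longrightarrow> x \<noteq> 0 \<Longrightarrow> 0 < s * B x x"
  shows "\<exists>c\<in>Hs k. B a c = 0 \<and> 0 < s * B c c"
proof -
  \<comment> \<open>Chosen so that \<open>B c a' = B a (proj_Hs k c)\<close> for every
    \<open>c\<close> orthogonal to the \<open>f i\<close>.\<close>
  define a' where "a' = a - (\<Sum>i<k. B a (f i) *\<^sub>R e i)"
  let ?T = "insert a' (f ` {..<k})"
  have "card ?T \<le> Suc k"
    using card_insert_le_m1[of "Suc k" "f ` {..<k}" a'] card_image_le[of "{..<k}" f] by simp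
  then have "card ?T < dim S" using S(2) by linarith
  then obtain c where c: "c \<in> S" "c \<noteq> 0" "\<And>t. t \<in> ?T \<Longrightarrow> B c t = 0"
    using ex_nonzero_perp[OF S(1), of ?T] by blast
  have cf: "B c (f i) = 0" if "i < k" for i using c(3) that by simp
  define g where "g = (\<Sum>i<k. B c (e i) *\<^sub>R f i)"
  have pc: "proj_Hs k c = c - g" by (simp add: proj_Hs_def g_def cf)
  have gF: "g \<in> FF k" unfolding g_def by (auto intro!: subspace_sum subspace_scale subspace_FF f_in_FF)
  have cg: "B c g = 0" by (simp add: g_def B_sum cf)
  have "B a (proj_Hs k c) = B c a'"
    by (simp add: pc g_def a'_def B_sum sym[of a c] mult.commute)
  then have "B a (proj_Hs k c) = 0" using c(3) by simp
  moreover have "B (proj_Hs k c) (proj_Hs k c) = B c c"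
    using cg FF_isotropic[OF gF gF] by (simp add: pc sym[of g c])
  ultimately show ?thesis using proj_Hs_in[of k c] def[OF c(1,2)] by auto
qed

end

context indefinite_frames begin

lemma unipotent_radical_eq: "unipotent_radical (flag_stabilizer B k Ffl) = unip"
  unfolding unipotent_radical_def
proof (rule Greatest_equality)
  show "unip \<lhd> matrix_group (flag_stabilizer B k Ffl) \<and> connected unip \<and> (\<forall>u\<in>unip. unipotent u)"
    using unip_normal connected_UU[of 0] unip_unipotent by (simp add: UU_0)
next
  let ?G = "matrix_group (flag_stabilizer B k Ffl)"
  fix N assume "N \<lhd> ?G \<and> connected N \<and> (\<forall>u\<in>N. unipotent u)"
  then have N: "N \<lhd> ?G" "\<And>u. u \<in> N \<Longrightarrow> unipotent u" by auto
  interpret N: normal N ?G by (rule N(1))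
  have st: "m \<in> flag_stabilizer B k Ffl" if "m \<in> N" for m
    using N.subset that by (auto simp: matrix_group_def)
  have inv: "inv\<^bsub>?G\<^esub> m = matrix_inv m" if "m \<in> flag_stabilizer B k Ffl" for m
    by (rule inv_flag_stabilizer[OF Ffl_extensional that])
  show "N \<subseteq> unip"
  proof (rule N_subset_unip)
    show "m \<in> isometry_group B" if "m \<in> N" for m
      using st[OF that] by (intro SO0_isometry) (simp add: flag_stabilizer_def)
    show "m *v x \<in> FF j" if "m \<in> N" "j \<le> k" "x \<in> FF j" for m x j
      using stabilizer_FF st that by blast
    show "m ** n \<in> N" if "m \<in> N" "n \<in> N" for m n
      using subgroup.m_closed[OF N.subgroup_axioms that] by (simp add: matrix_group_def)
    show "matrix_inv m \<in> N" if "m \<in> N" for m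
      using subgroup.m_inv_closed[OF N.subgroup_axioms that] inv[OF st[OF that]] by simp
    show "matrix (boost x y t) ** m ** matrix (boost x y (1 / t)) \<in> N"
      if m: "m \<in> N" and h: "hyp x y" and t: "0 < t" for m x y t
    proof -
      let ?a = "matrix (boost x y t)"
      have a: "?a \<in> flag_stabilizer B k Ffl" by (rule boost_stabilizer[OF h t])
      have "?a ** matrix (boost x y (1 / t)) = mat 1"
        using boost_inverse[OF h, of t] t by (simp add: matrix_eq matrix_boost flip: matrix_vector_mul_assoc)
      then have "matrix_inv ?a ** (?a ** matrix (boost x y (1 / t))) = matrix_inv ?a" by simp
      then have "matrix (boost x y (1 / t)) = matrix_inv ?a"
        using a isometry_inverse(1)[of ?a]
        by (simp add: matrix_mul_assoc flag_stabilizer_def SO0_isometry)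
      then show ?thesis
        using N.inv_op_closed2[of ?a m] a m inv[OF a] by (simp add: matrix_group_def)
    qed
    show "unipotent m" if "m \<in> N" for m by (rule N(2)[OF that])
  qed
qed

lemma generic_e: "generic 0 e"
proof -
  have "c i = 0 \<and> d i = 0"
    if z: "(\<Sum>i\<in>{0..<k}. c i *\<^sub>R f i + d i *\<^sub>R e i) = 0" and i: "i \<in> {0..<k}" for c d i
  proof -
    have "B (\<Sum>i\<in>{0..<k}. c i *\<^sub>R f i + d i *\<^sub>R e i) (e i) = (\<Sum>l\<in>{0..<k}. if l = i then c l else 0)"
      unfolding B_sum by (rule sum.cong) (use i in \<open>auto simp: fe ee\<close>)
    moreover have "B (\<Sum>i\<in>{0..<k}. c i *\<^sub>R f i + d i *\<^sub>R e i) (f i) = (\<Sum>l\<in>{0..<k}. if l = i then d l else 0)"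
      unfolding B_sum by (rule sum.cong) (use i in \<open>auto simp: ff ef\<close>)
    ultimately show ?thesis using z i by simp
  qed
  then show ?thesis by (auto simp: generic_def Hs_0 ee)
qed

lemma flag_involution_eq:
  assumes "u \<in> unip"
  shows "flag_involution B k Efl Ffl (flag_act k u Efl) = flag_act k (matrix_inv u) Efl"
  by (simp add: flag_involution_def Let_def unipotent_radical_eq inv_into_f_f[OF unip_inj assms])

lemma unip_inv_connected:
  assumes u: "u \<in> unip" and tr: "transverse B k (flag_act k u Efl) Efl"
  obtains D where "connected D" "u \<in> D" "matrix_inv u \<in> D" "D \<subseteq> unip"
    "\<And>v. v \<in> D \<Longrightarrow> transverse B k (flag_act k v Efl) Efl"
proof -
  have ui: "u \<in> isometry_group B" using u by (rule unip_isometry)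
  obtain s where s: "pivots k 0 s (\<lambda>i l. B (e i) (u *v e l))"
    using tr leading_nonsing_imp_pivots unfolding transverse_Efl_iff[OF ui] by blast
  \<comment> \<open>Signs at indices from \<open>k\<close> on are untested and may be zero;
    replacing zeros by 1 meets the demand of \<open>pivot_set_connected\<close> that every sign be
    nonzero.\<close>
  define s' where "s' i = (if s i = 0 then 1 else s i)" for i
  have "B (e i) (matrix_inv u *v e l) = B (e l) (u *v e i)" for i l
    using isometry_inv_swap[OF ui, of "e l" "e i"] by (simp add: sym)
  then have s2: "pivots k 0 s (\<lambda>i l. B (e i) (matrix_inv u *v e l))"
    using s pivots_transpose[of k 0 s "\<lambda>i l. B (e i) (u *v e l)"] by simp
  have nz: "pivots m j s a \<Longrightarrow> pivots m j s' a" for m j a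
    by (induction m arbitrary: j a) (auto simp: s'_def)
  show ?thesis
  proof
    show "connected (pivot_set 0 e s')"
      using pivot_set_connected[of 0 e s'] generic_e by (auto simp: s'_def)
    show "u \<in> pivot_set 0 e s'" "matrix_inv u \<in> pivot_set 0 e s'"
      using nz[OF s] nz[OF s2] u unip_inv[OF u] by (auto simp: pivot_set_def UU_0)
    show "pivot_set 0 e s' \<subseteq> unip" by (auto simp: pivot_set_def UU_0)
    show "transverse B k (flag_act k v Efl) Efl" if "v \<in> pivot_set 0 e s'" for v
      using that pivots_imp_leading_nonsing[of k 0 s'] unfolding pivot_set_def UU_0
      by (auto simp: transverse_Efl_iff[OF unip_isometry])
  qed
qed

text \<open>The image of \<open>D\<close> under the orbit map joins a flag of \<open>C\<close> to
  its image under the involution, so the involution maps \<open>C\<close> into itself; being its own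
  inverse there, it maps \<open>C\<close> onto itself.\<close>

lemma flag_involution_component:
  assumes C: "C \<in> connected_components_of
     (subtopology (flag_topology B k) (Omega B k Efl \<inter> Omega B k Ffl))"
  shows "flag_involution B k Efl Ffl ` C = C"
proof -
  let ?O = "Omega B k Efl \<inter> Omega B k Ffl"
  let ?X = "subtopology (flag_topology B k) ?O"
  let ?i = "flag_involution B k Efl Ffl"
  have CO: "C \<subseteq> ?O"
    using connected_components_of_subset[OF C] by simp
  have key: "?i G \<in> C \<and> ?i (?i G) = G" if G: "G \<in> C" for G
  proof -
    have "G \<in> flags B k" "transverse B k G Ffl" "transverse B k G Efl"
      using CO G by (auto simp: Omega_def)
    then obtain u where u: "u \<in> unip" "flag_act k u Efl = G" using unip_surj by blast
    obtain D where D: "connected D" "u \<in> D" "matrix_inv u \<in> D" "D \<subseteq> unip"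
      "\<And>v. v \<in> D \<Longrightarrow> transverse B k (flag_act k v Efl) Efl"
      using unip_inv_connected[OF u(1)] \<open>transverse B k G Efl\<close> u(2) by blast
    let ?D = "(\<lambda>v. flag_act k v Efl) ` D"
    have "connectedin (flag_topology B k) ?D"
    proof (rule connectedin_continuous_map_image)
      show "continuous_map (top_of_set D) (flag_topology B k) (\<lambda>v. flag_act k v Efl)"
        using D(4) unip_SO0 by (intro continuous_map_flag_act Efl_flags) auto
      show "connectedin (top_of_set D) D" using D(1) by (simp add: connectedin_subtopology)
    qed
    moreover have "?D \<subseteq> ?O"
      using D(4,5) transverse_Ffl flag_act_flags[OF unip_isometry Efl_flags] by (auto simp: Omega_def)
    ultimately have cD: "connectedin ?X ?D" by (simp add: connectedin_subtopology)
    have iG: "?i G = flag_act k (matrix_inv u) Efl" using flag_involution_eq[OF u(1)] u(2) by simp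
    have GD: "G \<in> ?D" "?i G \<in> ?D" using D(2,3) u(2) iG by auto
    have "C \<inter> ?D \<noteq> {}" using G GD by blast
    then have "?D \<subseteq> C" using connected_components_of_maximal[OF C cD] by (auto simp: disjnt_def)
    then have "?i G \<in> C" using GD by blast
    moreover have "matrix_inv (matrix_inv u) = u"
    proof -
      note i = isometry_inverse[OF unip_isometry]
      have "matrix_inv (matrix_inv u) ** (matrix_inv u ** u) = u"
        unfolding matrix_mul_assoc i(1)[OF unip_inv[OF u(1)]] by simp
      then show ?thesis by (simp add: i(1)[OF u(1)])
    qed
    then have "?i (?i G) = G" unfolding iG flag_involution_eq[OF unip_inv[OF u(1)]] using u(2) by simp
    ultimately show ?thesis by blast
  qed
  show ?thesis
  proof
    show "?i ` C \<subseteq> C" using key by blast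
    show "C \<subseteq> ?i ` C" using key by (metis image_eqI subsetI)
  qed
qed

end

section \<open>Definite subspaces and adapted frames from the hypotheses\<close>

lemma span_orthogonal_definite:
  assumes B: "bilinear B" and fin: "finite P"
    and orth: "\<And>x y. x \<in> P \<Longrightarrow> y \<in> P \<Longrightarrow> x \<noteq> y \<Longrightarrow> B x y = 0"
    and pos: "\<And>x. x \<in> P \<Longrightarrow> 0 < s * B x x"
    and x: "x \<in> span P" "x \<noteq> 0"
  shows "0 < s * (B x x :: real)"
proof -
  obtain r where r: "x = (\<Sum>v\<in>P. r v *\<^sub>R v)" using x(1) fin by (auto simp: span_finite)
  have "B x x = (\<Sum>v\<in>P. \<Sum>w\<in>P. B (r v *\<^sub>R v) (r w *\<^sub>R w))"
    unfolding r by (simp add: bilinear_sum[OF B] sum.cartesian_product)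
  also have "\<dots> = (\<Sum>v\<in>P. (r v)\<^sup>2 * B v v)"
  proof (rule sum.cong)
    fix v assume v: "v \<in> P"
    have "(\<Sum>w\<in>P. B (r v *\<^sub>R v) (r w *\<^sub>R w)) = (\<Sum>w\<in>P. if w = v then (r v)\<^sup>2 * B v v else 0)"
      by (rule sum.cong)
         (use v orth in \<open>auto simp: bilinear_lmul[OF B] bilinear_rmul[OF B] power2_eq_square\<close>)
    then show "(\<Sum>w\<in>P. B (r v *\<^sub>R v) (r w *\<^sub>R w)) = (r v)\<^sup>2 * B v v" using v fin by simp
  qed simp
  finally have eq: "s * B x x = (\<Sum>v\<in>P. (r v)\<^sup>2 * (s * B v v))"
    by (simp add: sum_distrib_left mult.left_commute)
  have "\<exists>v\<in>P. r v \<noteq> 0"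
  proof (rule ccontr)
    assume "\<not> (\<exists>v\<in>P. r v \<noteq> 0)"
    then have "x = 0" unfolding r by simp
    then show False using x(2) by simp
  qed
  then obtain v where v: "v \<in> P" "r v \<noteq> 0" by blast
  show ?thesis unfolding eq
  proof (rule sum_pos2[OF fin v(1)])
    show "0 < (r v)\<^sup>2 * (s * B v v)" using v pos by simp
    show "0 \<le> (r w)\<^sup>2 * (s * B w w)" if "w \<in> P" for w
      using mult_nonneg_nonneg[OF zero_le_power2 less_imp_le[OF pos[OF that]]] .
  qed
qed

text \<open>Take \<open>e' i\<close> in step \<open>i + 1\<close> of the first flag orthogonal to
  step \<open>i\<close> of the second, and \<open>f i\<close> symmetrically. Then all off-diagonal
  pairings vanish, and transversality makes the diagonal ones nonzero, so rescaling
  suffices.\<close>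

lemma transverse_dual_frames:
  assumes S: "sym_form B" and F0: "F0 \<in> flags B k" and Finf: "Finf \<in> flags B k"
    and tr: "transverse B k F0 Finf"
  obtains e f where "dual_frames B k e f" "F0 = dual_frames.Efl k e" "Finf = dual_frames.Ffl k f"
proof -
  interpret sym_form B by (rule S)
  \<comment> \<open>Both flags are extended by the zero space at index 0, so that step
    \<open>i\<close> exists for every frame index \<open>i < k\<close>.\<close>
  define E F where "E j = (if j = 0 then {0} else F0 j)" and "F j = (if j = 0 then {0} else Finf j)" for j
  have E: "subspace (E j)" "dim (E j) = j" and F: "subspace (F j)" "dim (F j) = j" if "j \<le> k" for j
    using F0 Finf that by (auto simp: E_def F_def flags_def subspace_single_0)
  have Em: "E i \<subseteq> E j" and Fm: "F i \<subseteq> F j" if "i \<le> j" "j \<le> k" for i j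
    using that F0 Finf E(1)[of j] F(1)[of j] by (auto simp: E_def F_def flags_def subspace_0)
  have Ei: "B x y = 0" if "x \<in> E k" "y \<in> E k" for x y
  proof (cases "k = 0")
    case False
    then have "k \<in> {1..k}" "x \<in> F0 k" "y \<in> F0 k" using that by (auto simp: E_def)
    then show ?thesis using F0 unfolding flags_def by blast
  qed (use that in \<open>simp add: E_def\<close>)
  have Fi: "B x y = 0" if "x \<in> F k" "y \<in> F k" for x y
  proof (cases "k = 0")
    case False
    then have "k \<in> {1..k}" "x \<in> Finf k" "y \<in> Finf k" using that by (auto simp: F_def)
    then show ?thesis using Finf unfolding flags_def by blast
  qed (use that in \<open>simp add: F_def\<close>)
  have tEF: "x = 0" if "x \<in> E j" "j \<le> k" "\<And>y. y \<in> F j \<Longrightarrow> B x y = 0" for x j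
  proof (cases "j = 0")
    case False
    then have "j \<in> {1..k}" "x \<in> F0 j" "x \<in> perp B (Finf j)"
      using that by (auto simp: E_def F_def perp_def)
    then show ?thesis using tr unfolding transverse_def by blast
  qed (use that in \<open>simp add: E_def\<close>)
  \<comment> \<open>The reversed transversality comes from the sum being the whole space:
    \<open>x\<close> is then orthogonal to everything.\<close>
  have tFE: "x = 0" if x: "x \<in> F j" "j \<le> k" "\<And>y. y \<in> E j \<Longrightarrow> B x y = 0" for x j
  proof (cases "j = 0")
    case False
    then have U: "{x + y | x y. x \<in> F0 j \<and> y \<in> perp B (Finf j)} = UNIV"
      using tr x(2) by (simp add: transverse_def)
    show ?thesis
    proof (rule nondeg)
      fix z
      obtain a b where "z = a + b" "a \<in> F0 j" "b \<in> perp B (Finf j)" using U by blast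
      then show "B x z = 0" using x False sym[of x b] by (auto simp: E_def F_def perp_def)
    qed
  qed (use x in \<open>simp add: F_def\<close>)
  have perp_ex: "\<exists>c\<in>V. c \<noteq> 0 \<and> (\<forall>y\<in>W. B c y = 0)"
    if "subspace V" "dim W < dim V" for V W
  proof -
    have "0 < dim (V \<inter> perp B W)" using dim_Int_perp_ge[OF that(1), of W] that(2) by linarith
    then have "\<not> V \<inter> perp B W \<subseteq> {0}" by (metis dim_eq_0 less_irrefl)
    then show ?thesis by (auto simp: perp_def)
  qed
  have "\<exists>c\<in>E (Suc i). c \<noteq> 0 \<and> (\<forall>y\<in>F i. B c y = 0)" if "i < k" for i
    using perp_ex[of "E (Suc i)" "F i"] E F that by simp
  then obtain e' where e': "\<And>i. i < k \<Longrightarrow> e' i \<in> E (Suc i) \<and> e' i \<noteq> 0 \<and> (\<forall>y\<in>F i. B (e' i) y = 0)"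
    by metis
  have "\<exists>c\<in>F (Suc i). c \<noteq> 0 \<and> (\<forall>y\<in>E i. B c y = 0)" if "i < k" for i
    using perp_ex[of "F (Suc i)" "E i"] E F that by simp
  then obtain f where f: "\<And>i. i < k \<Longrightarrow> f i \<in> F (Suc i) \<and> f i \<noteq> 0 \<and> (\<forall>y\<in>E i. B (f i) y = 0)"
    by metis
  \<comment> \<open>Otherwise \<open>e' i\<close> would be orthogonal to all of
    \<open>F (Suc i)\<close>, which \<open>F i\<close> and \<open>f i\<close> span.\<close>
  have pair: "B (e' i) (f i) \<noteq> 0" if i: "i < k" for i
  proof
    assume z: "B (e' i) (f i) = 0"
    have "f i \<notin> F i" using tFE[of "f i" i] f[OF i] i by auto
    moreover have "span (F i) = F i" using F(1)[of i] i by (intro span_subspace) (auto intro: span_base)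
    ultimately have "f i \<notin> span (F i)" by (simp only: not_False_eq_True)
    then have "Suc (dim (F i)) = dim (insert (f i) (F i))" by (simp add: dim_insert)
    then have d: "dim (span (insert (f i) (F i))) = Suc i" using F(2)[of i] i by simp
    have "span (insert (f i) (F i)) = F (Suc i)"
    proof (rule subspace_dim_equal)
      show "span (insert (f i) (F i)) \<subseteq> F (Suc i)"
        using f[OF i] Fm[of i "Suc i"] F(1)[of "Suc i"] i by (intro span_minimal) auto
      show "dim (F (Suc i)) \<le> dim (span (insert (f i) (F i)))" unfolding d using F(2)[of "Suc i"] i by simp
    qed (use F(1)[of "Suc i"] i in auto)
    moreover have "span (insert (f i) (F i)) \<subseteq> {y. B (e' i) y = 0}"
      by (rule span_minimal) (use z e'[OF i] in \<open>auto simp: subspace_def\<close>)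
    ultimately have "\<And>y. y \<in> F (Suc i) \<Longrightarrow> B (e' i) y = 0" by auto
    then show False using tEF[of "e' i" "Suc i"] e'[OF i] i by auto
  qed
  define e where "e i = inverse (B (e' i) (f i)) *\<^sub>R e' i" for i
  have eE: "e i \<in> E (Suc i)" if "i < k" for i
    using e'[OF that] E(1)[of "Suc i"] that by (simp add: e_def subspace_scale)
  interpret D: dual_frames B k e f
  proof
    fix i l assume il: "i < k" "l < k"
    show "B (e i) (e l) = 0"
      using eE[OF il(1)] eE[OF il(2)] Em[of "Suc i" k] Em[of "Suc l" k] il by (intro Ei) auto
    show "B (f i) (f l) = 0"
      using f[OF il(1)] f[OF il(2)] Fm[of "Suc i" k] Fm[of "Suc l" k] il by (intro Fi) auto
    show "B (e i) (f l) = (if i = l then 1 else 0)"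
    proof (cases i l rule: linorder_cases)
      case less
      then have "e i \<in> E l" using eE[OF il(1)] Em[of "Suc i" l] il by auto
      then show ?thesis using f[OF il(2)] less sym[of "e i" "f l"] by simp
    next
      case greater
      then have "f l \<in> F i" using f[OF il(2)] Fm[of "Suc l" i] il by auto
      then show ?thesis using e'[OF il(1)] greater by (simp add: e_def)
    qed (use pair il in \<open>simp add: e_def\<close>)
  qed
  have "D.EE j = E j" if j: "j \<le> k" for j
  proof (rule subspace_dim_equal)
    have "e i \<in> E j" if "i < j" for i
      using eE[of i] Em[of "Suc i" j] that j by auto
    then show "D.EE j \<subseteq> E j"
      unfolding D.EE_def by (intro span_minimal E(1)[OF j]) auto
    show "dim (E j) \<le> dim (D.EE j)" using E(2)[OF j] D.dim_EE[OF j] by simp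
  qed (use E(1)[OF j] in \<open>simp_all add: D.EE_def\<close>)
  then have "F0 = D.Efl"
    using flags_extensional[OF F0]
    by (auto simp: D.Efl_def fun_eq_iff restrict_def extensional_def E_def)
  moreover have "D.FF j = F j" if j: "j \<le> k" for j
  proof (rule subspace_dim_equal)
    have "f i \<in> F j" if "i < j" for i
      using f[of i] Fm[of "Suc i" j] that j by auto
    then show "D.FF j \<subseteq> F j"
      unfolding D.FF_def by (intro span_minimal F(1)[OF j]) auto
    show "dim (F j) \<le> dim (D.FF j)" using F(2)[OF j] D.dim_FF[OF j] by simp
  qed (use F(1)[OF j] in \<open>simp_all add: D.FF_def\<close>)
  then have "Finf = D.Ffl"
    using flags_extensional[OF Finf]
    by (auto simp: D.Ffl_def fun_eq_iff restrict_def extensional_def F_def)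
  ultimately show ?thesis using that D.dual_frames_axioms by blast
qed

theorem proposition4p4:
  fixes B :: "real^'n \<Rightarrow> real^'n \<Rightarrow> real"
    and p q k :: nat
    and F0 Finf :: "nat \<Rightarrow> (real^'n) set"
  assumes "symmetric_form_of_signature B p q"
    and "p \<ge> q" and "q \<ge> 2"
    and "1 \<le> k" and "k < q - 1"
    and "F0 \<in> flags B k" and "Finf \<in> flags B k"
    and "transverse B k F0 Finf"
  shows "\<forall>C \<in> connected_components_of
             (subtopology (flag_topology B k) (Omega B k F0 \<inter> Omega B k Finf)).
           flag_involution B k F0 Finf ` C = C"
proof -
  obtain P N where bil: "bilinear B" and sym: "\<And>x y. B x y = B y x"
    and nd: "\<And>x. (\<And>y. B x y = 0) \<Longrightarrow> x = 0"
    and PN: "P \<inter> N = {}" "card P = p" "card N = q" "independent (P \<union> N)" "span (P \<union> N) = UNIV"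
    and orth: "\<And>x y. x \<in> P \<union> N \<Longrightarrow> y \<in> P \<union> N \<Longrightarrow> x \<noteq> y \<Longrightarrow> B x y = 0"
    and pos: "\<And>x. x \<in> P \<Longrightarrow> B x x > 0" and neg: "\<And>x. x \<in> N \<Longrightarrow> B x x < 0"
    using assms(1) unfolding symmetric_form_of_signature_def by metis
  have S: "sym_form B" by unfold_locales (use bil sym nd in auto)
  obtain e f where D: "dual_frames B k e f" and F0: "F0 = dual_frames.Efl k e"
    and Finf: "Finf = dual_frames.Ffl k f"
    using transverse_dual_frames[OF S assms(6-8)] .
  interpret D: dual_frames B k e f by (rule D)
  have fin: "finite (P \<union> N)" using PN(4) independent_imp_finite by blast
  then have finPN: "finite P" "finite N" by auto
  have "dim (P \<union> N) = card (P \<union> N)" by (rule dim_eq_card_independent[OF PN(4)])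
  moreover have "dim (P \<union> N) = CARD('n)" using PN(5) dim_span[of "P \<union> N"] by simp
  ultimately have "CARD('n) = p + q" using card_Un_disjoint[OF finPN PN(1)] PN(2,3) by simp
  \<comment> \<open>From \<open>k + 2 \<le> q\<close> and \<open>q \<le> p\<close>.\<close>
  then have large: "2 * k + 4 \<le> CARD('n)" using assms(2,5) by simp
  have dims: "dim (span P) = p" "dim (span N) = q"
    using PN independent_mono[OF PN(4)] by (auto simp: dim_eq_card_independent)
  have "\<exists>c\<in>D.Hs k. B a c = 0 \<and> 0 < s * B c c" if "s \<noteq> 0" for s a
  proof (cases "s > 0")
    case True
    have "0 < s * B x x" if "x \<in> span P" "x \<noteq> 0" for x
      by (rule span_orthogonal_definite[OF bil finPN(1) _ _ that]) (use orth pos True in auto)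
    then show ?thesis using dims assms(2,5) by (intro D.definite_HsI[of "span P"]) auto
  next
    case False
    have "0 < s * B x x" if "x \<in> span N" "x \<noteq> 0" for x
      by (rule span_orthogonal_definite[OF bil finPN(2) _ _ that])
         (use orth neg False \<open>s \<noteq> 0\<close> in \<open>auto simp: zero_less_mult_iff\<close>)
    then show ?thesis using dims assms(5) by (intro D.definite_HsI[of "span N"]) auto
  qed
  then interpret I: indefinite_frames B k e f by unfold_locales (use large in auto)
  show ?thesis unfolding F0 Finf using I.flag_involution_component by blast
qed

end
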